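(* Let $\sigma_x,\sigma_k>0$, let $M_{i,j}(x,k)\in\mathcal{S}'(\mathbb{R}^{2n})$, $i,j=1,\dots,d$, and let $M=M(x,\partial_x)$ be the matrix of operators with Weyl symbols $M_{i,j}(x,k)$. Let $u(x,t)$ be a wavefield with components $u_i(\cdot,t)\in\mathcal{S}(\mathbb{R}^n)$, $i=1,\dots,d$. Then the quadratic observable $$\mathbb{M}(t)=\int_{y\in\mathbb{R}^n}\bar u^T(y,t)\,Mu(y,t)\,dy$$ can be expressed directly in terms of the smoothed Wigner distribution of $u$ as $$\mathbb{M}(t)=\int_{x,k\in\mathbb{R}^n}\operatorname{tr}\left(\tilde{\mathcal{M}}\,\tilde W[u](x,k,t)\right)dx\,dk.$$ Moreover, the observable can be resolved over phase space at coarse scale by $$\tilde{\mathbb{M}}(x,k,t)=\operatorname{tr}\left(\tilde{\mathcal{M}}\,\tilde W[u](x,k,t)\right),$$ consistently with its natural resolutions: $$\int_{k\in\mathbb{R}^n}\tilde{\mathbb{M}}(x,k,t)\,dk=\frac{\sqrt2^{\,n}}{\sigma_x^n}\int_{x'\in\mathbb{R}^n}e^{-\frac{2\pi(x-x')^2}{\sigma_x^2}}\,\bar u^T(x',t)\,Mu(x',t)\,dx'$$ and $$\int_{x\in\mathbb{R}^n}\tilde{\mathbb{M}}(x,k,t)\,dx=\frac{\sqrt2^{\,n}}{\sigma_k^n}\int_{k'\in\mathbb{R}^n}e^{-\frac{2\pi(k-k')^2}{\sigma_k^2}}\,\bar{\hat u}^T(k',t)\,\widehat{Mu}(k',t)\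,dk'.$$
   Context: Fourier transform: $\hat f(k)=\int_{\mathbb{R}^n}e^{-2\pi i k\cdot x}f(x)\,dx$. An operator with (scalar) Weyl symbol $a(x,k)$ is $f\mapsto\int_{y,k\in\mathbb{R}^n}e^{2\pi i k(x-y)}a\left(\frac{x+y}{2},k\right)f(y)\,dy\,dk$; for matrices, entrywise. The smoothed Wigner transform of scalar functions is $$\tilde W[f,g](x,k)=\left(\frac{\sqrt2}{\sigma_x}\right)^n\int_{u,y\in\mathbb{R}^n}e^{-2\pi i k y-\frac{\pi\sigma_k^2y^2}{2}-\frac{2\pi(u-x)^2}{\sigma_x^2}}\,f\left(u+\frac y2\right)\bar g\left(u-\frac y2\right)du\,dy;$$ for $\mathbb{C}^d$-valued functions it is the $d\times d$ matrix with entries $\tilde W[f,g]_{i,j}=\tilde W[f_i,g_j]$; $\tilde W[u](x,k,t)=\tilde W[u(\cdot,t),u(\cdot,t)](x,k)$. $\tilde{\mathcal{M}}$ is the $d\times d$ matrix of operators $$\tilde{\mathcal{M}}_{i,j}w(x,k)=\int_{S,T\in\mathbb{R}^n}\hat M_{i,j}(S,T)\,e^{2\pi i(Sx+Tk)-\frac{\pi}{2}(\sigma_x^2S^2+\sigma_k^2T^2)}\,w\left(x+\frac{T+i\sigma_x^2S}{2},k-\frac{S-i\sigma_k^2T}{2}\right)dS\,dT,$$ with $\hat M_{i,j}$ the Fourier transform of $M_{i,j}(x,k)$ in both variables; it acts on $w=\tilde W[f,g]$, $f,g\in\mathcal{S}(\mathbb{R}^n)$, which extends to an entire function. $\tilde{\mathcal{M}}\tilde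 W$ is the matrix product $(\tilde{\mathcal{M}}\tilde W)_{i,j}=\sum_l\tilde{\mathcal{M}}_{i,l}\tilde W_{l,j}$. Integrals involving $Mu$ (in general a tempered distribution) are understood in the sense of duality pairings. *)

theory Defs
  imports "HOL-Analysis.Analysis"
begin

section \<open>Schwartz functions and tempered distributions\<close>

primrec iter_partial ::
  "'a::euclidean_space list \<Rightarrow> ('a \<Rightarrow> complex) \<Rightarrow> 'a \<Rightarrow> complex" where
  "iter_partial [] f = f"
| "iter_partial (b # bs) f = (\<lambda>x. frechet_derivative (iter_partial bs f) (at x) b)"

definition schwartz_weight ::
  "nat \<Rightarrow> 'a::euclidean_space list \<Rightarrow> ('a \<Rightarrow> complex) \<Rightarrow> 'a \<Rightarrow> real" where
  "schwartz_weight N bs f x = (1 + norm x) ^ N * cmod (iter_partial bs f x)"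

text \<open>Lists of basis vectors play the role of multi-indices. Differentiability of all iterated
  partial derivatives is \<open>C\<^sup>\<infinity>\<close> smoothness.\<close>

definition schwartz :: "('a::euclidean_space \<Rightarrow> complex) \<Rightarrow> bool" where
  "schwartz f \<longleftrightarrow>
     (\<forall>bs. set bs \<subseteq> Basis \<longrightarrow>
        (\<forall>x. iter_partial bs f differentiable (at x)) \<and>
        (\<forall>N. bdd_above (range (schwartz_weight N bs f))))"

definition schwartz_seminorm :: "nat \<Rightarrow> ('a::euclidean_space \<Rightarrow> complex) \<Rightarrow> real" where
  "schwartz_seminorm N f =
     (\<Sum>bs | set bs \<subseteq> (Basis :: 'a set) \<and> length bs \<le> N. SUP x. schwartz_weight N bs f x)"

text \<open>A distribution is a functional on all functions of which only the values on Schwartz functions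
  are constrained; on other arguments it is arbitrary, so nothing can be deduced about a pairing
  unless the function paired with is Schwartz. The last conjunct is continuity for
  the topology of the increasing family \<^const>\<open>schwartz_seminorm\<close>.
  The pairing is bilinear (no complex conjugation).\<close>

type_synonym 'a functional = "('a \<Rightarrow> complex) \<Rightarrow> complex"

definition tempered_distribution :: "('a::euclidean_space) functional \<Rightarrow> bool" where
  "tempered_distribution T \<longleftrightarrow>
     (\<forall>f g. schwartz f \<longrightarrow> schwartz g \<longrightarrow> T (\<lambda>x. f x + g x) = T f + T g) \<and>
     (\<forall>c f. schwartz f \<longrightarrow> T (\<lambda>x. c * f x) = c * T f) \<and>
     (\<exists>C N. \<forall>f. schwartz f \<longrightarrow> cmod (T f) \<le> C * schwartz_seminorm N f)"

definition fourier :: "('a::euclidean_space \<Rightarrow> complex) \<Rightarrow> 'a \<Rightarrow> complex" where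
  "fourier f k = (\<integral>x. exp (- 2 * of_real pi * \<i> * of_real (k \<bullet> x)) * f x \<partial>lborel)"

definition fourier_dist :: "('a::euclidean_space) functional \<Rightarrow> 'a functional" where
  "fourier_dist T = (\<lambda>\<phi>. T (fourier \<phi>))"

section \<open>Weyl operators\<close>

type_synonym 'n phase = "(real^'n) \<times> (real^'n)"

text \<open>Pairing \<open>\<integral> e\<^bsup>2\<pi>ik(x-y)\<^esup> a((x+y)/2, k) f(y) dy dk\<close> with \<open>\<phi>(x)\<close> and substituting
  \<open>x = q + z/2\<close>, \<open>y = q - z/2\<close> (of Jacobian 1) leaves the pairing of \<open>a(q,k)\<close> with the
  function below; this defines the operator for a distributional symbol.\<close>

definition weyl_op ::
  "'n::finite phase functional \<Rightarrow> (real^'n \<Rightarrow> complex) \<Rightarrow> (real^'n) functional" where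
  "weyl_op a f = (\<lambda>\<phi>. a (\<lambda>(q, k).
     \<integral>z. exp (2 * of_real pi * \<i> * of_real (k \<bullet> z))
          * \<phi> (q + (1/2) *\<^sub>R z) * f (q - (1/2) *\<^sub>R z) \<partial>lborel))"

definition weyl_matrix_op ::
  "('n::finite phase functional)^'d^'d \<Rightarrow> (real^'n \<Rightarrow> complex^'d::finite)
     \<Rightarrow> ((real^'n) functional)^'d" where
  "weyl_matrix_op M f = (\<chi> i. (\<lambda>\<phi>. \<Sum>j\<in>UNIV. weyl_op (M $ i $ j) (\<lambda>x. f x $ j) \<phi>))"

text \<open>\<open>\<integral> \<phi>\<^sup>T V\<close> for a vector \<open>V\<close> of distributions and a vector-valued test function \<open>\<phi>\<close>.\<close>

definition vec_pairing ::
  "(('a::euclidean_space) functional)^'d::finite \<Rightarrow> ('a \<Rightarrow> complex^'d) \<Rightarrow> complex" where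
  "vec_pairing V \<phi> = (\<Sum>i\<in>UNIV. (V $ i) (\<lambda>x. \<phi> x $ i))"

definition cnj_vec :: "complex^'d::finite \<Rightarrow> complex^'d" where
  "cnj_vec v = (\<chi> i. cnj (v $ i))"

definition vec_fourier ::
  "('a::euclidean_space \<Rightarrow> complex^'d::finite) \<Rightarrow> 'a \<Rightarrow> complex^'d" where
  "vec_fourier f k = (\<chi> i. fourier (\<lambda>x. f x $ i) k)"

definition vec_fourier_dist ::
  "(('a::euclidean_space) functional)^'d::finite \<Rightarrow> ('a functional)^'d" where
  "vec_fourier_dist V = (\<chi> i. fourier_dist (V $ i))"

section \<open>Smoothed Wigner transform\<close>

definition swt ::
  "real \<Rightarrow> real \<Rightarrow> (real^'n::finite \<Rightarrow> complex) \<Rightarrow> (real^'n \<Rightarrow> complex) \<Rightarrow> 'n phase \<Rightarrow> complex" where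
  "swt \<sigma>x \<sigma>k f g = (\<lambda>(x, k).
     of_real ((sqrt 2 / \<sigma>x) ^ CARD('n)) *
     (\<integral>(u, y). exp (- 2 * of_real pi * \<i> * of_real (k \<bullet> y)
                    - of_real (pi * \<sigma>k\<^sup>2 * (norm y)\<^sup>2 / 2)
                    - of_real (2 * pi * (norm (u - x))\<^sup>2 / \<sigma>x\<^sup>2))
               * f (u + (1/2) *\<^sub>R y) * cnj (g (u - (1/2) *\<^sub>R y)) \<partial>lborel))"

definition swt_matrix ::
  "real \<Rightarrow> real \<Rightarrow> (real^'n::finite \<Rightarrow> complex^'d::finite) \<Rightarrow> (real^'n \<Rightarrow> complex^'d)
     \<Rightarrow> 'n phase \<Rightarrow> complex^'d^'d" where
  "swt_matrix \<sigma>x \<sigma>k f g p = (\<chi> i j. swt \<sigma>x \<sigma>k (\<lambda>x. f x $ i) (\<lambda>x. g x $ j) p)"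

section \<open>Entire extension and the smoothed operators\<close>

definition of_real_vec :: "real^'n::finite \<Rightarrow> complex^'n" where
  "of_real_vec x = (\<chi> j. of_real (x $ j))"

definition entire :: "((complex^'n::finite) \<times> (complex^'n) \<Rightarrow> complex) \<Rightarrow> bool" where
  "entire F \<longleftrightarrow>
     (\<forall>p. \<exists>L. (F has_derivative L) (at p) \<and> (\<forall>c v w. L (c *s v, c *s w) = c * L (v, w)))"

definition entire_extension ::
  "('n::finite phase \<Rightarrow> complex) \<Rightarrow> (complex^'n) \<times> (complex^'n) \<Rightarrow> complex" where
  "entire_extension w =
     (THE F. entire F \<and> (\<forall>x k. F (of_real_vec x, of_real_vec k) = w (x, k)))"

text \<open>The integral over \<open>(S, T)\<close> against the Fourier transform of the symbol is the pairing
  with that tempered distribution.\<close>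

definition smoothed_op ::
  "real \<Rightarrow> real \<Rightarrow> 'n::finite phase functional \<Rightarrow> ('n phase \<Rightarrow> complex) \<Rightarrow> 'n phase \<Rightarrow> complex" where
  "smoothed_op \<sigma>x \<sigma>k a w = (\<lambda>(x, k). fourier_dist a (\<lambda>(S, T).
     exp (2 * of_real pi * \<i> * of_real (S \<bullet> x + T \<bullet> k)
          - of_real (pi / 2 * (\<sigma>x\<^sup>2 * (norm S)\<^sup>2 + \<sigma>k\<^sup>2 * (norm T)\<^sup>2)))
     * entire_extension w
         (\<chi> j. of_real (x $ j) + (of_real (T $ j) + \<i> * of_real (\<sigma>x\<^sup>2 * S $ j)) / 2,
          \<chi> j. of_real (k $ j) - (of_real (S $ j) - \<i> * of_real (\<sigma>k\<^sup>2 * T $ j)) / 2)))"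

definition smoothed_op_matrix ::
  "real \<Rightarrow> real \<Rightarrow> ('n::finite phase functional)^'d^'d
     \<Rightarrow> (('n phase \<Rightarrow> complex) \<Rightarrow> 'n phase \<Rightarrow> complex)^'d^'d::finite" where
  "smoothed_op_matrix \<sigma>x \<sigma>k M = (\<chi> i j. smoothed_op \<sigma>x \<sigma>k (M $ i $ j))"

definition op_matrix_mult ::
  "(('a \<Rightarrow> complex) \<Rightarrow> 'a \<Rightarrow> complex)^'d^'d \<Rightarrow> ('a \<Rightarrow> complex^'d^'d::finite)
     \<Rightarrow> 'a \<Rightarrow> complex^'d^'d" where
  "op_matrix_mult A W p = (\<chi> i j. \<Sum>l\<in>UNIV. (A $ i $ l) (\<lambda>q. W q $ l $ j) p)"

section \<open>Observables\<close>

definition observable ::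
  "('n::finite phase functional)^'d^'d \<Rightarrow> (real^'n \<Rightarrow> complex^'d::finite) \<Rightarrow> complex" where
  "observable M v = vec_pairing (weyl_matrix_op M v) (\<lambda>y. cnj_vec (v y))"

definition smoothed_observable ::
  "real \<Rightarrow> real \<Rightarrow> ('n::finite phase functional)^'d^'d \<Rightarrow> (real^'n \<Rightarrow> complex^'d::finite)
     \<Rightarrow> 'n phase \<Rightarrow> complex" where
  "smoothed_observable \<sigma>x \<sigma>k M v p =
     trace (op_matrix_mult (smoothed_op_matrix \<sigma>x \<sigma>k M) (swt_matrix \<sigma>x \<sigma>k v v) p)"

end

theory Submission
  imports Defs "HOL-Probability.Characteristic_Functions" "HOL-Probability.Sinc_Integral"
    "HOL-Complex_Analysis.Conformal_Mappings" "HOL-Real_Asymp.Real_Asymp"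
begin

text \<open>
  Let \<open>f\<close>, \<open>g\<close> be two components of \<open>u\<close> and \<open>a\<close> an entry of the symbol matrix; by linearity it
  is enough to treat the scalar expression \<open>smoothed_op \<sigma>x \<sigma>k a (swt \<sigma>x \<sigma>k f g)\<close>.

  The entire extension of \<open>swt \<sigma>x \<sigma>k f g\<close> is the same Gaussian integral with complex position and
  momentum (\<open>entire_extension_swt\<close>). At the shifted arguments that occur in the smoothed operator, its
  exponent combines with the Gaussian prefactor into the exponent at the real point, translated by
  \<open>T\<close>, and a pure phase in \<open>S\<close> (\<open>swt_exponent_shift\<close>). Fourier inversion
  in \<open>S\<close> shows that the smoothed operator at \<open>(x, k)\<close> pairs \<open>a\<close> with one explicit function of
  \<open>(X, K)\<close>, a partial Fourier transform of \<open>wigner_kernel\<close> (\<open>smoothed_op_swt\<close>). In other words the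
  smoothed operator localises the Weyl pairing \<open>weyl_op a f (cnj \<circ> g)\<close> near \<open>(x, k)\<close>.

  The three identities then say that these local pairings integrate to the right thing over
  \<open>(x, k)\<close>, over \<open>k\<close>, and over \<open>x\<close>. This splits into two facts. A tempered distribution commutes
  with the integral of a family of test functions that is Schwartz jointly in the parameter and the
  variable (\<open>tempered_parameter_integral\<close>, by Riemann sums). And the integrals of the family
  itself are elementary: the integral over \<open>k\<close> is evaluated by Fourier inversion, the one over
  \<open>x\<close> is the mass of a Gaussian.

  The joint Schwartz property holds because \<open>wigner_kernel\<close> is a tensor product of Schwartz functions
  and Gaussians composed with an injective linear map, and partial Fourier transforms preserve
  Schwartz functions (\<open>schwartz_partial_fourier\<close>). These closure properties are proved by coinduction
  (\<open>schwartz_coinduct_lin\<close>).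
\<close>

text \<open>
  From here on the dollar sign selects the components of vectors only.
\<close>

no_notation fps_nth (infixl \<open>$\<close> 75)

section \<open>Coinduction for Schwartz functions\<close>

lemma iter_partial_snoc:
  "iter_partial (bs @ [b]) f = iter_partial bs (\<lambda>x. frechet_derivative f (at x) b)"
  by (induction bs) auto

lemma schwartz_differentiable: "schwartz f \<Longrightarrow> f differentiable (at x)"
  unfolding schwartz_def by (drule spec[of _ "[]"]) auto

lemma schwartz_partial:
  assumes "schwartz f" "b \<in> Basis"
  shows "schwartz (\<lambda>x. frechet_derivative f (at x) b)"
  unfolding schwartz_def
proof (intro allI impI)
  fix bs :: "'a list" assume "set bs \<subseteq> Basis"
  with assms have "set (bs @ [b]) \<subseteq> Basis" by auto
  moreover have "schwartz_weight N bs (\<lambda>x. frechet_derivative f (at x) b) = schwartz_weight N (bs @ [b]) f" for N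
    by (simp add: fun_eq_iff schwartz_weight_def iter_partial_snoc)
  ultimately show "(\<forall>x. iter_partial bs (\<lambda>x. frechet_derivative f (at x) b) differentiable at x) \<and>
    (\<forall>N. bdd_above (range (schwartz_weight N bs (\<lambda>x. frechet_derivative f (at x) b))))"
    using assms(1) unfolding schwartz_def iter_partial_snoc[symmetric] by metis
qed

lemma schwartz_iter_partial:
  "schwartz f \<Longrightarrow> set bs \<subseteq> Basis \<Longrightarrow> schwartz (iter_partial bs f)"
  by (induction bs) (auto intro: schwartz_partial)

lemma schwartz_decay:
  assumes "schwartz f"
  obtains C where "C \<ge> 0" "\<And>x. (1 + norm x) ^ N * cmod (f x) \<le> C"
proof -
  have "bdd_above (range (schwartz_weight N [] f))"
    using assms unfolding schwartz_def by (metis empty_set empty_subsetI)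
  then obtain C where C: "\<And>x. (1 + norm x) ^ N * cmod (f x) \<le> C"
    unfolding bdd_above_def schwartz_weight_def by auto
  have "0 \<le> (1 + norm (0::'a)) ^ N * cmod (f 0)" by simp
  also have "\<dots> \<le> C" by (rule C)
  finally show thesis using C that by blast
qed

text \<open>
  The "up to linear combinations" part of the coinduction principle: product and chain rules
  produce sums of functions of the same shape, rarely a single one.
\<close>

inductive lin_closure :: "(('a \<Rightarrow> complex) \<Rightarrow> bool) \<Rightarrow> ('a \<Rightarrow> complex) \<Rightarrow> bool"
  for P :: "('a \<Rightarrow> complex) \<Rightarrow> bool" where
  lin_base: "P f \<Longrightarrow> lin_closure P f"
| lin_zero: "lin_closure P (\<lambda>x. 0)"
| lin_add: "lin_closure P f \<Longrightarrow> lin_closure P g \<Longrightarrow> lin_closure P (\<lambda>x. f x + g x)"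
| lin_scale: "lin_closure P f \<Longrightarrow> lin_closure P (\<lambda>x. c * f x)"

lemma lin_closure_sum:
  "finite I \<Longrightarrow> (\<And>i. i \<in> I \<Longrightarrow> lin_closure P (f i)) \<Longrightarrow> lin_closure P (\<lambda>x. \<Sum>i\<in>I. f i x)"
  by (induction I rule: finite_induct) (auto intro: lin_zero lin_add)

lemma partial_add:
  assumes "f differentiable at x" "g differentiable at x"
  shows "frechet_derivative (\<lambda>x. f x + g x) (at x) b =
    frechet_derivative f (at x) b + frechet_derivative g (at x) b"
proof -
  have "((\<lambda>x. f x + g x) has_derivative
     (\<lambda>h. frechet_derivative f (at x) h + frechet_derivative g (at x) h)) (at x)"
    by (intro derivative_intros) (use assms in \<open>simp_all flip: frechet_derivative_works\<close>)
  from frechet_derivative_at[OF this] show ?thesis by (metis (no_types, lifting))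
qed

lemma partial_scale:
  fixes c :: complex
  assumes "f differentiable at x"
  shows "frechet_derivative (\<lambda>x. c * f x) (at x) b = c * frechet_derivative f (at x) b"
proof -
  have "((\<lambda>x. c * f x) has_derivative (\<lambda>h. c * frechet_derivative f (at x) h)) (at x)"
    by (intro derivative_intros) (use assms in \<open>simp_all flip: frechet_derivative_works\<close>)
  from frechet_derivative_at[OF this] show ?thesis by (metis (no_types, lifting))
qed

text \<open>
  The definition of Schwartz functions speaks of all iterated partial derivatives at once. It suffices
  instead to exhibit a class of differentiable, rapidly decreasing functions whose partial derivatives
  are linear combinations of members: such a class is stable under all iterated derivatives. The
  basic closure properties below are proved by naming the class of functions that they produce.
\<close>

lemma schwartz_coinduct_lin:
  fixes f :: "'a::euclidean_space \<Rightarrow> complex"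
  assumes f: "lin_closure P f"
    and diff: "\<And>f x. P f \<Longrightarrow> f differentiable (at x)"
    and dec: "\<And>f N. P f \<Longrightarrow> \<exists>C. \<forall>x. (1 + norm x) ^ N * cmod (f x) \<le> C"
    and step: "\<And>f b. P f \<Longrightarrow> b \<in> Basis \<Longrightarrow> lin_closure P (\<lambda>x. frechet_derivative f (at x) b)"
  shows "schwartz f"
proof -
  have D: "f differentiable (at x)" if "lin_closure P f" for f x
    using that by (induction rule: lin_closure.induct) (auto intro: diff)
  have S: "lin_closure P (\<lambda>x. frechet_derivative f (at x) b)"
    if "lin_closure P f" "b \<in> Basis" for f b
    using that
  proof (induction rule: lin_closure.induct)
    case lin_zero
    then show ?case by (simp add: lin_closure.lin_zero)
  next
    case (lin_add f g)
    then show ?case by (simp add: partial_add D lin_closure.lin_add)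
  next
    case (lin_scale f c)
    then show ?case by (simp add: partial_scale D lin_closure.lin_scale)
  qed (rule step)
  have B: "\<exists>C. \<forall>x. (1 + norm x) ^ N * cmod (f x) \<le> C" if "lin_closure P f" for f N
    using that
  proof (induction rule: lin_closure.induct)
    case (lin_base f)
    then show ?case by (rule dec)
  next
    case lin_zero
    then show ?case by (intro exI[of _ 0]) simp
  next
    case (lin_add f g)
    then obtain C D where "\<And>x. (1 + norm x) ^ N * cmod (f x) \<le> C" "\<And>x. (1 + norm x) ^ N * cmod (g x) \<le> D"
      by blast
    then have "(1 + norm x) ^ N * cmod (f x + g x) \<le> C + D" for x
      using mult_left_mono[OF norm_triangle_ineq[of "f x" "g x"], of "(1 + norm x) ^ N"]
      by (smt (verit, best) distrib_left norm_ge_zero zero_le_power)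
    then show ?case by blast
  next
    case (lin_scale f c)
    then obtain C where "\<And>x. (1 + norm x) ^ N * cmod (f x) \<le> C" by blast
    then have "(1 + norm x) ^ N * cmod (c * f x) \<le> cmod c * C" for x
      using mult_left_mono[of "(1 + norm x) ^ N * cmod (f x)" C "cmod c"]
      by (simp add: norm_mult mult_ac)
    then show ?case by blast
  qed
  have I: "lin_closure P (iter_partial bs f)" if "set bs \<subseteq> Basis" for bs
    using that by (induction bs) (auto intro: S f)
  show ?thesis
    unfolding schwartz_def schwartz_weight_def bdd_above_def
    using D[OF I] B[OF I] by (auto 0 3)
qed

lemmas schwartz_coinduct = schwartz_coinduct_lin[OF lin_base]

lemma schwartz_lin_closure: "lin_closure schwartz f \<Longrightarrow> schwartz f"
  by (erule schwartz_coinduct_lin)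
    (auto intro: schwartz_differentiable lin_base schwartz_partial, metis schwartz_decay)

lemma schwartz_add: "schwartz f \<Longrightarrow> schwartz g \<Longrightarrow> schwartz (\<lambda>x. f x + g x)"
  and schwartz_scale: "schwartz f \<Longrightarrow> schwartz (\<lambda>x. c * f x)"
  and schwartz_zero: "schwartz (\<lambda>x. 0)"
  by (blast intro: schwartz_lin_closure lin_closure.intros)+

lemma schwartz_sum:
  "finite I \<Longrightarrow> (\<And>i. i \<in> I \<Longrightarrow> schwartz (f i)) \<Longrightarrow> schwartz (\<lambda>x. \<Sum>i\<in>I. f i x)"
  by (induction I rule: finite_induct) (auto intro: schwartz_add schwartz_zero)

lemma schwartz_decay_ex: "schwartz f \<Longrightarrow> \<exists>C. \<forall>x. (1 + norm x) ^ N * cmod (f x) \<le> C"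
  using schwartz_decay by metis

lemma partial_eq: "(f has_derivative D) (at x) \<Longrightarrow> frechet_derivative f (at x) b = D b"
  by (metis frechet_derivative_at)

lemma schwartz_has_derivative:
  "schwartz f \<Longrightarrow> (f has_derivative frechet_derivative f (at x)) (at x)"
  using schwartz_differentiable frechet_derivative_works by blast

lemma frechet_derivative_expand:
  fixes f :: "'a::euclidean_space \<Rightarrow> complex"
  assumes "schwartz f"
  shows "frechet_derivative f (at x) v = (\<Sum>b\<in>Basis. of_real (v \<bullet> b) * frechet_derivative f (at x) b)"
proof -
  have l: "linear (frechet_derivative f (at x))"
    using assms by (intro linear_frechet_derivative schwartz_differentiable)
  have "frechet_derivative f (at x) v = frechet_derivative f (at x) (\<Sum>b\<in>Basis. (v \<bullet> b) *\<^sub>R b)"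
    by (simp add: euclidean_representation)
  also have "\<dots> = (\<Sum>b\<in>Basis. of_real (v \<bullet> b) * frechet_derivative f (at x) b)"
    by (simp add: linear_sum[OF l] linear_scale[OF l] scaleR_conv_of_real)
  finally show ?thesis .
qed

section \<open>Closure properties of the Schwartz space\<close>

text \<open>
  Injectivity of the linear part is what keeps the decay: on a finite-dimensional space it makes
  \<open>norm x\<close> at most a multiple of \<open>norm (L x)\<close>. It need not be surjective, so the
  lemma covers restrictions to affine subspaces as well as changes of variables.
\<close>

lemma schwartz_compose_affine:
  fixes f :: "'b::euclidean_space \<Rightarrow> complex" and L :: "'a::euclidean_space \<Rightarrow> 'b"
  assumes f: "schwartz f" and L: "linear L" "inj L"
  shows "schwartz (\<lambda>x. f (L x + c))"
proof (rule schwartz_coinduct[of "\<lambda>h. \<exists>f. schwartz f \<and> h = (\<lambda>x. f (L x + c))"])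
  show "\<exists>g. schwartz g \<and> (\<lambda>x. f (L x + c)) = (\<lambda>x. g (L x + c))" using f by blast
  have D: "((\<lambda>x. g (L x + c)) has_derivative (\<lambda>h. frechet_derivative g (at (L x + c)) (L h))) (at x)"
    if "schwartz g" for g x
  proof -
    have 1: "((\<lambda>x. L x + c) has_derivative L) (at x)"
      using L by (auto intro!: derivative_eq_intros linear_imp_has_derivative)
    show ?thesis using has_derivative_compose[OF 1 schwartz_has_derivative[OF that]] .
  qed
  show "h differentiable at x" if "\<exists>f. schwartz f \<and> h = (\<lambda>x. f (L x + c))" for h x
    using that D unfolding differentiable_def by blast
  obtain K where K: "K > 0" "\<And>x. K * norm x \<le> norm (L x)"
    using linear_inj_bounded_below_pos[OF L] by (metis mult.commute)
  \<comment> \<open>a constant that absorbs both the coercivity of \<open>L\<close> and the shift by \<open>c\<close>\<close>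
  define K' where "K' = 1 + (1 + norm c) / K"
  have K': "1 + norm x \<le> K' * (1 + norm (L x + c))" for x
  proof -
    have "norm (L x) \<le> norm (L x + c) + norm c"
      using norm_triangle_ineq4[of "L x + c" c] by simp
    then have "norm x \<le> (norm (L x + c) + norm c) / K"
      using K(1) K(2)[of x] by (simp add: field_simps)
    moreover have "norm c * norm (L x + c) / K \<ge> 0" using K(1) by simp
    moreover have "K' * (1 + norm (L x + c)) = 1 + norm (L x + c) + 1 / K + (norm (L x + c) + norm c) / K
      + norm c * norm (L x + c) / K"
      by (simp add: K'_def algebra_simps add_divide_distrib)
    ultimately show ?thesis
      using K(1) norm_ge_zero[of "L x + c"] divide_nonneg_pos[of 1 K] by linarith
  qed
  show "\<exists>C. \<forall>x. (1 + norm x) ^ N * cmod (h x) \<le> C" if "\<exists>f. schwartz f \<and> h = (\<lambda>x. f (L x + c))" for h N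
  proof -
    from that obtain g where g: "schwartz g" "h = (\<lambda>x. g (L x + c))" by blast
    obtain C where C: "\<And>y. (1 + norm y) ^ N * cmod (g y) \<le> C" using schwartz_decay_ex[OF g(1)] by blast
    have "(1 + norm x) ^ N * cmod (h x) \<le> K' ^ N * C" for x
    proof -
      have "(1 + norm x) ^ N * cmod (h x) \<le> (K' * (1 + norm (L x + c))) ^ N * cmod (h x)"
        by (intro mult_right_mono power_mono K') auto
      also have "\<dots> = K' ^ N * ((1 + norm (L x + c)) ^ N * cmod (g (L x + c)))"
        by (simp add: g power_mult_distrib mult_ac)
      also have "\<dots> \<le> K' ^ N * C"
        by (intro mult_left_mono C) (use K in \<open>auto simp: K'_def\<close>)
      finally show ?thesis .
    qed
    then show ?thesis by blast
  qed
  show "lin_closure (\<lambda>h. \<exists>f. schwartz f \<and> h = (\<lambda>x. f (L x + c))) (\<lambda>x. frechet_derivative h (at x) b)"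
    if "\<exists>f. schwartz f \<and> h = (\<lambda>x. f (L x + c))" "b \<in> Basis" for h b
  proof -
    from that obtain g where g: "schwartz g" "h = (\<lambda>x. g (L x + c))" by blast
    have eq: "(\<lambda>x. frechet_derivative h (at x) b) =
      (\<lambda>x. \<Sum>b'\<in>Basis. of_real (L b \<bullet> b') * frechet_derivative g (at (L x + c)) b')"
      unfolding g(2) partial_eq[OF D[OF g(1)]] by (subst frechet_derivative_expand[OF g(1)]) simp
    show ?thesis unfolding eq
    proof (intro lin_closure_sum lin_scale lin_base)
      fix b' :: 'b assume "b' \<in> Basis"
      then show "\<exists>f. schwartz f \<and> (\<lambda>x. frechet_derivative g (at (L x + c)) b') = (\<lambda>x. f (L x + c))"
        by (intro exI[of _ "\<lambda>y. frechet_derivative g (at y) b'"] conjI schwartz_partial g refl)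
    qed simp
  qed
qed

text \<open>
  A form of the preceding lemma for affine maps written without separating the constant part.
\<close>

lemma schwartz_reparametrise:
  fixes \<Phi> :: "'b::euclidean_space \<Rightarrow> complex" and L :: "'a::euclidean_space \<Rightarrow> 'b"
  assumes "schwartz \<Phi>" "linear (\<lambda>x. L x - L 0)" "inj L"
  shows "schwartz (\<lambda>x. \<Phi> (L x))"
proof -
  have "inj (\<lambda>x. L x - L 0)" using assms(3) by (simp add: inj_def)
  from schwartz_compose_affine[OF assms(1,2) this, of "L 0"] show ?thesis by simp
qed

lemma schwartz_cnj:
  assumes "schwartz f" shows "schwartz (\<lambda>x. cnj (f x))"
proof (rule schwartz_coinduct[of "\<lambda>h. \<exists>f. schwartz f \<and> h = (\<lambda>x. cnj (f x))"])
  have D: "((\<lambda>x. cnj (g x)) has_derivative (\<lambda>h. cnj (frechet_derivative g (at x) h))) (at x)"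
    if "schwartz g" for g :: "'a \<Rightarrow> complex" and x
    using has_derivative_cnj[OF schwartz_has_derivative[OF that]] .
  show "h differentiable at x" if "\<exists>f. schwartz f \<and> h = (\<lambda>x. cnj (f x))" for h and x :: 'a
    using that D unfolding differentiable_def by blast
  show "lin_closure (\<lambda>h. \<exists>f. schwartz f \<and> h = (\<lambda>x. cnj (f x))) (\<lambda>x. frechet_derivative h (at x) b)"
    if "\<exists>f. schwartz f \<and> h = (\<lambda>x. cnj (f x))" "b \<in> Basis" for h and b :: 'a
    using that by (auto simp: partial_eq[OF D] intro!: lin_base intro: schwartz_partial)
qed (use assms schwartz_decay_ex in auto)

text \<open>
  A partial derivative along a basis vector of the product acts on one factor only, so the tensor
  products themselves form a class closed under partial derivatives.
\<close>

lemma schwartz_tensor: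
  fixes f :: "'a::euclidean_space \<Rightarrow> complex" and g :: "'b::euclidean_space \<Rightarrow> complex"
  assumes "schwartz f" "schwartz g" 
  shows "schwartz (\<lambda>p. f (fst p) * g (snd p))"
proof (rule schwartz_coinduct[of "\<lambda>h. \<exists>f g. schwartz f \<and> schwartz g \<and> h = (\<lambda>p. f (fst p) * g (snd p))"])
  have D: "((\<lambda>p. f (fst p) * g (snd p)) has_derivative
      (\<lambda>h. f (fst p) * frechet_derivative g (at (snd p)) (snd h) + frechet_derivative f (at (fst p)) (fst h) * g (snd p))) (at p)"
    if "schwartz f" "schwartz g" for f :: "'a \<Rightarrow> complex" and g :: "'b \<Rightarrow> complex" and p
  proof -
    have 1: "((\<lambda>p. f (fst p)) has_derivative (\<lambda>h. frechet_derivative f (at (fst p)) (fst h))) (at p)"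
      by (rule has_derivative_compose[OF has_derivative_fst[OF has_derivative_ident]])
        (rule schwartz_has_derivative that)+
    have 2: "((\<lambda>p. g (snd p)) has_derivative (\<lambda>h. frechet_derivative g (at (snd p)) (snd h))) (at p)"
      by (rule has_derivative_compose[OF has_derivative_snd[OF has_derivative_ident]])
        (rule schwartz_has_derivative that)+
    show ?thesis by (rule has_derivative_mult[OF 1 2])
  qed
  show "h differentiable at x" if "\<exists>f g. schwartz f \<and> schwartz g \<and> h = (\<lambda>p. f (fst p) * g (snd p))" for h and x :: "'a \<times> 'b"
  proof -
    from that obtain f g where fg: "schwartz f" "schwartz g" "h = (\<lambda>p. f (fst p) * g (snd p))" by blast
    show ?thesis unfolding fg(3) differentiable_def by (rule exI) (rule D[OF fg(1,2)])
  qed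
  show "lin_closure (\<lambda>h. \<exists>f g. schwartz f \<and> schwartz g \<and> h = (\<lambda>p. f (fst p) * g (snd p))) (\<lambda>x. frechet_derivative h (at x) b)"
    if "\<exists>f g. schwartz f \<and> schwartz g \<and> h = (\<lambda>p. f (fst p) * g (snd p))" "b \<in> Basis" for h and b :: "'a \<times> 'b"
  proof -
    from that obtain f g where fg: "schwartz f" "schwartz g" "h = (\<lambda>p. f (fst p) * g (snd p))" by blast
    have "linear (frechet_derivative f (at x))" "linear (frechet_derivative g (at y))" for x y
      using fg by (auto intro: linear_frechet_derivative schwartz_differentiable)
    note z = linear_0[OF this(1)] linear_0[OF this(2)]
    from \<open>b \<in> Basis\<close> consider u where "u \<in> Basis" "b = (u, 0)" | v where "v \<in> Basis" "b = (0, v)"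
      unfolding Basis_prod_def by blast
    then have "\<exists>f g. schwartz f \<and> schwartz g \<and> (\<lambda>x. frechet_derivative h (at x) b) = (\<lambda>p. f (fst p) * g (snd p))"
    proof cases
      case 1
      then have eq: "(\<lambda>x. frechet_derivative h (at x) b) = (\<lambda>p. frechet_derivative f (at (fst p)) u * g (snd p))"
        unfolding fg(3) partial_eq[OF D[OF fg(1,2)]] by (simp add: z)
      show ?thesis
        by (rule exI[of _ "\<lambda>x. frechet_derivative f (at x) u"], rule exI[of _ "g"], rule conjI[OF schwartz_partial[OF fg(1) 1(1)] conjI[OF fg(2) eq]])
    next
      case 2
      then have eq: "(\<lambda>x. frechet_derivative h (at x) b) = (\<lambda>p. f (fst p) * frechet_derivative g (at (snd p)) v)"
        unfolding fg(3) partial_eq[OF D[OF fg(1,2)]] by (simp add: z)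
      show ?thesis
        by (rule exI[of _ "f"], rule exI[of _ "\<lambda>x. frechet_derivative g (at x) v"], rule conjI[OF fg(1) conjI[OF schwartz_partial[OF fg(2) 2(1)] eq]])
    qed
    then show ?thesis by (intro lin_base)
  qed
  show "\<exists>C. \<forall>x. (1 + norm x) ^ N * cmod (h x) \<le> C"
    if "\<exists>f g. schwartz f \<and> schwartz g \<and> h = (\<lambda>p. f (fst p) * g (snd p))" for h :: "'a \<times> 'b \<Rightarrow> complex" and N
  proof -
    from that obtain f g where fg: "schwartz f" "schwartz g" "h = (\<lambda>p. f (fst p) * g (snd p))" by blast
    obtain C where C: "C \<ge> 0" "\<And>y. (1 + norm y) ^ N * cmod (f y) \<le> C"
      using schwartz_decay[OF fg(1), of N] by blast
    obtain D where D: "\<And>y. (1 + norm y) ^ N * cmod (g y) \<le> D"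
      using schwartz_decay[OF fg(2), of N] by blast
    have "(1 + norm p) ^ N * cmod (h p) \<le> C * D" for p
    proof -
      have "norm p \<le> norm (fst p) + norm (snd p)"
        using norm_Pair_le[of "fst p" "snd p"] by simp
      then have "1 + norm p \<le> (1 + norm (fst p)) * (1 + norm (snd p))"
        using mult_nonneg_nonneg[OF norm_ge_zero norm_ge_zero, of "fst p" "snd p"]
        unfolding distrib_left distrib_right by linarith
      then have "(1 + norm p) ^ N * cmod (h p) \<le> ((1 + norm (fst p)) * (1 + norm (snd p))) ^ N * cmod (h p)"
        by (intro mult_right_mono power_mono) auto
      also have "\<dots> = ((1 + norm (fst p)) ^ N * cmod (f (fst p))) * ((1 + norm (snd p)) ^ N * cmod (g (snd p)))"
        by (simp add: fg norm_mult power_mult_distrib mult_ac)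
      also have "\<dots> \<le> C * D"
        by (intro mult_mono C D) (auto simp: C)
      finally show ?thesis .
    qed
    then show ?thesis by blast
  qed
  show "\<exists>f' g'. schwartz f' \<and> schwartz g' \<and> (\<lambda>p. f (fst p) * g (snd p)) = (\<lambda>p. f' (fst p) * g' (snd p))"
    by (rule exI[of _ f], rule exI[of _ g], rule conjI[OF assms(1) conjI[OF assms(2) refl]])
qed

lemma schwartz_translate: "schwartz f \<Longrightarrow> schwartz (\<lambda>x. f (x + c))"
  using schwartz_compose_affine[of f "\<lambda>x. x" c] by (simp add: linear_iff)

lemma schwartz_reflect:
  assumes "schwartz f" shows "schwartz (\<lambda>x. f (c - x))"
proof -
  have "inj (\<lambda>x::'a. - x)" by (auto intro: injI)
  from schwartz_compose_affine[OF assms _ this, of c] show ?thesis by (simp add: linear_iff)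
qed

text \<open>
  The pointwise product is the tensor product restricted to the diagonal.
\<close>

lemma schwartz_mult:
  assumes "schwartz f" "schwartz g"
  shows "schwartz (\<lambda>x. f x * g x)"
proof -
  have "inj (\<lambda>x::'a. (x, x))" by (auto intro: injI)
  from schwartz_compose_affine[OF schwartz_tensor[OF assms] _ this, of 0] show ?thesis by (simp add: linear_iff)
qed

text \<open>
  Functions obtained from a given class by multiplying with linear functionals. Gaussians and their
  derivatives live in the closure of a single function, and the same closure shows that the Schwartz
  space admits multiplication by coordinates.
\<close>

inductive coord_closure :: "('a::euclidean_space \<Rightarrow> complex) set \<Rightarrow> ('a \<Rightarrow> complex) \<Rightarrow> bool" for P where
  coord_base: "f \<in> P \<Longrightarrow> coord_closure P f"
| coord_mult: "coord_closure P f \<Longrightarrow> coord_closure P (\<lambda>x. of_real (x \<bullet> v) * f x)"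

lemma schwartz_coord_closure:
  fixes f :: "'a::euclidean_space \<Rightarrow> complex"
  assumes "coord_closure P f"
    and diff: "\<And>f x. f \<in> P \<Longrightarrow> f differentiable (at x)"
    and dec: "\<And>f N. f \<in> P \<Longrightarrow> \<exists>C. \<forall>x. (1 + norm x) ^ N * cmod (f x) \<le> C"
    and step: "\<And>f b. f \<in> P \<Longrightarrow> b \<in> Basis \<Longrightarrow>
      lin_closure (coord_closure P) (\<lambda>x. frechet_derivative f (at x) b)"
  shows "schwartz f"
proof (rule schwartz_coinduct[of "coord_closure P"])
  have D: "((\<lambda>x. of_real (x \<bullet> v) * f x) has_derivative
     (\<lambda>h. of_real (x \<bullet> v) * frechet_derivative f (at x) h + of_real (h \<bullet> v) * f x)) (at x)"
    if "f differentiable (at x)" for f :: "'a \<Rightarrow> complex" and x v :: 'a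
    by (intro has_derivative_mult has_derivative_of_real has_derivative_inner_left has_derivative_ident
        frechet_derivative_works[THEN iffD1, OF that])
  show d: "f differentiable (at x)" if "coord_closure P f" for f x
    using that
  proof (induction rule: coord_closure.induct)
    case (coord_mult f v)
    then show ?case using D unfolding differentiable_def by blast
  qed (rule diff)
  have m: "lin_closure (coord_closure P) (\<lambda>x. of_real (x \<bullet> v) * g x)" if "lin_closure (coord_closure P) g" for g v
    using that
  proof (induction rule: lin_closure.induct)
    case (lin_base f)
    then show ?case by (intro lin_closure.lin_base coord_mult)
  next
    case lin_zero
    then show ?case using lin_closure.lin_zero by simp
  next
    case (lin_add f g)
    then show ?case using lin_closure.lin_add by (simp add: distrib_left)
  next
    case (lin_scale f c)
    from lin_closure.lin_scale[OF lin_scale.IH, of c] show ?case by (simp add: mult_ac)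
  qed
  show "lin_closure (coord_closure P) (\<lambda>x. frechet_derivative f (at x) b)"
    if "coord_closure P f" "b \<in> Basis" for f b
    using that
  proof (induction rule: coord_closure.induct)
    case (coord_mult f v)
    then have "(\<lambda>x. frechet_derivative (\<lambda>x. of_real (x \<bullet> v) * f x) (at x) b) =
      (\<lambda>x. of_real (x \<bullet> v) * frechet_derivative f (at x) b + of_real (b \<bullet> v) * f x)"
      by (simp add: partial_eq[OF D] d)
    then show ?case
      by (simp only:) (rule lin_add[OF m[OF coord_mult.IH[OF coord_mult.prems]] lin_scale[OF lin_base[of "coord_closure P", OF coord_mult.hyps]]])
  qed (rule step)
  show "\<exists>C. \<forall>x. (1 + norm x) ^ N * cmod (f x) \<le> C" if "coord_closure P f" for f N
    using that
  proof (induction arbitrary: N rule: coord_closure.induct)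
    case (coord_mult f v)
    then obtain C where C: "\<And>x. (1 + norm x) ^ Suc N * cmod (f x) \<le> C" by blast
    have "(1 + norm x) ^ N * cmod (of_real (x \<bullet> v) * f x) \<le> norm v * C" for x
    proof -
      have "\<bar>x \<bullet> v\<bar> \<le> (1 + norm x) * norm v"
        using Cauchy_Schwarz_ineq2[of x v] norm_ge_zero[of v] unfolding distrib_right by linarith
      then have "(1 + norm x) ^ N * (\<bar>x \<bullet> v\<bar> * cmod (f x)) \<le> (1 + norm x) ^ N * (((1 + norm x) * norm v) * cmod (f x))"
        by (intro mult_left_mono mult_right_mono) auto
      also have "\<dots> = norm v * ((1 + norm x) ^ Suc N * cmod (f x))" by simp
      also have "\<dots> \<le> norm v * C" by (intro mult_left_mono C) auto
      finally show ?thesis by (simp add: norm_mult)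
    qed
    then show ?case by blast
  qed (rule dec)
qed fact

lemma schwartz_coord_mult:
  assumes "schwartz f" shows "schwartz (\<lambda>x. of_real (x \<bullet> v) * f x)"
  by (rule schwartz_coord_closure[of "Collect schwartz"])
    (use assms in \<open>auto intro: coord_closure.intros lin_base schwartz_differentiable schwartz_partial
      schwartz_decay_ex\<close>)

text \<open>
  From \<open>y \<le> exp y\<close> at \<open>y = r / N\<close>, raised to the power \<open>N\<close>; for
  \<open>N = 0\<close> the convention \<open>0 ^ 0 = 1\<close> makes it true.
\<close>

lemma power_le_exp_real:
  fixes r :: real assumes "r \<ge> 0" shows "r ^ N \<le> real N ^ N * exp r"
proof (cases "N = 0")
  case False
  have "r / real N \<le> exp (r / real N)" using exp_ge_add_one_self[of "r / real N"] by linarith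
  then have "(r / real N) ^ N \<le> exp (r / real N) ^ N" using assms by (intro power_mono) auto
  also have "\<dots> = exp r" using False by (simp flip: exp_of_nat_mult)
  finally show ?thesis using False by (simp add: field_simps)
qed (use assms in auto)

lemma schwartz_gaussian:
  assumes c: "c > 0"
  shows "schwartz (\<lambda>x::'a::euclidean_space. of_real (exp (- c * (norm x)\<^sup>2)))"
    (is "schwartz ?g")
proof (rule schwartz_coord_closure[of "{?g}"])
  have D: "(?g has_derivative (\<lambda>h. - 2 * c * (of_real (x \<bullet> h) * ?g x))) (at x)" for x :: 'a
  proof -
    have "((\<lambda>x. exp (- c * (x \<bullet> x))) has_derivative (\<lambda>h. - 2 * c * ((x \<bullet> h) * exp (- c * (x \<bullet> x))))) (at x)"
      by (rule derivative_eq_intros refl)+ (auto simp: fun_eq_iff inner_commute)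
    from has_derivative_of_real[OF this, where 'a = complex] show ?thesis
      by (simp add: power2_norm_eq_inner)
  qed
  show "f differentiable (at x)" if "f \<in> {?g}" for f x
    using that D unfolding differentiable_def by blast
  show "lin_closure (coord_closure {?g}) (\<lambda>x. frechet_derivative f (at x) b)" if "f \<in> {?g}" for f b
  proof -
    have "(\<lambda>x. frechet_derivative f (at x) b) = (\<lambda>x. of_real (- 2 * c) * (of_real (x \<bullet> b) * ?g x))"
      using that by (simp only: singleton_iff partial_eq[OF D])
    then show ?thesis
      by (simp only:) (intro lin_scale lin_base coord_mult coord_base singletonI)
  qed
  show "\<exists>C. \<forall>x. (1 + norm x) ^ N * cmod (f x) \<le> C" if "f \<in> {?g}" for f N
  proof -
    have "(1 + norm x) ^ N * exp (- c * (norm x)\<^sup>2) \<le> real N ^ N * exp (1 + 1 / (4 * c))" for x :: 'a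
    proof -
      have "(1 + norm x) ^ N * exp (- c * (norm x)\<^sup>2) \<le> real N ^ N * exp (1 + norm x) * exp (- c * (norm x)\<^sup>2)"
        by (intro mult_right_mono power_le_exp_real) auto
      also have "\<dots> = real N ^ N * exp (1 + norm x - c * (norm x)\<^sup>2)"
        by (simp add: exp_diff exp_minus field_simps)
      also have "0 \<le> (2 * c * norm x - 1)\<^sup>2" by simp
      then have "1 + norm x - c * (norm x)\<^sup>2 \<le> 1 + 1 / (4 * c)"
        using c by (simp add: field_simps power2_eq_square)
      then have "real N ^ N * exp (1 + norm x - c * (norm x)\<^sup>2) \<le> real N ^ N * exp (1 + 1 / (4 * c))"
        by (intro mult_left_mono) auto
      finally show ?thesis .
    qed
    then show ?thesis using that by auto
  qed
qed (auto intro: coord_base)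

section \<open>An integrable weight and differentiation under the integral\<close>

text \<open>
  A product of one-dimensional Cauchy densities (without normalisation) is used instead of a power of
  \<open>1 + norm x\<close> because its integrability reduces to dimension one.
\<close>

definition cauchy_weight :: "'a::euclidean_space \<Rightarrow> real" where
  "cauchy_weight x = (\<Prod>b\<in>Basis. inverse (1 + (x \<bullet> b)\<^sup>2))"

lemma cauchy_weight_nonneg: "cauchy_weight x \<ge> 0"
  by (auto simp: cauchy_weight_def intro!: prod_nonneg)

lemma cauchy_weight_le_1: "cauchy_weight x \<le> 1"
proof -
  have "1 \<le> 1 + (x \<bullet> b)\<^sup>2" for b by simp
  then have "inverse (1 + (x \<bullet> b)\<^sup>2) \<le> 1" "0 \<le> inverse (1 + (x \<bullet> b)\<^sup>2)" for b
    by (auto intro: inverse_le_1_iff[THEN iffD2])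
  then show ?thesis unfolding cauchy_weight_def by (intro prod_le_1) auto
qed

lemma integrable_cauchy_weight: "integrable lborel (cauchy_weight :: 'a::euclidean_space \<Rightarrow> real)"
proof -
  have 1: "integrable lborel (\<lambda>x::real. inverse (1 + x\<^sup>2))"
    using integrable_inverse_1_plus_square by (simp add: set_integrable_def)
  have "(\<integral>\<^sup>+x. ennreal (cauchy_weight (x::'a)) \<partial>lborel) = (\<integral>\<^sup>+x. (\<Prod>b\<in>Basis. ennreal (inverse (1 + ((x::'a) \<bullet> b)\<^sup>2))) \<partial>lborel)"
    by (simp add: cauchy_weight_def prod_ennreal)
  also have "\<dots> = (\<Prod>b\<in>(Basis::'a set). (\<integral>\<^sup>+x. ennreal (inverse (1 + x\<^sup>2)) \<partial>lborel))"
    by (rule nn_integral_lborel_prod) auto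
  also have "\<dots> < \<infinity>"
    using 1 unfolding integrable_iff_bounded by (simp add: power_less_top_ennreal)
  finally show ?thesis
    unfolding integrable_iff_bounded by (simp add: cauchy_weight_nonneg) (simp add: cauchy_weight_def[abs_def])
qed

lemma cauchy_weight_ge: "1 \<le> (1 + norm x) ^ (2 * DIM('a)) * cauchy_weight (x :: 'a::euclidean_space)"
proof -
  have "(\<Prod>b\<in>(Basis::'a set). 1 + (x \<bullet> b)\<^sup>2) \<le> (\<Prod>b\<in>(Basis::'a set). (1 + norm x)\<^sup>2)"
  proof (rule prod_mono)
    fix b :: 'a assume "b \<in> Basis"
    then have "\<bar>x \<bullet> b\<bar> \<le> norm x" by (rule Basis_le_norm)
    then have "(x \<bullet> b)\<^sup>2 \<le> (norm x)\<^sup>2" by (metis abs_le_square_iff abs_norm_cancel)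
    then show "0 \<le> 1 + (x \<bullet> b)\<^sup>2 \<and> 1 + (x \<bullet> b)\<^sup>2 \<le> (1 + norm x)\<^sup>2"
      by (simp add: power2_sum add_increasing2)
  qed
  then have "(\<Prod>b\<in>(Basis::'a set). 1 + (x \<bullet> b)\<^sup>2) \<le> (1 + norm x) ^ (2 * DIM('a))"
    by (simp add: power_mult)
  moreover have "(\<Prod>b\<in>(Basis::'a set). 1 + (x \<bullet> b)\<^sup>2) * cauchy_weight x = 1"
    unfolding cauchy_weight_def prod.distrib[symmetric]
    by (intro prod.neutral ballI right_inverse) (smt (verit) zero_le_power2)
  ultimately show ?thesis
    using mult_right_mono[of _ _ "cauchy_weight x"] cauchy_weight_nonneg[of x] by metis
qed

text \<open>
  The weight may depend on a second variable \<open>y\<close> that is dominated by \<open>x\<close>, typically a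
  component of \<open>x\<close>. This gives bounds of a Schwartz function of several variables that are
  uniform in some of them and integrable in the others.
\<close>

lemma schwartz_bound:
  fixes f :: "'a::euclidean_space \<Rightarrow> complex"
  assumes "schwartz f"
  obtains C where "C \<ge> 0"
    "\<And>x (y::'b::euclidean_space). norm y \<le> norm x \<Longrightarrow> (1 + norm x) ^ N * cmod (f x) \<le> C * cauchy_weight y"
proof -
  obtain C where C: "C \<ge> 0" "\<And>x. (1 + norm x) ^ (N + 2 * DIM('b)) * cmod (f x) \<le> C"
    using schwartz_decay[OF assms, of "N + 2 * DIM('b)"] by blast
  have "(1 + norm x) ^ N * cmod (f x) \<le> C * cauchy_weight y" if "norm y \<le> norm x" for x and y :: 'b
  proof -
    have "(1 + norm x) ^ N * cmod (f x) * 1 \<le> (1 + norm x) ^ N * cmod (f x) * ((1 + norm y) ^ (2 * DIM('b)) * cauchy_weight y)"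
      by (intro mult_left_mono cauchy_weight_ge) auto
    also have "\<dots> \<le> (1 + norm x) ^ N * cmod (f x) * ((1 + norm x) ^ (2 * DIM('b)) * cauchy_weight y)"
      by (intro mult_left_mono mult_right_mono power_mono cauchy_weight_nonneg) (use that in auto)
    also have "\<dots> = (1 + norm x) ^ (N + 2 * DIM('b)) * cmod (f x) * cauchy_weight y"
      by (simp add: power_add)
    also have "\<dots> \<le> C * cauchy_weight y"
      by (intro mult_right_mono C cauchy_weight_nonneg)
    finally show ?thesis by simp
  qed
  with C(1) show thesis by (rule that)
qed

lemma schwartz_derivative_bound:
  fixes f :: "'a::euclidean_space \<Rightarrow> complex"
  assumes f: "schwartz f"
  obtains C where "C \<ge> 0"
    "\<And>x (y::'b::euclidean_space) v. norm y \<le> norm x \<Longrightarrow>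
      (1 + norm x) ^ N * cmod (frechet_derivative f (at x) v) \<le> C * cauchy_weight y * norm v"
proof -
  have "\<forall>b. \<exists>C\<ge>0. b \<in> Basis \<longrightarrow> (\<forall>x (y::'b). norm y \<le> norm x \<longrightarrow>
      (1 + norm x) ^ N * cmod (frechet_derivative f (at x) b) \<le> C * cauchy_weight y)"
    using schwartz_bound[OF schwartz_partial[OF f]] by (metis order_refl)
  then obtain C where C: "\<And>b. C b \<ge> 0" "\<And>b x (y::'b). b \<in> Basis \<Longrightarrow> norm y \<le> norm x \<Longrightarrow>
      (1 + norm x) ^ N * cmod (frechet_derivative f (at x) b) \<le> C b * cauchy_weight y"
    by metis
  have "(1 + norm x) ^ N * cmod (frechet_derivative f (at x) v) \<le> (\<Sum>b\<in>Basis. C b) * cauchy_weight y * norm v"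
    if "norm y \<le> norm x" for x v and y :: 'b
  proof -
    have "(1 + norm x) ^ N * cmod (frechet_derivative f (at x) v)
      \<le> (1 + norm x) ^ N * (\<Sum>b\<in>Basis. norm v * cmod (frechet_derivative f (at x) b))"
      by (subst frechet_derivative_expand[OF f], intro mult_left_mono sum_norm_le)
        (auto simp: norm_mult Basis_le_norm intro!: mult_right_mono)
    also have "\<dots> = (\<Sum>b\<in>Basis. norm v * ((1 + norm x) ^ N * cmod (frechet_derivative f (at x) b)))"
      by (simp add: sum_distrib_left mult_ac)
    also have "\<dots> \<le> (\<Sum>b\<in>Basis. norm v * (C b * cauchy_weight y))"
      by (intro sum_mono mult_left_mono C that) auto
    also have "\<dots> = (\<Sum>b\<in>Basis. C b) * cauchy_weight y * norm v"
      by (simp add: sum_distrib_right sum_distrib_left mult_ac)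
    finally show ?thesis .
  qed
  then show thesis using that[of "\<Sum>b\<in>Basis. C b"] C(1) by (simp add: sum_nonneg)
qed

lemma schwartz_continuous: "schwartz f \<Longrightarrow> continuous_on S f"
  by (meson differentiable_imp_continuous_within continuous_at_imp_continuous_on schwartz_differentiable)

lemma schwartz_measurable: "schwartz f \<Longrightarrow> f \<in> borel_measurable borel"
  by (intro borel_measurable_continuous_onI schwartz_continuous)

lemma schwartz_integrable:
  fixes f :: "'a::euclidean_space \<Rightarrow> complex"
  assumes f: "schwartz f" shows "integrable lborel f"
proof -
  obtain C where "\<And>x. cmod (f x) \<le> C * cauchy_weight x"
    using schwartz_bound[OF f, of 0] by (metis mult_1 order_refl power_0)
  then have "norm (f x) \<le> norm (C * cauchy_weight x)" for x by (smt (verit) real_norm_def)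
  then show ?thesis
    using schwartz_measurable[OF f]
    by (intro Bochner_Integration.integrable_bound[OF integrable_mult_right[OF integrable_cauchy_weight, of C]]) auto
qed

text \<open>
  Differentiation under the integral for the total derivative: by the mean value theorem the
  difference quotients are dominated by \<open>2 * g\<close>, so dominated convergence applies along every
  sequence tending to \<open>p0\<close>. It is used with real and with complex parameters.
\<close>

lemma has_derivative_integral:
  fixes f :: "'p::real_normed_vector \<Rightarrow> 'y \<Rightarrow> complex"
  assumes r: "r > 0"
    and int: "\<And>p. p \<in> ball p0 r \<Longrightarrow> integrable M (f p)"
    and der: "\<And>p y. p \<in> ball p0 r \<Longrightarrow> ((\<lambda>p. f p y) has_derivative f' p y) (at p)"
    and bnd: "\<And>p y h. p \<in> ball p0 r \<Longrightarrow> cmod (f' p y h) \<le> g y * norm h"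
    and g: "integrable M g"
    and meas: "\<And>h. (\<lambda>y. f' p0 y h) \<in> borel_measurable M"
  shows "((\<lambda>p. \<integral>y. f p y \<partial>M) has_derivative (\<lambda>h. \<integral>y. f' p0 y h \<partial>M)) (at p0)"
proof -
  have p0: "p0 \<in> ball p0 r" using r by simp
  have lin: "bounded_linear (f' p0 y)" for y using der[OF p0] by (rule has_derivative_bounded_linear)
  have int': "integrable M (\<lambda>y. f' p0 y h)" for h
    by (rule Bochner_Integration.integrable_bound[OF integrable_mult_left[OF g, of "norm h"] meas])
      (use bnd[OF p0] in \<open>auto intro: order_trans[OF _ abs_ge_self]\<close>)
  have "bounded_linear (\<lambda>h. \<integral>y. f' p0 y h \<partial>M)"
  proof (rule bounded_linear_intro)
    show "(\<integral>y. f' p0 y (h + k) \<partial>M) = (\<integral>y. f' p0 y h \<partial>M) + (\<integral>y. f' p0 y k \<partial>M)" for h k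
      by (simp add: linear_simps(1)[OF lin] int')
    show "(\<integral>y. f' p0 y (c *\<^sub>R h) \<partial>M) = c *\<^sub>R (\<integral>y. f' p0 y h \<partial>M)" for c h
      by (simp add: linear_simps(5)[OF lin])
    show "norm (\<integral>y. f' p0 y h \<partial>M) \<le> norm h * integral\<^sup>L M g" for h
    proof -
      have "norm (\<integral>y. f' p0 y h \<partial>M) \<le> (\<integral>y. norm (f' p0 y h) \<partial>M)" by (rule integral_norm_bound)
      also have "\<dots> \<le> (\<integral>y. g y * norm h \<partial>M)"
        by (rule integral_mono) (use int' g bnd[OF p0] in auto)
      finally show ?thesis by (simp add: mult.commute)
    qed
  qed
  moreover have "((\<lambda>p. norm ((\<integral>y. f p y \<partial>M) - (\<integral>y. f p0 y \<partial>M) - (\<integral>y. f' p0 y (p - p0) \<partial>M)) / norm (p - p0)) \<longlongrightarrow> 0) (at p0)"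
    unfolding tendsto_at_iff_sequentially
  proof (intro allI impI)
    fix X :: "nat \<Rightarrow> 'p" assume X0: "\<forall>i. X i \<in> UNIV - {p0}" and X: "X \<longlonglongrightarrow> p0"
    define q where "q n y = norm (f (X n) y - f p0 y - f' p0 y (X n - p0)) / norm (X n - p0)" for n y
    \<comment> \<open>only finitely many \<open>X n\<close> lie outside the ball, and nothing is known about \<open>f\<close> there\<close>
    define s where "s n y = (if X n \<in> ball p0 r then q n y else 0)" for n y
    have ev: "eventually (\<lambda>n. X n \<in> ball p0 r) sequentially"
      using X r by (metis tendsto_def open_ball p0)
    have "(\<lambda>n. integral\<^sup>L M (s n)) \<longlonglongrightarrow> (\<integral>y. 0 \<partial>M)"
    proof (rule integral_dominated_convergence[where w = "\<lambda>y. 2 * g y"])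
      show "s n \<in> borel_measurable M" for n
        unfolding s_def q_def using int[THEN borel_measurable_integrable] p0 meas by (cases "X n \<in> ball p0 r") auto
      show "AE y in M. (\<lambda>n. s n y) \<longlonglongrightarrow> 0"
      proof (rule AE_I2)
        fix y
        have "((\<lambda>p. norm (f p y - f p0 y - f' p0 y (p - p0)) / norm (p - p0)) \<longlongrightarrow> 0) (at p0)"
          using der[OF p0, of y] unfolding has_derivative_iff_norm by blast
        then have "(\<lambda>n. q n y) \<longlonglongrightarrow> 0"
          using X0 X unfolding tendsto_at_iff_sequentially q_def comp_def by blast
        then show "(\<lambda>n. s n y) \<longlonglongrightarrow> 0"
          by (rule Lim_transform_eventually) (use ev in \<open>eventually_elim, auto simp: s_def\<close>)
      qed
      show "AE y in M. norm (s n y) \<le> 2 * g y" for n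
      proof (rule AE_I2)
        fix y
        have g0: "0 \<le> g y"
        proof -
          have "0 \<le> g y * norm (X n - p0)" using bnd[OF p0, of y "X n - p0"] norm_ge_zero order_trans by blast
          then show ?thesis using X0 by (simp add: zero_le_mult_iff)
        qed
        show "norm (s n y) \<le> 2 * g y"
        proof (cases "X n \<in> ball p0 r")
          case True
          have "norm (f (X n) y - f p0 y) \<le> g y * norm (X n - p0)"
          proof (rule differentiable_bound[OF convex_ball[of p0 r], where f' = "\<lambda>p. f' p y"])
            fix p assume "p \<in> ball p0 r"
            then show "((\<lambda>p. f p y) has_derivative f' p y) (at p within ball p0 r)"
              using der has_derivative_at_withinI by blast
            show "onorm (f' p y) \<le> g y"
              by (rule onorm_bound[OF g0]) (use bnd \<open>p \<in> ball p0 r\<close> in auto)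
          qed (use True p0 in auto)
          moreover have "norm (f' p0 y (X n - p0)) \<le> g y * norm (X n - p0)" by (rule bnd[OF p0])
          ultimately have "norm (f (X n) y - f p0 y - f' p0 y (X n - p0)) \<le> 2 * g y * norm (X n - p0)"
            using norm_triangle_ineq4[of "f (X n) y - f p0 y" "f' p0 y (X n - p0)"] by linarith
          then show ?thesis using X0 True by (simp add: s_def q_def divide_le_eq)
        qed (simp add: s_def g0)
      qed
    qed (use g in auto)
    then have lim: "(\<lambda>n. integral\<^sup>L M (s n)) \<longlonglongrightarrow> 0" by simp
    show "((\<lambda>p. norm ((\<integral>y. f p y \<partial>M) - (\<integral>y. f p0 y \<partial>M) - (\<integral>y. f' p0 y (p - p0) \<partial>M)) / norm (p - p0)) \<circ> X) \<longlonglongrightarrow> 0"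
    proof (rule Lim_null_comparison[OF _ lim])
      show "\<forall>\<^sub>F n in sequentially. norm (((\<lambda>p. norm ((\<integral>y. f p y \<partial>M) - (\<integral>y. f p0 y \<partial>M) - (\<integral>y. f' p0 y (p - p0) \<partial>M)) / norm (p - p0)) \<circ> X) n) \<le> integral\<^sup>L M (s n)"
        using ev
      proof eventually_elim
        case (elim n)
        have "(\<integral>y. f (X n) y \<partial>M) - (\<integral>y. f p0 y \<partial>M) - (\<integral>y. f' p0 y (X n - p0) \<partial>M)
          = (\<integral>y. f (X n) y - f p0 y - f' p0 y (X n - p0) \<partial>M)"
          using int[OF elim] int[OF p0] int' by simp
        also have "norm \<dots> \<le> (\<integral>y. norm (f (X n) y - f p0 y - f' p0 y (X n - p0)) \<partial>M)"
          by (rule integral_norm_bound)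
        finally show ?case
          using divide_right_mono[of _ _ "norm (X n - p0)"] elim
          by (simp add: s_def[abs_def] q_def[abs_def])
      qed
    qed
  qed
  ultimately show ?thesis unfolding has_derivative_iff_norm by blast
qed

lemma integral_translation:
  fixes f :: "'a::euclidean_space \<Rightarrow> 'b::{banach, second_countable_topology}"
  assumes "f \<in> borel_measurable borel"
  shows "(\<integral>x. f (x + c) \<partial>lborel) = (\<integral>x. f x \<partial>lborel)"
proof -
  have "(\<integral>x. f x \<partial>lborel) = (\<integral>x. f x \<partial>distr lborel borel ((+) c))" by (simp add: lborel_distr_plus)
  also have "\<dots> = (\<integral>x. f (c + x) \<partial>lborel)" using assms by (intro integral_distr) auto
  finally show ?thesis by (simp add: add.commute)
qed

lemma integrable_translation:
  fixes f :: "'a::euclidean_space \<Rightarrow> 'b::{banach, second_countable_topology}"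
  assumes "integrable lborel f"
  shows "integrable lborel (\<lambda>x. f (x + c))"
proof -
  have "integrable (distr lborel borel ((+) c)) f" using assms by (simp add: lborel_distr_plus)
  then have "integrable lborel (\<lambda>x. f (c + x))" by (rule integrable_distr[rotated]) auto
  then show ?thesis by (simp add: add.commute)
qed

text \<open>
  Translation invariance makes \<open>\<integral> \<psi> (x + t v) dx\<close> constant in \<open>t\<close>; differentiating under
  the integral at \<open>t = 0\<close> gives the claim. Applied to a product it is integration by parts.
\<close>

lemma integral_derivative_eq_0:
  fixes \<psi> :: "'a::euclidean_space \<Rightarrow> complex"
  assumes int: "integrable lborel \<psi>"
    and der: "\<And>x. (\<psi> has_derivative \<psi>' x) (at x)"
    and bnd: "\<And>x. (1 + norm x) ^ (2 * DIM('a)) * cmod (\<psi>' x v) \<le> C"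
    and meas: "(\<lambda>x. \<psi>' x v) \<in> borel_measurable borel"
  shows "(\<integral>x. \<psi>' x v \<partial>lborel) = 0"
proof -
  let ?M = "2 * DIM('a)"
  have C0: "C \<ge> 0" using bnd[of 0] by (rule order_trans[rotated]) simp
  have lin: "linear (\<psi>' x)" for x using der has_derivative_linear by blast
  have "((\<lambda>t. \<integral>x. \<psi> (x + t *\<^sub>R v) \<partial>lborel) has_derivative (\<lambda>h. \<integral>x. \<psi>' (x + 0 *\<^sub>R v) (h *\<^sub>R v) \<partial>lborel)) (at (0::real))"
  proof (rule has_derivative_integral[where r = 1 and g = "\<lambda>x. C * (1 + norm v) ^ ?M * cauchy_weight x"])
    show "((\<lambda>t. \<psi> (x + t *\<^sub>R v)) has_derivative (\<lambda>h. \<psi>' (x + t *\<^sub>R v) (h *\<^sub>R v))) (at t)" for t x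
      by (rule has_derivative_compose[OF _ der]) (auto intro!: derivative_eq_intros)
    show "cmod (\<psi>' (x + t *\<^sub>R v) (h *\<^sub>R v)) \<le> C * (1 + norm v) ^ ?M * cauchy_weight x * norm h"
      if t: "t \<in> ball 0 1" for t x h
    proof -
      let ?y = "x + t *\<^sub>R v"
      have "norm (t *\<^sub>R v) \<le> norm v" using t by (simp add: mult_left_le_one_le)
      then have "1 + norm x \<le> (1 + norm ?y) + norm v" using norm_triangle_ineq4[of ?y "t *\<^sub>R v"] by simp
      also have "\<dots> \<le> (1 + norm ?y) * (1 + norm v)" by (simp add: algebra_simps)
      finally have le: "1 + norm x \<le> (1 + norm ?y) * (1 + norm v)" .
      have "cmod (\<psi>' ?y v) * 1 \<le> cmod (\<psi>' ?y v) * ((1 + norm x) ^ ?M * cauchy_weight x)"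
        by (intro mult_left_mono cauchy_weight_ge) auto
      also have "\<dots> \<le> cmod (\<psi>' ?y v) * (((1 + norm ?y) * (1 + norm v)) ^ ?M * cauchy_weight x)"
        by (intro mult_left_mono mult_right_mono power_mono le cauchy_weight_nonneg) auto
      also have "\<dots> = (1 + norm ?y) ^ ?M * cmod (\<psi>' ?y v) * ((1 + norm v) ^ ?M * cauchy_weight x)"
        by (simp add: power_mult_distrib)
      also have "\<dots> \<le> C * ((1 + norm v) ^ ?M * cauchy_weight x)"
        by (intro mult_right_mono bnd mult_nonneg_nonneg cauchy_weight_nonneg) auto
      finally have "cmod (\<psi>' ?y v) * \<bar>h\<bar> \<le> C * (1 + norm v) ^ ?M * cauchy_weight x * \<bar>h\<bar>"
        by (intro mult_right_mono) (auto simp: mult_ac)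
      then show ?thesis by (simp add: linear_scale[OF lin] mult_ac)
    qed
    show "(\<lambda>x. \<psi>' (x + 0 *\<^sub>R v) (h *\<^sub>R v)) \<in> borel_measurable lborel" for h
      using meas by (simp add: linear_scale[OF lin])
  qed (auto intro!: integrable_translation int integrable_mult_right integrable_cauchy_weight)
  moreover have "(\<integral>x. \<psi> (x + t *\<^sub>R v) \<partial>lborel) = (\<integral>x. \<psi> x \<partial>lborel)" for t :: real
    using int by (intro integral_translation) simp
  ultimately have "((\<lambda>t. \<integral>x. \<psi> x \<partial>lborel) has_derivative (\<lambda>h. \<integral>x. \<psi>' x (h *\<^sub>R v) \<partial>lborel)) (at (0::real))"
    by simp
  from has_derivative_unique[OF this has_derivative_const] have "(\<integral>x. \<psi>' x (1 *\<^sub>R v) \<partial>lborel) = 0"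
    by meson
  then show ?thesis by simp
qed

section \<open>Partial Fourier transforms of Schwartz functions\<close>

lemma fourier_alt: "fourier f k = (\<integral>x. cis (- 2 * pi * (k \<bullet> x)) * f x \<partial>lborel)"
  unfolding fourier_def cis_conv_exp by (simp add: mult_ac)

lemma fourier_at_0: "fourier f 0 = (\<integral>x. f x \<partial>lborel)"
  by (simp add: fourier_def)

lemma fourier_scale: "fourier (\<lambda>x. c * f x) k = c * fourier f k"
  unfolding fourier_alt by (subst integral_mult_right_zero[symmetric]) (simp only: mult_ac)

lemma has_derivative_cexp:
  fixes g :: "'a::real_normed_vector \<Rightarrow> complex"
  assumes "(g has_derivative g') (at x)"
  shows "((\<lambda>x. exp (g x)) has_derivative (\<lambda>h. exp (g x) * g' h)) (at x)"
  using has_derivative_compose[OF assms DERIV_exp[of "g x", unfolded has_field_derivative_def]] .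

lemma slice_bound:
  fixes \<Phi> :: "'a::euclidean_space \<times> 'b::euclidean_space \<Rightarrow> complex"
  assumes "schwartz \<Phi>"
  obtains C where "C \<ge> 0" "\<And>a b. cmod (\<Phi> (a, b)) \<le> C * cauchy_weight b"
  using schwartz_bound[OF assms, of 0, where 'b='b] norm_snd_le by (metis mult_1 power_0)

lemma schwartz_slice_fst:
  assumes "schwartz \<Phi>" shows "schwartz (\<lambda>b. \<Phi> (a, b))"
proof -
  have "inj (\<lambda>b. (0, b))" by (auto intro: injI)
  from schwartz_compose_affine[OF assms _ this, of "(a, 0)"] show ?thesis by (simp add: linear_iff)
qed

lemma schwartz_slice_snd:
  assumes "schwartz \<Phi>" shows "schwartz (\<lambda>a. \<Phi> (a, b))"
proof -
  have "inj (\<lambda>a. (a, 0))" by (auto intro: injI)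
  from schwartz_compose_affine[OF assms _ this, of "(0, b)"] show ?thesis by (simp add: linear_iff)
qed

lemma integrable_cis_mult:
  assumes "schwartz f" shows "integrable lborel (\<lambda>x. cis (- 2 * pi * (k \<bullet> x)) * f x)"
proof (rule Bochner_Integration.integrable_bound[OF schwartz_integrable[OF assms]])
  show "(\<lambda>x. cis (- 2 * pi * (k \<bullet> x)) * f x) \<in> borel_measurable lborel"
    unfolding cis_conv_exp using schwartz_measurable[OF assms] by simp
qed (auto simp: norm_mult)

text \<open>
  Derivatives in the parameter fall on \<open>\<Phi>\<close>, derivatives in the frequency multiply \<open>\<Phi>\<close> by a
  coordinate; both keep the integrand a Schwartz function.
\<close>

lemma partial_fourier_has_derivative:
  fixes \<Phi> :: "'a::euclidean_space \<times> 'b::euclidean_space \<Rightarrow> complex"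
  assumes \<Phi>: "schwartz \<Phi>"
  shows "((\<lambda>p. fourier (\<lambda>b. \<Phi> (fst p, b)) (snd p)) has_derivative
    (\<lambda>h. \<integral>b. cis (- 2 * pi * (snd p \<bullet> b)) *
        (frechet_derivative \<Phi> (at (fst p, b)) (fst h, 0) - 2 * pi * \<i> * of_real (snd h \<bullet> b) * \<Phi> (fst p, b)) \<partial>lborel)) (at p)"
proof -
  obtain C where C: "C \<ge> 0" "\<And>x (y::'b) v. norm y \<le> norm x \<Longrightarrow>
      (1 + norm x) ^ 0 * cmod (frechet_derivative \<Phi> (at x) v) \<le> C * cauchy_weight y * norm v"
    using schwartz_derivative_bound[OF \<Phi>, of 0] by blast
  obtain D where D: "D \<ge> 0" "\<And>x (y::'b). norm y \<le> norm x \<Longrightarrow>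
      (1 + norm x) ^ 1 * cmod (\<Phi> x) \<le> D * cauchy_weight y"
    using schwartz_bound[OF \<Phi>, of 1] by blast
  have meas: "(\<lambda>b. frechet_derivative \<Phi> (at (a, b)) v) \<in> borel_measurable borel" for a v
    by (subst frechet_derivative_expand[OF \<Phi>], intro borel_measurable_sum borel_measurable_times borel_measurable_const
        schwartz_measurable schwartz_slice_fst[OF schwartz_partial[OF \<Phi>]])
  show ?thesis unfolding fourier_alt
  proof (rule has_derivative_integral[where r = 1 and g = "\<lambda>b. (C + 2 * pi * D) * cauchy_weight b"])
    show "integrable lborel (\<lambda>x. cis (- 2 * pi * (snd p \<bullet> x)) * \<Phi> (fst p, x))" for p :: "'a \<times> 'b"
      by (intro integrable_cis_mult schwartz_slice_fst \<Phi>)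
    show "((\<lambda>p. cis (- 2 * pi * (snd p \<bullet> b)) * \<Phi> (fst p, b)) has_derivative
      (\<lambda>h. cis (- 2 * pi * (snd p \<bullet> b)) *
        (frechet_derivative \<Phi> (at (fst p, b)) (fst h, 0) - 2 * pi * \<i> * of_real (snd h \<bullet> b) * \<Phi> (fst p, b)))) (at p)" for p b
    proof -
      have 1: "((\<lambda>p. \<Phi> (fst p, b)) has_derivative (\<lambda>h. frechet_derivative \<Phi> (at (fst p, b)) (fst h, 0))) (at p)"
        by (rule has_derivative_compose[OF _ schwartz_has_derivative[OF \<Phi>]]) (auto intro!: derivative_eq_intros)
      have 2: "((\<lambda>p. exp (\<i> * of_real (- 2 * pi * (snd p \<bullet> b)))) has_derivative
        (\<lambda>h. exp (\<i> * of_real (- 2 * pi * (snd p \<bullet> b))) * (\<i> * of_real (- 2 * pi * (snd h \<bullet> b))))) (at p)"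
        by (rule has_derivative_cexp, intro has_derivative_mult_right has_derivative_of_real
            has_derivative_inner_right has_derivative_inner_left has_derivative_snd has_derivative_ident)
      show ?thesis
        unfolding cis_conv_exp
        by (rule has_derivative_eq_rhs[OF has_derivative_mult[OF 2 1]]) (auto simp: fun_eq_iff algebra_simps)
    qed
    show "cmod (cis (- 2 * pi * (snd p \<bullet> b)) *
        (frechet_derivative \<Phi> (at (fst p, b)) (fst h, 0) - 2 * pi * \<i> * of_real (snd h \<bullet> b) * \<Phi> (fst p, b)))
       \<le> (C + 2 * pi * D) * cauchy_weight b * norm h" for p b h
    proof -
      have "cmod (frechet_derivative \<Phi> (at (fst p, b)) (fst h, 0)) \<le> C * cauchy_weight b * norm (fst h)"
        using C(2)[of b "(fst p, b)" "(fst h, 0)"] norm_snd_le[of b "fst p"] by simp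
      also have "\<dots> \<le> C * cauchy_weight b * norm h"
        using norm_fst_le[of "fst h" "snd h"] by (intro mult_left_mono) (auto simp: C cauchy_weight_nonneg)
      finally have A: "cmod (frechet_derivative \<Phi> (at (fst p, b)) (fst h, 0)) \<le> C * cauchy_weight b * norm h" .
      have "\<bar>snd h \<bullet> b\<bar> \<le> norm h * norm b"
        by (rule order_trans[OF Cauchy_Schwarz_ineq2 mult_right_mono])
          (use norm_snd_le[of "snd h" "fst h"] in auto)
      also have "\<dots> \<le> norm h * (1 + norm (fst p, b))"
        using norm_snd_le[of b "fst p"] by (intro mult_left_mono) auto
      finally have "\<bar>snd h \<bullet> b\<bar> * cmod (\<Phi> (fst p, b)) \<le> norm h * ((1 + norm (fst p, b)) * cmod (\<Phi> (fst p, b)))"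
        by (metis mult_right_mono norm_ge_zero mult.assoc)
      also have "\<dots> \<le> norm h * (D * cauchy_weight b)"
        using D(2)[of b "(fst p, b)"] norm_snd_le[of b "fst p"] by (intro mult_left_mono) auto
      finally have B: "\<bar>snd h \<bullet> b\<bar> * cmod (\<Phi> (fst p, b)) \<le> D * cauchy_weight b * norm h" by (simp add: mult_ac)
      have "cmod (frechet_derivative \<Phi> (at (fst p, b)) (fst h, 0) - 2 * pi * \<i> * of_real (snd h \<bullet> b) * \<Phi> (fst p, b))
        \<le> cmod (frechet_derivative \<Phi> (at (fst p, b)) (fst h, 0)) + 2 * pi * (\<bar>snd h \<bullet> b\<bar> * cmod (\<Phi> (fst p, b)))"
        by (rule order_trans[OF norm_triangle_ineq4]) (simp add: norm_mult)
      also have "\<dots> \<le> C * cauchy_weight b * norm h + 2 * pi * (D * cauchy_weight b * norm h)"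
        by (intro add_mono mult_left_mono A B) auto
      finally show ?thesis unfolding norm_mult[of "cis _"] norm_cis mult_1 by (simp add: algebra_simps)
    qed
    show "(\<lambda>b. cis (- 2 * pi * (snd p \<bullet> b)) *
        (frechet_derivative \<Phi> (at (fst p, b)) (fst h, 0) - 2 * pi * \<i> * of_real (snd h \<bullet> b) * \<Phi> (fst p, b)))
        \<in> borel_measurable lborel" for h
      unfolding cis_conv_exp using meas[of "fst p" "(fst h, 0)"] schwartz_measurable[OF schwartz_slice_fst[OF \<Phi>], of "fst p"]
      by simp
  qed (auto intro!: integrable_mult_right integrable_cauchy_weight)
qed

lemma fourier_of_partial:
  fixes f :: "'a::euclidean_space \<Rightarrow> complex"
  assumes f: "schwartz f" and v: "v \<in> Basis"
  shows "fourier (\<lambda>x. frechet_derivative f (at x) v) k = 2 * pi * \<i> * of_real (k \<bullet> v) * fourier f k"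
proof -
  let ?e = "\<lambda>x. cis (- 2 * pi * (k \<bullet> x))"
  let ?d = "\<lambda>x h. ?e x * (frechet_derivative f (at x) h - 2 * pi * \<i> * of_real (k \<bullet> h) * f x)"
  obtain C where C: "\<And>x. (1 + norm x) ^ (2 * DIM('a)) * cmod (f x) \<le> C" 
    using schwartz_decay[OF f, of "2 * DIM('a)"] by blast
  obtain D where D: "\<And>x. (1 + norm x) ^ (2 * DIM('a)) * cmod (frechet_derivative f (at x) v) \<le> D"
    using schwartz_decay[OF schwartz_partial[OF f v], of "2 * DIM('a)"] by blast
  have "(\<integral>x. ?d x v \<partial>lborel) = 0"
  proof (rule integral_derivative_eq_0[where \<psi> = "\<lambda>x. ?e x * f x" and C = "D + 2 * pi * \<bar>k \<bullet> v\<bar> * C"])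
    show "integrable lborel (\<lambda>x. ?e x * f x)" by (rule integrable_cis_mult[OF f])
    show "((\<lambda>x. ?e x * f x) has_derivative ?d x) (at x)" for x
    proof -
      have 2: "((\<lambda>x. exp (\<i> * of_real (- 2 * pi * (k \<bullet> x)))) has_derivative
        (\<lambda>h. exp (\<i> * of_real (- 2 * pi * (k \<bullet> x))) * (\<i> * of_real (- 2 * pi * (k \<bullet> h))))) (at x)"
        by (rule has_derivative_cexp, intro has_derivative_mult_right has_derivative_of_real
            has_derivative_inner_right has_derivative_inner_left has_derivative_snd has_derivative_ident)
      show ?thesis
        unfolding cis_conv_exp
        by (rule has_derivative_eq_rhs[OF has_derivative_mult[OF 2 schwartz_has_derivative[OF f]]])
          (auto simp: fun_eq_iff algebra_simps)
    qed
    show "(1 + norm x) ^ (2 * DIM('a)) * cmod (?d x v) \<le> D + 2 * pi * \<bar>k \<bullet> v\<bar> * C" for x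
    proof -
      let ?w = "(1 + norm x) ^ (2 * DIM('a))"
      have "?w * cmod (?d x v) \<le> ?w * (cmod (frechet_derivative f (at x) v) + 2 * pi * \<bar>k \<bullet> v\<bar> * cmod (f x))"
        unfolding norm_mult norm_cis mult_1
        by (intro mult_left_mono order_trans[OF norm_triangle_ineq4]) (auto simp: norm_mult)
      also have "\<dots> = ?w * cmod (frechet_derivative f (at x) v) + 2 * pi * \<bar>k \<bullet> v\<bar> * (?w * cmod (f x))"
        by (simp add: algebra_simps)
      also have "\<dots> \<le> D + 2 * pi * \<bar>k \<bullet> v\<bar> * C"
        by (intro add_mono D mult_left_mono C) auto
      finally show ?thesis .
    qed
    show "(\<lambda>x. ?d x v) \<in> borel_measurable borel"
      unfolding cis_conv_exp using schwartz_measurable[OF f] schwartz_measurable[OF schwartz_partial[OF f v]] by simp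
  qed
  also have "(\<integral>x. ?d x v \<partial>lborel) = fourier (\<lambda>x. frechet_derivative f (at x) v) k - 2 * pi * \<i> * of_real (k \<bullet> v) * fourier f k"
  proof -
    have "(\<lambda>x. ?d x v) = (\<lambda>x. ?e x * frechet_derivative f (at x) v - 2 * pi * \<i> * of_real (k \<bullet> v) * (?e x * f x))"
      by (simp add: fun_eq_iff algebra_simps)
    then show ?thesis
      unfolding fourier_alt
      by (simp only: Bochner_Integration.integral_diff[OF integrable_cis_mult[OF schwartz_partial[OF f v]]
            integrable_mult_right[OF integrable_cis_mult[OF f]]] integral_mult_right_zero)
  qed
  finally show ?thesis by simp
qed

lemma partial_slice:
  fixes \<Phi> :: "'a::euclidean_space \<times> 'b::euclidean_space \<Rightarrow> complex"
  assumes \<Phi>: "schwartz \<Phi>"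
  shows "frechet_derivative (\<lambda>b. \<Phi> (a, b)) (at b) v = frechet_derivative \<Phi> (at (a, b)) (0, v)"
    and "frechet_derivative (\<lambda>a. \<Phi> (a, b)) (at a) u = frechet_derivative \<Phi> (at (a, b)) (u, 0)"
proof -
  have "((\<lambda>b. \<Phi> (a, b)) has_derivative (\<lambda>h. frechet_derivative \<Phi> (at (a, b)) (0, h))) (at b)"
    by (rule has_derivative_compose[OF _ schwartz_has_derivative[OF \<Phi>]]) (auto intro!: derivative_eq_intros)
  then show "frechet_derivative (\<lambda>b. \<Phi> (a, b)) (at b) v = frechet_derivative \<Phi> (at (a, b)) (0, v)"
    by (rule partial_eq)
  have "((\<lambda>a. \<Phi> (a, b)) has_derivative (\<lambda>h. frechet_derivative \<Phi> (at (a, b)) (h, 0))) (at a)"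
    by (rule has_derivative_compose[OF _ schwartz_has_derivative[OF \<Phi>]]) (auto intro!: derivative_eq_intros)
  then show "frechet_derivative (\<lambda>a. \<Phi> (a, b)) (at a) u = frechet_derivative \<Phi> (at (a, b)) (u, 0)"
    by (rule partial_eq)
qed

text \<open>
  Differentiability comes from \<open>partial_fourier_has_derivative\<close>. For the decay, multiplying the
  transform by a coordinate of the parameter or of the frequency gives again a partial Fourier
  transform (of \<open>\<Phi>\<close> times a coordinate, or of a derivative of \<open>\<Phi>\<close>), so every power of the weight is
  reached by induction from the boundedness of all partial Fourier transforms.
\<close>

lemma schwartz_partial_fourier:
  fixes \<Phi> :: "'a::euclidean_space \<times> 'b::euclidean_space \<Rightarrow> complex"
  assumes \<Phi>: "schwartz \<Phi>"
  shows "schwartz (\<lambda>p. fourier (\<lambda>b. \<Phi> (fst p, b)) (snd p))"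
proof -
  define P where "P = (\<lambda>h. \<exists>\<Phi>. schwartz \<Phi> \<and> h = (\<lambda>p::'a\<times>'b. fourier (\<lambda>b. \<Phi> (fst p, b)) (snd p)))"
  have PI: "P (\<lambda>p. fourier (\<lambda>b. \<Phi> (fst p, b)) (snd p))" if "schwartz \<Phi>" for \<Phi>
    unfolding P_def by (rule exI[of _ \<Phi>], rule conjI[OF that refl])
  have dec: "\<exists>C. \<forall>p. (1 + norm p) ^ N * cmod (fourier (\<lambda>b. \<Phi> (fst p, b)) (snd p)) \<le> C"
    if "schwartz \<Phi>" for N and \<Phi> :: "'a \<times> 'b \<Rightarrow> complex"
    using that
  proof (induction N arbitrary: \<Phi>)
    case 0
    obtain C where C: "C \<ge> 0" "\<And>a b. cmod (\<Phi> (a, b)) \<le> C * cauchy_weight b"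
      using slice_bound[OF 0] by blast
    have "cmod (fourier (\<lambda>b. \<Phi> (a, b)) k) \<le> (\<integral>b. C * cauchy_weight (b::'b) \<partial>lborel)" for a k
      unfolding fourier_alt
      by (rule Bochner_Integration.integral_norm_bound_integral[OF integrable_cis_mult])
        (auto intro!: schwartz_slice_fst 0 integrable_mult_right integrable_cauchy_weight simp: norm_mult C)
    then show ?case by auto
  next
    case (Suc N)
    let ?F = "\<lambda>\<Phi> p. fourier (\<lambda>b. \<Phi> (fst p, b)) (snd p)"
    have "\<exists>\<Psi>. schwartz \<Psi> \<and> (\<forall>p. of_real (p \<bullet> u) * ?F \<Phi> p = ?F \<Psi> p)" if "u \<in> Basis" for u :: "'a \<times> 'b"
    proof -
      from that consider w where "w \<in> Basis" "u = (w, 0)" | v where "v \<in> Basis" "u = (0, v)"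
        unfolding Basis_prod_def by blast
      then show ?thesis
      proof cases
        case 1
        have "schwartz (\<lambda>p. of_real (p \<bullet> u) * \<Phi> p)" by (rule schwartz_coord_mult[OF Suc.prems])
        moreover have "of_real (p \<bullet> u) * ?F \<Phi> p = ?F (\<lambda>p. of_real (p \<bullet> u) * \<Phi> p) p" for p
          unfolding fourier_alt 1(2) inner_prod_def by (simp add: mult_ac flip: integral_mult_right_zero)
        ultimately show ?thesis by blast
      next
        case 2
        have "schwartz (\<lambda>p. (1 / (2 * pi * \<i>)) * frechet_derivative \<Phi> (at p) u)"
          by (intro schwartz_scale schwartz_partial Suc.prems that)
        moreover have "of_real (p \<bullet> u) * ?F \<Phi> p = ?F (\<lambda>p. (1 / (2 * pi * \<i>)) * frechet_derivative \<Phi> (at p) u) p" for p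
        proof -
          have "?F (\<lambda>p. frechet_derivative \<Phi> (at p) u) p = 2 * pi * \<i> * of_real (snd p \<bullet> v) * ?F \<Phi> p"
            unfolding 2(2) partial_slice(1)[OF Suc.prems, symmetric]
            by (rule fourier_of_partial[OF schwartz_slice_fst[OF Suc.prems] 2(1)])
          moreover have "?F (\<lambda>p. (1 / (2 * pi * \<i>)) * frechet_derivative \<Phi> (at p) u) p
             = (1 / (2 * pi * \<i>)) * ?F (\<lambda>p. frechet_derivative \<Phi> (at p) u) p"
            unfolding fourier_alt by (subst integral_mult_right_zero[symmetric]) (simp only: mult_ac)
          ultimately show ?thesis by (simp add: 2(2) inner_prod_def)
        qed
        ultimately show ?thesis by blast
      qed
    qed
    then obtain \<Psi> where \<Psi>: "\<And>u. u \<in> Basis \<Longrightarrow> schwartz (\<Psi> u)"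
      "\<And>u p. u \<in> Basis \<Longrightarrow> of_real (p \<bullet> u) * ?F \<Phi> p = ?F (\<Psi> u) p" by metis
    have "\<forall>u. \<exists>C. u \<in> Basis \<longrightarrow> (\<forall>p. (1 + norm p) ^ N * cmod (?F (\<Psi> u) p) \<le> C)"
      using Suc.IH[OF \<Psi>(1)] by blast
    then obtain C where C: "\<And>u p. u \<in> Basis \<Longrightarrow> (1 + norm p) ^ N * cmod (?F (\<Psi> u) p) \<le> C u" by metis
    obtain D where D: "\<And>p. (1 + norm p) ^ N * cmod (?F \<Phi> p) \<le> D" using Suc.IH[OF Suc.prems] by blast
    have "(1 + norm p) ^ Suc N * cmod (?F \<Phi> p) \<le> D + (\<Sum>u\<in>Basis. C u)" for p
    proof -
      let ?w = "(1 + norm p) ^ N"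
      have "(1 + norm p) ^ Suc N * cmod (?F \<Phi> p) = (1 + norm p) * (?w * cmod (?F \<Phi> p))"
        by (simp add: mult_ac)
      also have "\<dots> \<le> (1 + (\<Sum>u\<in>Basis. \<bar>p \<bullet> u\<bar>)) * (?w * cmod (?F \<Phi> p))"
        by (intro mult_right_mono add_left_mono norm_le_l1) auto
      also have "\<dots> = ?w * cmod (?F \<Phi> p) + (\<Sum>u\<in>Basis. ?w * cmod (of_real (p \<bullet> u) * ?F \<Phi> p))"
        by (simp add: algebra_simps sum_distrib_right sum_distrib_left norm_mult)
      also have "\<dots> \<le> D + (\<Sum>u\<in>Basis. C u)"
        by (intro add_mono D sum_mono) (simp only: \<Psi>(2) C)
      finally show ?thesis .
    qed
    then show ?case by blast
  qed
  show ?thesis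
  proof (rule schwartz_coinduct[of P])
    show "P (\<lambda>p. fourier (\<lambda>b. \<Phi> (fst p, b)) (snd p))" by (rule PI[OF \<Phi>])
  next
    fix h and p :: "'a \<times> 'b" assume "P h"
    then obtain \<Phi> where \<Phi>: "schwartz \<Phi>" "h = (\<lambda>p. fourier (\<lambda>b. \<Phi> (fst p, b)) (snd p))" unfolding P_def by blast
    show "h differentiable (at p)"
      unfolding differentiable_def \<Phi>(2) using partial_fourier_has_derivative[OF \<Phi>(1)] by blast
  next
    fix h N assume "P h"
    then obtain \<Phi> where \<Phi>: "schwartz \<Phi>" "h = (\<lambda>p. fourier (\<lambda>b. \<Phi> (fst p, b)) (snd p))" unfolding P_def by blast
    show "\<exists>C. \<forall>p. (1 + norm p) ^ N * cmod (h p) \<le> C" unfolding \<Phi>(2) by (rule dec[OF \<Phi>(1)])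
  next
    fix h and c :: "'a \<times> 'b" assume "P h" and c: "c \<in> Basis"
    then obtain \<Phi> where \<Phi>: "schwartz \<Phi>" "h = (\<lambda>p. fourier (\<lambda>b. \<Phi> (fst p, b)) (snd p))" unfolding P_def by blast
    note z = linear_0[OF linear_frechet_derivative[OF schwartz_differentiable[OF \<Phi>(1)]]]
    from c consider w where "w \<in> Basis" "c = (w, 0)" | v where "v \<in> Basis" "c = (0, v)"
      unfolding Basis_prod_def by blast
    then show "lin_closure P (\<lambda>p. frechet_derivative h (at p) c)"
    proof cases
      case 1
      have "(\<lambda>p. frechet_derivative h (at p) c) = (\<lambda>p. fourier (\<lambda>b. (\<lambda>q. frechet_derivative \<Phi> (at q) c) (fst p, b)) (snd p))"
        unfolding \<Phi>(2) partial_eq[OF partial_fourier_has_derivative[OF \<Phi>(1)]] unfolding fourier_alt 1(2) by simp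
      then show ?thesis
        by (simp only:) (intro lin_base PI schwartz_partial \<Phi> c)
    next
      case 2
      have "(\<lambda>p. frechet_derivative h (at p) c) =
        (\<lambda>p. (- 2 * pi * \<i>) * fourier (\<lambda>b. (\<lambda>q. of_real (q \<bullet> c) * \<Phi> q) (fst p, b)) (snd p))"
        unfolding \<Phi>(2) partial_eq[OF partial_fourier_has_derivative[OF \<Phi>(1)]] unfolding fourier_alt 2(2)
        by (rule ext, subst integral_mult_right_zero[symmetric]) (simp add: z zero_prod_def[symmetric] inner_commute mult_ac)
      then show ?thesis
        by (simp only:) (intro lin_scale lin_base PI schwartz_coord_mult \<Phi>)
    qed
  qed
qed

text \<open>
  The case without parameter, obtained by adding a dummy real parameter.
\<close>

lemma schwartz_fourier:
  fixes f :: "'a::euclidean_space \<Rightarrow> complex"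
  assumes "schwartz f" shows "schwartz (fourier f)"
proof -
  \<comment> \<open>the Gaussian in the dummy parameter has value 1 at 0\<close>
  have "schwartz (\<lambda>p::real \<times> 'a. of_real (exp (- 1 * (norm (fst p))\<^sup>2)) * f (snd p))"
    by (intro schwartz_tensor schwartz_gaussian assms) auto
  from schwartz_slice_fst[OF schwartz_partial_fourier[OF this], of 0] show ?thesis
    by simp
qed

section \<open>Pairing a tempered distribution with a parameter integral\<close>

lemma parameter_integral_has_derivative:
  fixes \<Phi> :: "'s::euclidean_space \<times> 'a::euclidean_space \<Rightarrow> complex"
  assumes \<Phi>: "schwartz \<Phi>"
  shows "((\<lambda>a. \<integral>s. \<Phi> (s, a) \<partial>lborel) has_derivative
    (\<lambda>h. \<integral>s. frechet_derivative \<Phi> (at (s, a)) (0, h) \<partial>lborel)) (at a)"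
proof -
  obtain C where C: "C \<ge> 0" "\<And>x (y::'s) v. norm y \<le> norm x \<Longrightarrow>
      (1 + norm x) ^ 0 * cmod (frechet_derivative \<Phi> (at x) v) \<le> C * cauchy_weight y * norm v"
    using schwartz_derivative_bound[OF \<Phi>, of 0] by blast
  show ?thesis
  proof (rule has_derivative_integral[where r = 1 and g = "\<lambda>s. C * cauchy_weight s"])
    show "integrable lborel (\<lambda>s. \<Phi> (s, a))" for a by (intro schwartz_integrable schwartz_slice_snd \<Phi>)
    show "((\<lambda>a. \<Phi> (s, a)) has_derivative (\<lambda>h. frechet_derivative \<Phi> (at (s, a)) (0, h))) (at a)" for s a
      by (rule has_derivative_compose[OF _ schwartz_has_derivative[OF \<Phi>]]) (auto intro!: derivative_eq_intros)
    show "cmod (frechet_derivative \<Phi> (at (s, a)) (0, h)) \<le> C * cauchy_weight s * norm h" for s a h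
      using C(2)[of s "(s, a)" "(0, h)"] norm_fst_le[of s a] by simp
    show "(\<lambda>s. frechet_derivative \<Phi> (at (s, a)) (0, h)) \<in> borel_measurable lborel" for h
      unfolding measurable_lborel2
      by (subst frechet_derivative_expand[OF \<Phi>], intro borel_measurable_sum borel_measurable_times borel_measurable_const
          schwartz_measurable schwartz_slice_snd[OF schwartz_partial[OF \<Phi>]])
  qed (auto intro!: integrable_mult_right integrable_cauchy_weight)
qed

text \<open>
  An integral is a Fourier transform at frequency 0.
\<close>

lemma schwartz_parameter_integral:
  fixes \<Phi> :: "'s::euclidean_space \<times> 'a::euclidean_space \<Rightarrow> complex"
  assumes \<Phi>: "schwartz \<Phi>"
  shows "schwartz (\<lambda>a. \<integral>s. \<Phi> (s, a) \<partial>lborel)"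
proof -
  have "inj (\<lambda>p::'a \<times> 's. (snd p, fst p))" by (auto intro: injI)
  then have "schwartz (\<lambda>p. \<Phi> ((snd p, fst p) + 0))"
    by (intro schwartz_compose_affine \<Phi>) (auto simp: linear_iff)
  from schwartz_slice_snd[OF schwartz_partial_fourier[OF this], of 0] show ?thesis
    by (simp add: fourier_def)
qed

lemma iter_partial_parameter_integral:
  fixes \<Phi> :: "'s::euclidean_space \<times> 'a::euclidean_space \<Rightarrow> complex"
  assumes "schwartz \<Phi>" "set bs \<subseteq> Basis"
  shows "iter_partial bs (\<lambda>a. \<integral>s. \<Phi> (s, a) \<partial>lborel) = (\<lambda>a. \<integral>s. iter_partial (map (Pair 0) bs) \<Phi> (s, a) \<partial>lborel)"
  using assms
proof (induction bs)
  case (Cons b bs)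
  have "schwartz (iter_partial (map (Pair 0) bs) \<Phi>)"
    using Cons.prems by (intro schwartz_iter_partial) (auto simp: Basis_prod_def)
  from partial_eq[OF parameter_integral_has_derivative[OF this]] Cons show ?case by simp
qed simp

lemma iter_partial_slice:
  fixes \<Phi> :: "'s::euclidean_space \<times> 'a::euclidean_space \<Rightarrow> complex"
  assumes "schwartz \<Phi>" "set bs \<subseteq> Basis"
  shows "iter_partial bs (\<lambda>a. \<Phi> (s, a)) = (\<lambda>a. iter_partial (map (Pair 0) bs) \<Phi> (s, a))"
  using assms
proof (induction bs)
  case (Cons b bs)
  have "schwartz (iter_partial (map (Pair 0) bs) \<Phi>)"
    using Cons.prems by (intro schwartz_iter_partial) (auto simp: Basis_prod_def)
  from partial_slice(1)[OF this] Cons show ?case by simp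
qed simp

lemma iter_partial_add:
  assumes "schwartz f" "schwartz g" "set bs \<subseteq> Basis"
  shows "iter_partial bs (\<lambda>x. f x + g x) = (\<lambda>x. iter_partial bs f x + iter_partial bs g x)"
  using assms(3)
proof (induction bs)
  case (Cons b bs)
  then show ?case
    using schwartz_differentiable[OF schwartz_iter_partial[OF assms(1), of bs]]
      schwartz_differentiable[OF schwartz_iter_partial[OF assms(2), of bs]]
    by (simp add: partial_add)
qed simp

lemma iter_partial_scale:
  assumes "schwartz f" "set bs \<subseteq> Basis"
  shows "iter_partial bs (\<lambda>x. c * f x) = (\<lambda>x. c * iter_partial bs f x)"
  using assms(2)
proof (induction bs)
  case (Cons b bs)
  then show ?case
    using schwartz_differentiable[OF schwartz_iter_partial[OF assms(1), of bs]]
    by (simp add: partial_scale)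
qed simp

lemma iter_partial_zero: "iter_partial bs (\<lambda>x. 0) = (\<lambda>x. 0)"
  by (induction bs) auto

lemma iter_partial_sum:
  assumes "finite I" "\<And>i. i \<in> I \<Longrightarrow> schwartz (f i)" "set bs \<subseteq> Basis"
  shows "iter_partial bs (\<lambda>x. \<Sum>i\<in>I. f i x) = (\<lambda>x. \<Sum>i\<in>I. iter_partial bs (f i) x)"
  using assms(1,2)
  by (induction I rule: finite_induct)
    (simp_all add: iter_partial_zero iter_partial_add schwartz_sum assms(3))

lemma tempered_sum:
  assumes T: "tempered_distribution T" and "finite I" "\<And>i. i \<in> I \<Longrightarrow> schwartz (f i)"
  shows "T (\<lambda>x. \<Sum>i\<in>I. f i x) = (\<Sum>i\<in>I. T (f i))"
  using assms(2,3)
proof (induction I rule: finite_induct)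
  case empty
  have "T (\<lambda>x. 0 * 0) = 0 * T (\<lambda>x. 0)"
    using T schwartz_zero unfolding tempered_distribution_def by blast
  then show ?case by simp
next
  case (insert i I)
  then have "T (\<lambda>x. f i x + (\<Sum>i\<in>I. f i x)) = T (f i) + T (\<lambda>x. \<Sum>i\<in>I. f i x)"
    using T schwartz_sum[of I f] unfolding tempered_distribution_def by blast
  with insert show ?case by simp
qed

lemma tempered_scale:
  "tempered_distribution T \<Longrightarrow> schwartz f \<Longrightarrow> T (\<lambda>x. c * f x) = c * T f"
  unfolding tempered_distribution_def by blast

lemma tempered_diff:
  assumes T: "tempered_distribution T" and "schwartz f" "schwartz g"
  shows "T (\<lambda>x. f x - g x) = T f - T g"
proof -
  have "T (\<lambda>x. f x + (-1) * g x) = T f + T (\<lambda>x. (-1) * g x)"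
    using T assms(2) schwartz_scale[OF assms(3), of "-1"] unfolding tempered_distribution_def by blast
  then show ?thesis using tempered_scale[OF T assms(3), of "-1"] by simp
qed

text \<open>
  The continuity estimate with the supremum seminorm replaced by any pointwise bound \<open>K\<close>, which is
  how it is used throughout.
\<close>

lemma tempered_bound:
  fixes T :: "('a::euclidean_space) functional"
  assumes "tempered_distribution T"
  obtains C N where "C \<ge> 0"
    "\<And>f K. schwartz f \<Longrightarrow> (\<And>bs x. set bs \<subseteq> Basis \<Longrightarrow> length bs \<le> N \<Longrightarrow>
        (1 + norm x) ^ N * cmod (iter_partial bs f x) \<le> K) \<Longrightarrow> cmod (T f) \<le> C * K"
proof -
  from assms obtain C N where CN: "\<And>f. schwartz f \<Longrightarrow> cmod (T f) \<le> C * schwartz_seminorm N f"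
    unfolding tempered_distribution_def by blast
  let ?B = "{bs. set bs \<subseteq> (Basis :: 'a set) \<and> length bs \<le> N}"
  have fin: "finite ?B" using finite_lists_length_le[of "Basis :: 'a set" N] by simp
  have "cmod (T f) \<le> (\<bar>C\<bar> * real (card ?B)) * K"
    if f: "schwartz f" and K: "\<And>bs x. set bs \<subseteq> Basis \<Longrightarrow> length bs \<le> N \<Longrightarrow>
        (1 + norm x) ^ N * cmod (iter_partial bs f x) \<le> K" for f K
  proof -
    have up: "(SUP x. schwartz_weight N bs f x) \<le> K" if "bs \<in> ?B" for bs
      using that by (intro cSUP_least) (auto simp: schwartz_weight_def K)
    have lo: "0 \<le> (SUP x. schwartz_weight N bs f x)" if "bs \<in> ?B" for bs
    proof -
      have "bdd_above (range (schwartz_weight N bs f))" using f that unfolding schwartz_def by simp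
      then have "schwartz_weight N bs f 0 \<le> (SUP x. schwartz_weight N bs f x)" by (intro cSUP_upper) auto
      then show ?thesis by (rule order_trans[rotated]) (simp add: schwartz_weight_def)
    qed
    have "schwartz_seminorm N f \<le> (\<Sum>bs\<in>?B. K)"
      unfolding schwartz_seminorm_def by (intro sum_mono up)
    moreover have "0 \<le> schwartz_seminorm N f"
      unfolding schwartz_seminorm_def by (intro sum_nonneg lo)
    ultimately have "C * schwartz_seminorm N f \<le> \<bar>C\<bar> * (\<Sum>bs\<in>?B. K)"
      by (intro mult_mono) auto
    with CN[OF f] show ?thesis by simp
  qed
  then show thesis using that[of "\<bar>C\<bar> * real (card ?B)" N] by simp
qed

text \<open>
  On each cell of the tagged division the Lipschitz bound controls the error, and the weight controls
  what is lost outside the box. The same estimate is applied to scalar functions of two kinds: the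
  weighted derivatives of a family of test functions at a fixed point, and the pairings of the family
  with a distribution.
\<close>

lemma riemann_sum_error:
  fixes g :: "'s::euclidean_space \<Rightarrow> complex"
  assumes lip: "\<And>s s'. cmod (g s - g s') \<le> L * norm (s - s')"
    and L: "L \<ge> 0" and A: "A \<ge> 0"
    and bnd: "\<And>s. cmod (g s) \<le> A * cauchy_weight s"
    and p: "p tagged_division_of (cbox a b)" and fine: "(\<lambda>x. ball x \<delta>) fine p"
  shows "cmod ((\<Sum>(x,K)\<in>p. of_real (measure lborel K) * g x) - (\<integral>s. g s \<partial>lborel))
    \<le> L * \<delta> * measure lborel (cbox a b) + A * (\<integral>s. indicator (- cbox a b) s * cauchy_weight s \<partial>lborel)"
proof -
  have cont: "continuous_on S g" for S
  proof (rule continuous_on_subset[OF _ subset_UNIV])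
    show "continuous_on UNIV g"
      unfolding continuous_on_iff
    proof (intro ballI allI impI)
      fix s and e :: real assume "e > 0"
      have "dist (g s') (g s) < e" if "dist s' s < e / (L + 1)" for s'
      proof -
        have "dist (g s') (g s) \<le> (L + 1) * dist s' s"
          using lip[of s' s] by (simp add: dist_norm distrib_right add_increasing2)
        also have "\<dots> < e" using that L by (simp add: field_simps)
        finally show ?thesis .
      qed
      then show "\<exists>d>0. \<forall>s'\<in>UNIV. dist s' s < d \<longrightarrow> dist (g s') (g s) < e"
        using \<open>e > 0\<close> L by (intro exI[of _ "e / (L + 1)"]) auto
    qed
  qed
  have gm: "g \<in> borel_measurable borel" by (rule borel_measurable_continuous_onI[OF cont])
  have int: "integrable lborel g"
    using gm bnd by (intro Bochner_Integration.integrable_bound[OF integrable_mult_right[OF integrable_cauchy_weight, of A]])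
      (auto intro: order_trans[OF _ abs_ge_self])
  let ?R = "cbox a b"
  have io: "g integrable_on cbox c d" for c d by (intro integrable_continuous cont)
  have "(\<Sum>(x,K)\<in>p. of_real (measure lborel K) * g x) - integral ?R g
    = (\<Sum>(x,K)\<in>p. of_real (measure lborel K) * g x - integral K g)"
    unfolding integral_combine_tagged_division_topdown[OF io p]
    by (simp add: sum_subtractf split_def)
  also have "cmod \<dots> \<le> (\<Sum>(x,K)\<in>p. L * \<delta> * measure lborel K)"
  proof (rule sum_norm_le, clarify)
    fix x K assume xK: "(x, K) \<in> p"
    obtain c d where K: "K = cbox c d" using tagged_division_ofD(4)[OF p xK] by blast
    have sub: "K \<subseteq> ball x \<delta>" using fine xK unfolding fine_def by blast
    have x: "x \<in> K" by (rule tagged_division_ofD(2)[OF p xK])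
    then have d: "\<delta> > 0" using sub by (metis mem_ball_0 ball_empty empty_iff not_le subsetD)
    have "((\<lambda>s. g x - g s) has_integral (measure lborel K *\<^sub>R g x - integral K g)) K"
      unfolding K by (intro has_integral_diff has_integral_const integrable_integral io)
    then have "norm (measure lborel K *\<^sub>R g x - integral K g) \<le> L * \<delta> * measure lborel (cbox c d)"
      unfolding K
    proof (rule has_integral_bound[rotated])
      fix s assume "s \<in> cbox c d"
      then have "norm (x - s) \<le> \<delta>" using sub K by (auto simp: dist_norm subset_iff less_imp_le)
      then show "norm (g x - g s) \<le> L * \<delta>" using lip[of x s] L by (metis mult_left_mono order_trans)
    qed (use L d in auto)
    then show "cmod (of_real (measure lborel K) * g x - integral K g) \<le> L * \<delta> * measure lborel K"
      by (simp add: K scaleR_conv_of_real)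
  qed
  also have "\<dots> = L * \<delta> * measure lborel ?R"
    unfolding additive_content_tagged_division[OF p, symmetric] by (simp add: sum_distrib_left split_def)
  finally have 1: "cmod ((\<Sum>(x,K)\<in>p. of_real (measure lborel K) * g x) - integral ?R g) \<le> L * \<delta> * measure lborel ?R" .
  have sR: "set_integrable lborel ?R g" "set_integrable lborel (- ?R) g"
    unfolding set_integrable_def by (intro integrable_mult_indicator int; simp)+
  have "(\<integral>s. g s \<partial>lborel) = (\<integral>s. indicator ?R s *\<^sub>R g s + indicator (- ?R) s *\<^sub>R g s \<partial>lborel)"
    by (intro Bochner_Integration.integral_cong) (auto simp: indicator_def)
  also have "\<dots> = (LINT s:?R|lborel. g s) + (LINT s:-?R|lborel. g s)"
    unfolding set_lebesgue_integral_def
    by (rule Bochner_Integration.integral_add[OF sR[unfolded set_integrable_def]])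
  finally have "(\<integral>s. g s \<partial>lborel) = (LINT s:?R|lborel. g s) + (LINT s:-?R|lborel. g s)" .
  then have "integral ?R g - (\<integral>s. g s \<partial>lborel) = - (LINT s:-?R|lborel. g s)"
    using set_borel_integral_eq_integral(2)[OF sR(1)] by simp
  then have "cmod (integral ?R g - (\<integral>s. g s \<partial>lborel)) = cmod (LINT s:-?R|lborel. g s)" by simp
  also have "\<dots> \<le> (\<integral>s. A * (indicator (- ?R) s * cauchy_weight s) \<partial>lborel)"
    unfolding set_lebesgue_integral_def
    using sR(2)[unfolded set_integrable_def]
  proof (rule Bochner_Integration.integral_norm_bound_integral)
    show "integrable lborel (\<lambda>s. A * (indicator (- ?R) s * cauchy_weight s))"
      using integrable_mult_indicator[OF _ integrable_cauchy_weight, of "- ?R"]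
      by (intro integrable_mult_right) simp
    show "norm (indicator (- ?R) s *\<^sub>R g s) \<le> A * (indicator (- ?R) s * cauchy_weight s)" for s
      using bnd[of s] by (auto simp: indicator_def)
  qed
  finally have 2: "cmod (integral ?R g - (\<integral>s. g s \<partial>lborel)) \<le> A * (\<integral>s. indicator (- ?R) s * cauchy_weight s \<partial>lborel)"
    by simp
  have "cmod ((\<Sum>(x,K)\<in>p. of_real (measure lborel K) * g x) - (\<integral>s. g s \<partial>lborel))
    \<le> cmod ((\<Sum>(x,K)\<in>p. of_real (measure lborel K) * g x) - integral ?R g) + cmod (integral ?R g - (\<integral>s. g s \<partial>lborel))"
    using dist_triangle[of _ _ "integral ?R g"] unfolding dist_norm .
  with 1 2 show ?thesis by linarith
qed

lemma cauchy_weight_tail: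
  "(\<lambda>m. \<integral>s. indicator (- cbox (- real m *\<^sub>R One) (real m *\<^sub>R One)) s * cauchy_weight (s::'s::euclidean_space) \<partial>lborel) \<longlonglongrightarrow> 0"
proof -
  have "(\<lambda>m. \<integral>s. indicator (- cbox (- real m *\<^sub>R One) (real m *\<^sub>R One)) s * cauchy_weight (s::'s) \<partial>lborel) \<longlonglongrightarrow> (\<integral>(s::'s). 0 \<partial>lborel)"
  proof (rule integral_dominated_convergence[where w = cauchy_weight])
    show "AE s in lborel. (\<lambda>m. indicator (- cbox (- real m *\<^sub>R One) (real m *\<^sub>R One)) s * cauchy_weight (s::'s)) \<longlonglongrightarrow> 0"
    proof (rule AE_I2)
      fix s :: 's
      obtain m0 :: nat where m0: "norm s \<le> real m0" using real_arch_simple by blast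
      have "s \<in> cbox (- real m *\<^sub>R One) (real m *\<^sub>R One)" if "m \<ge> m0" for m
        unfolding mem_box
      proof
        fix i :: 's assume i: "i \<in> Basis"
        then have "\<bar>s \<bullet> i\<bar> \<le> real m" using Basis_le_norm[OF i, of s] m0 that by linarith
        then show "- real m *\<^sub>R One \<bullet> i \<le> s \<bullet> i \<and> s \<bullet> i \<le> real m *\<^sub>R One \<bullet> i" using i by auto
      qed
      then have "\<forall>m\<ge>m0. indicator (- cbox (- real m *\<^sub>R One) (real m *\<^sub>R One)) s * cauchy_weight s = 0" by auto
      then show "(\<lambda>m. indicator (- cbox (- real m *\<^sub>R One) (real m *\<^sub>R One)) s * cauchy_weight s) \<longlonglongrightarrow> 0"
        by (intro tendsto_eventually) (auto simp: eventually_sequentially)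
    qed
    show "(\<lambda>s. indicator (- cbox (- real m *\<^sub>R One) (real m *\<^sub>R One)) s * cauchy_weight (s::'s)) \<in> borel_measurable lborel" for m
      using borel_measurable_integrable[OF integrable_cauchy_weight]
      by (intro borel_measurable_times borel_measurable_indicator) auto
    show "AE s in lborel. norm (indicator (- cbox (- real m *\<^sub>R One) (real m *\<^sub>R One)) s * cauchy_weight (s::'s)) \<le> cauchy_weight s" for m
      by (auto simp: indicator_def cauchy_weight_nonneg)
  qed (auto intro: integrable_cauchy_weight)
  then show ?thesis by simp
qed

text \<open>
  A distribution commutes with finite sums, so the identity holds for Riemann sums. Since \<open>\<Phi>\<close> is
  Schwartz jointly in both variables, the Riemann sums of \<open>s \<mapsto> \<Phi> (s, \<cdot>)\<close> approximate the parameter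
  integral in every Schwartz seminorm and, by continuity of \<open>T\<close>, the Riemann sums of
  \<open>s \<mapsto> T (\<Phi> (s, \<cdot>))\<close> approximate the integral of the pairings. An integral with values in a
  function space is replaced by \<open>riemann_sum_error\<close> at each point, with constants uniform in the point.
\<close>

lemma tempered_parameter_integral:
  fixes \<Phi> :: "'s::euclidean_space \<times> 'a::euclidean_space \<Rightarrow> complex"
  assumes T: "tempered_distribution T" and \<Phi>: "schwartz \<Phi>"
  shows "has_bochner_integral lborel (\<lambda>s. T (\<lambda>a. \<Phi> (s, a))) (T (\<lambda>a. \<integral>s. \<Phi> (s, a) \<partial>lborel))"
proof -
  obtain C N where C: "C \<ge> 0" and TC: "\<And>f K. schwartz f \<Longrightarrow> (\<And>bs x. set bs \<subseteq> Basis \<Longrightarrow> length bs \<le> N \<Longrightarrow>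
        (1 + norm x) ^ N * cmod (iter_partial bs f x) \<le> K) \<Longrightarrow> cmod (T f) \<le> C * K"
    using tempered_bound[OF T] by blast
  let ?B = "{bs. set bs \<subseteq> (Basis :: 'a set) \<and> length bs \<le> N}"
  have fin: "finite ?B" using finite_lists_length_le[of "Basis :: 'a set" N] by simp
  define D where "D bs = iter_partial (map (Pair 0) bs) \<Phi>" for bs
  have D: "schwartz (D bs)" if "bs \<in> ?B" for bs
    unfolding D_def using that by (intro schwartz_iter_partial \<Phi>) (auto simp: Basis_prod_def)
  have w: "(1 + norm a) ^ N \<le> (1 + norm (s, a)) ^ N" for s :: 's and a :: 'a
    using norm_snd_le[of a s] by (intro power_mono) auto
  have "\<exists>A. \<forall>bs\<in>?B. A bs \<ge> 0 \<and> (\<forall>(s::'s) a. (1 + norm a) ^ N * cmod (D bs (s, a)) \<le> A bs * cauchy_weight s)"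
  proof (rule bchoice, rule ballI)
    fix bs assume bs: "bs \<in> ?B"
    obtain A where A: "A \<ge> 0" "\<And>x (y::'s). norm y \<le> norm x \<Longrightarrow> (1 + norm x) ^ N * cmod (D bs x) \<le> A * cauchy_weight y"
      using schwartz_bound[OF D[OF bs], of N] by blast
    have "(1 + norm a) ^ N * cmod (D bs (s, a)) \<le> A * cauchy_weight s" for s a
      by (rule order_trans[OF mult_right_mono[OF w] A(2)]) (auto simp: norm_fst_le)
    with A(1) show "\<exists>A\<ge>0. \<forall>(s::'s) a. (1 + norm a) ^ N * cmod (D bs (s, a)) \<le> A * cauchy_weight s" by blast
  qed
  then obtain A where A: "\<And>bs. bs \<in> ?B \<Longrightarrow> A bs \<ge> 0"
    "\<And>bs s a. bs \<in> ?B \<Longrightarrow> (1 + norm a) ^ N * cmod (D bs (s, a)) \<le> A bs * cauchy_weight s" by blast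
  have "\<exists>L. \<forall>bs\<in>?B. L bs \<ge> 0 \<and> (\<forall>s s' a. (1 + norm a) ^ N * cmod (D bs (s, a) - D bs (s', a)) \<le> L bs * norm (s - s'))"
  proof (rule bchoice, rule ballI)
    fix bs assume bs: "bs \<in> ?B"
    obtain L where L: "L \<ge> 0" "\<And>x (y::'s) v. norm y \<le> norm x \<Longrightarrow>
        (1 + norm x) ^ N * cmod (frechet_derivative (D bs) (at x) v) \<le> L * cauchy_weight y * norm v"
      using schwartz_derivative_bound[OF D[OF bs], of N] by blast
    have "(1 + norm a) ^ N * cmod (D bs (s, a) - D bs (s', a)) \<le> L * norm (s - s')" for s s' a
    proof -
      let ?w = "of_real ((1 + norm a) ^ N) :: complex"
      have wn: "cmod ?w = (1 + norm a) ^ N" by (subst norm_of_real) simp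
      have "norm (?w * D bs (s, a) - ?w * D bs (s', a)) \<le> L * norm (s - s')"
      proof (rule differentiable_bound[where S = UNIV])
        fix s :: 's
        show "((\<lambda>s. ?w * D bs (s, a)) has_derivative (\<lambda>h. ?w * frechet_derivative (D bs) (at (s, a)) (h, 0))) (at s)"
          by (intro has_derivative_mult_right has_derivative_compose[OF _ schwartz_has_derivative[OF D[OF bs]]])
            (auto intro!: derivative_eq_intros)
        show "onorm (\<lambda>h. ?w * frechet_derivative (D bs) (at (s, a)) (h, 0)) \<le> L"
        proof (rule onorm_bound[OF L(1)])
          fix h :: 's
          have "norm (?w * frechet_derivative (D bs) (at (s, a)) (h, 0))
            \<le> (1 + norm (s, a)) ^ N * cmod (frechet_derivative (D bs) (at (s, a)) (h, 0))"
            unfolding norm_mult wn by (rule mult_right_mono[OF w]) simp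
          also have "\<dots> \<le> L * cauchy_weight s * norm (h, 0::'a)" by (rule L(2)) (rule norm_fst_le)
          also have "\<dots> \<le> L * 1 * norm h"
            using L(1) cauchy_weight_le_1[of s] cauchy_weight_nonneg[of s] by (intro mult_mono) (auto intro: mult_nonneg_nonneg)
          finally show "norm (?w * frechet_derivative (D bs) (at (s, a)) (h, 0)) \<le> L * norm h" by simp
        qed
      qed auto
      then show ?thesis unfolding right_diff_distrib[symmetric] norm_mult wn .
    qed
    with L(1) show "\<exists>L\<ge>0. \<forall>s s' a. (1 + norm a) ^ N * cmod (D bs (s, a) - D bs (s', a)) \<le> L * norm (s - s')" by blast
  qed
  then obtain L where L: "\<And>bs. bs \<in> ?B \<Longrightarrow> L bs \<ge> 0"
    "\<And>bs s s' a. bs \<in> ?B \<Longrightarrow> (1 + norm a) ^ N * cmod (D bs (s, a) - D bs (s', a)) \<le> L bs * norm (s - s')" by blast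
  \<comment> \<open>finitely many multi-indices enter the continuity estimate, so the constants can be summed\<close>
  define A0 where "A0 = (\<Sum>bs\<in>?B. A bs)"
  define L0 where "L0 = (\<Sum>bs\<in>?B. L bs)"
  have A0: "A0 \<ge> 0" unfolding A0_def by (intro sum_nonneg A)
  have L0: "L0 \<ge> 0" unfolding L0_def by (intro sum_nonneg L)
  have AB: "(1 + norm a) ^ N * cmod (D bs (s, a)) \<le> A0 * cauchy_weight s" if "bs \<in> ?B" for bs s a
  proof -
    have "A bs \<le> A0" unfolding A0_def by (rule member_le_sum[OF that A(1) fin]) auto
    then show ?thesis using A(2)[OF that, of a s] cauchy_weight_nonneg[of s] by (meson mult_right_mono order_trans)
  qed
  have LB: "(1 + norm a) ^ N * cmod (D bs (s, a) - D bs (s', a)) \<le> L0 * norm (s - s')" if "bs \<in> ?B" for bs s s' a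
  proof -
    have "L bs \<le> L0" unfolding L0_def by (rule member_le_sum[OF that L(1) fin]) auto
    then show ?thesis using L(2)[OF that, of a s s'] norm_ge_zero[of "s - s'"] by (meson mult_right_mono order_trans)
  qed
  note slice = schwartz_slice_fst[OF \<Phi>]
  define h where "h s = T (\<lambda>a. \<Phi> (s, a))" for s
  have hbnd: "cmod (h s) \<le> (C * A0) * cauchy_weight s" for s
    unfolding h_def mult.assoc
  proof (rule TC[OF slice])
    show "(1 + norm x) ^ N * cmod (iter_partial bs (\<lambda>a. \<Phi> (s, a)) x) \<le> A0 * cauchy_weight s"
      if "set bs \<subseteq> Basis" "length bs \<le> N" for bs x
      using AB[of bs x s] that by (simp add: iter_partial_slice[OF \<Phi>] D_def)
  qed
  have hlip: "cmod (h s - h s') \<le> (C * L0) * norm (s - s')" for s s'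
    unfolding h_def mult.assoc tempered_diff[OF T slice slice, symmetric]
  proof (rule TC)
    have eq: "(\<lambda>a. \<Phi> (s, a) - \<Phi> (s', a)) = (\<lambda>a. \<Phi> (s, a) + (-1) * \<Phi> (s', a))" by simp
    show "schwartz (\<lambda>a. \<Phi> (s, a) - \<Phi> (s', a))"
      unfolding eq by (intro schwartz_add schwartz_scale slice)
    show "(1 + norm x) ^ N * cmod (iter_partial bs (\<lambda>a. \<Phi> (s, a) - \<Phi> (s', a)) x) \<le> L0 * norm (s - s')"
      if "set bs \<subseteq> Basis" "length bs \<le> N" for bs x
    proof -
      have "iter_partial bs (\<lambda>a. \<Phi> (s, a) - \<Phi> (s', a)) x = D bs (s, x) - D bs (s', x)"
        unfolding eq iter_partial_add[OF slice schwartz_scale[OF slice] that(1)]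
          iter_partial_scale[OF slice that(1)] iter_partial_slice[OF \<Phi> that(1)] D_def by simp
      then show ?thesis using LB[of bs x s s'] that by simp
    qed
  qed
  have hm: "h \<in> borel_measurable borel"
  proof (rule borel_measurable_continuous_onI)
    have "(C * L0)-lipschitz_on UNIV h"
      by (rule lipschitz_onI) (use hlip C L0 in \<open>auto simp: dist_norm\<close>)
    then show "continuous_on UNIV h" by (rule lipschitz_on_continuous_on)
  qed
  have hint: "integrable lborel h"
    using hm hbnd by (intro Bochner_Integration.integrable_bound[OF integrable_mult_right[OF integrable_cauchy_weight, of "C * A0"]])
      (auto intro: order_trans[OF _ abs_ge_self])
  let ?I = "\<lambda>a. \<integral>s. \<Phi> (s, a) \<partial>lborel"
  let ?R = "\<lambda>m. cbox (- real m *\<^sub>R One) (real m *\<^sub>R One :: 's)"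
  let ?tail = "\<lambda>m. \<integral>s. indicator (- ?R m) s * cauchy_weight s \<partial>lborel"
  have main: "cmod (integral\<^sup>L lborel h - T ?I) \<le> 2 * C * (L0 * \<delta> * measure lborel (?R m) + A0 * ?tail m)"
    if \<delta>: "\<delta> > 0" for \<delta> m
  proof -
    obtain p where p: "p tagged_division_of (?R m)" and fine: "(\<lambda>x. ball x \<delta>) fine p"
      using fine_division_exists[OF gauge_ball[OF \<delta>]] by blast
    have finp: "finite p" using p by blast
    let ?f = "\<lambda>a. \<Sum>xK\<in>p. of_real (measure lborel (snd xK)) * \<Phi> (fst xK, a)"
    have f: "schwartz ?f" by (intro schwartz_sum finp schwartz_scale slice)
    have Tf: "T ?f = (\<Sum>(x,K)\<in>p. of_real (measure lborel K) * h x)"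
      by (subst tempered_sum[OF T finp]) (auto simp: schwartz_scale slice tempered_scale[OF T slice] h_def split_def)
    have 1: "cmod (T ?f - integral\<^sup>L lborel h) \<le> (C * L0) * \<delta> * measure lborel (?R m) + (C * A0) * ?tail m"
      unfolding Tf by (rule riemann_sum_error[OF hlip _ _ hbnd p fine]) (use C L0 A0 in auto)
    have eq: "(\<lambda>a. ?f a - ?I a) = (\<lambda>a. ?f a + (-1) * ?I a)" by simp
    have I: "schwartz ?I" by (rule schwartz_parameter_integral[OF \<Phi>])
    have "cmod (T (\<lambda>a. ?f a - ?I a)) \<le> C * (L0 * \<delta> * measure lborel (?R m) + A0 * ?tail m)"
    proof (rule TC)
      show "schwartz (\<lambda>a. ?f a - ?I a)"
        unfolding eq by (intro schwartz_add schwartz_scale f I)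
      fix bs and x :: 'a assume bs: "set bs \<subseteq> (Basis::'a set)" "length bs \<le> N"
      let ?w = "of_real ((1 + norm x) ^ N) :: complex"
      have wn: "cmod ?w = (1 + norm x) ^ N" by (subst norm_of_real) simp
      have "cmod ((\<Sum>(y,K)\<in>p. of_real (measure lborel K) * (?w * D bs (y, x))) - (\<integral>s. ?w * D bs (s, x) \<partial>lborel))
         \<le> L0 * \<delta> * measure lborel (?R m) + A0 * ?tail m"
      proof (rule riemann_sum_error[OF _ L0 A0 _ p fine])
        show "cmod (?w * D bs (s, x) - ?w * D bs (s', x)) \<le> L0 * norm (s - s')" for s s'
          unfolding right_diff_distrib[symmetric] norm_mult wn using LB bs by simp
        show "cmod (?w * D bs (s, x)) \<le> A0 * cauchy_weight s" for s
          unfolding norm_mult wn using AB bs by simp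
      qed
      moreover have "(\<Sum>(y,K)\<in>p. of_real (measure lborel K) * (?w * D bs (y, x))) - (\<integral>s. ?w * D bs (s, x) \<partial>lborel)
        = ?w * ((\<Sum>(y,K)\<in>p. of_real (measure lborel K) * D bs (y, x)) - (\<integral>s. D bs (s, x) \<partial>lborel))"
        by (simp add: right_diff_distrib sum_distrib_left split_def mult_ac)
      moreover have "(\<Sum>(y,K)\<in>p. of_real (measure lborel K) * D bs (y, x)) - (\<integral>s. D bs (s, x) \<partial>lborel)
        = iter_partial bs (\<lambda>a. ?f a - ?I a) x"
        unfolding eq iter_partial_add[OF f schwartz_scale[OF I] bs(1)] iter_partial_scale[OF I bs(1)]
          iter_partial_sum[OF finp schwartz_scale[OF slice] bs(1)] iter_partial_scale[OF slice bs(1)]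
          iter_partial_parameter_integral[OF \<Phi> bs(1)] iter_partial_slice[OF \<Phi> bs(1)] D_def
        by (simp add: split_def)
      ultimately show "(1 + norm x) ^ N * cmod (iter_partial bs (\<lambda>a. ?f a - ?I a) x) \<le> L0 * \<delta> * measure lborel (?R m) + A0 * ?tail m"
        by (simp only: norm_mult wn)
    qed
    then have 2: "cmod (T ?f - T ?I) \<le> C * (L0 * \<delta> * measure lborel (?R m) + A0 * ?tail m)"
      by (simp only: tempered_diff[OF T f I])
    have "cmod (integral\<^sup>L lborel h - T ?I) \<le> cmod (T ?f - integral\<^sup>L lborel h) + cmod (T ?f - T ?I)"
      using norm_triangle_ineq4[of "T ?f - T ?I" "T ?f - integral\<^sup>L lborel h"] by simp
    with 1 2 show ?thesis by (simp add: algebra_simps)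
  qed
  \<comment> \<open>first refine the division of a fixed box, then exhaust the space by boxes\<close>
  have "cmod (integral\<^sup>L lborel h - T ?I) \<le> 2 * C * (A0 * ?tail m)" for m
  proof (rule tendsto_lowerbound[OF _ _ trivial_limit_at_right_real])
    show "((\<lambda>\<delta>. 2 * C * (L0 * \<delta> * measure lborel (?R m) + A0 * ?tail m)) \<longlongrightarrow> 2 * C * (A0 * ?tail m)) (at_right 0)"
      by (auto intro!: tendsto_eq_intros)
    show "\<forall>\<^sub>F \<delta> in at_right 0. cmod (integral\<^sup>L lborel h - T ?I) \<le> 2 * C * (L0 * \<delta> * measure lborel (?R m) + A0 * ?tail m)"
      using main by (auto simp: eventually_at_filter)
  qed
  moreover have "(\<lambda>m. 2 * C * (A0 * ?tail m)) \<longlonglongrightarrow> 2 * C * (A0 * 0)"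
    by (intro tendsto_mult tendsto_const cauchy_weight_tail)
  ultimately have "cmod (integral\<^sup>L lborel h - T ?I) \<le> 2 * C * (A0 * 0)"
    by (intro LIMSEQ_le_const) auto
  then have "integral\<^sup>L lborel h = T ?I" by simp
  with hint show ?thesis unfolding has_bochner_integral_iff h_def by simp
qed

section \<open>Gaussians and Fourier inversion\<close>

lemma integral_scaling:
  fixes f :: "'a::euclidean_space \<Rightarrow> complex"
  assumes f: "f \<in> borel_measurable borel" and c: "c \<noteq> 0"
  shows "(\<integral>x. f x \<partial>lborel) = of_real (\<bar>c\<bar> ^ DIM('a)) * (\<integral>x. f (c *\<^sub>R x) \<partial>lborel)"
proof -
  have "(\<integral>x. f x \<partial>lborel) = (\<integral>x. f x \<partial>density (distr lborel borel (\<lambda>x. 0 + c *\<^sub>R x)) (\<lambda>_. ennreal (\<bar>c\<bar> ^ DIM('a))))"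
    using lborel_affine[OF c, of "0::'a"] by simp
  also have "\<dots> = (\<integral>x. (\<bar>c\<bar> ^ DIM('a)) *\<^sub>R f x \<partial>distr lborel borel (\<lambda>x. 0 + c *\<^sub>R x))"
    by (rule integral_density) (use f in auto)
  also have "\<dots> = (\<integral>x. (\<bar>c\<bar> ^ DIM('a)) *\<^sub>R f (0 + c *\<^sub>R x) \<partial>lborel)"
    by (rule integral_distr) (use f in auto)
  finally show ?thesis by (simp add: scaleR_conv_of_real)
qed

lemma integral_reflect:
  fixes f :: "'a::euclidean_space \<Rightarrow> complex"
  assumes "f \<in> borel_measurable borel"
  shows "(\<integral>x. f (- x) \<partial>lborel) = (\<integral>x. f x \<partial>lborel)"
  using integral_scaling[OF assms, of "-1"] by simp

lemma integral_lborel_prod: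
  fixes h :: "'a::euclidean_space \<Rightarrow> real \<Rightarrow> complex"
  assumes int: "\<And>b. b \<in> Basis \<Longrightarrow> integrable lborel (h b)"
  shows "(\<integral>x. (\<Prod>b\<in>Basis. h b (x \<bullet> b)) \<partial>lborel) = (\<Prod>b\<in>Basis. \<integral>t. h b t \<partial>lborel)"
proof -
  interpret product_sigma_finite "\<lambda>_::'a. lborel :: real measure"
    by (simp add: product_sigma_finite_def sigma_finite_lborel)
  have [measurable]: "h b \<in> borel_measurable borel" if "b \<in> Basis" for b
    using borel_measurable_integrable[OF int[OF that]] by simp
  have "(\<integral>x. (\<Prod>b\<in>Basis. h b (x \<bullet> b)) \<partial>lborel)
    = (\<integral>f. (\<Prod>b\<in>Basis. h b ((\<Sum>b\<in>Basis. f b *\<^sub>R b) \<bullet> b)) \<partial>(\<Pi>\<^sub>M b\<in>Basis. lborel))"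
    by (subst lborel_eq, rule integral_distr) auto
  also have "\<dots> = (\<integral>f. (\<Prod>b\<in>Basis. h b (f b)) \<partial>(\<Pi>\<^sub>M b\<in>Basis. lborel))"
    by (intro Bochner_Integration.integral_cong prod.cong refl) simp
  also have "\<dots> = (\<Prod>b\<in>Basis. \<integral>t. h b t \<partial>lborel)"
    by (rule product_integral_prod) (use int in auto)
  finally show ?thesis .
qed

text \<open>
  The characteristic function of the standard normal distribution, rescaled.
\<close>

lemma fourier_gaussian_real:
  fixes s k :: real
  assumes s: "s > 0"
  shows "(\<integral>x. cis (- 2 * pi * (k * x)) * of_real (exp (- pi * x\<^sup>2 / s\<^sup>2)) \<partial>lborel) = of_real (s * exp (- pi * s\<^sup>2 * k\<^sup>2))"
proof -
  \<comment> \<open>the substitution \<open>x \<mapsto> c x\<close> turns the standard normal density into the given Gaussian, and \<open>t\<close> is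
    the matching argument of the characteristic function\<close>
  define c where "c = sqrt (2 * pi) / s"
  define t where "t = - sqrt (2 * pi) * k * s"
  have c: "c > 0" using s by (simp add: c_def)
  have tc: "t * c = - 2 * pi * k"
    using s by (simp add: t_def c_def real_sqrt_mult_self flip: real_sqrt_mult)
  have c2: "c\<^sup>2 = 2 * pi / s\<^sup>2" by (simp add: c_def power_divide)
  let ?g = "\<lambda>x. (1 / sqrt (2 * pi) * exp (- x\<^sup>2 / 2)) *\<^sub>R iexp (t * x)"
  have "of_real (exp (- (t\<^sup>2) / 2)) = char std_normal_distribution t"
    by (simp add: char_std_normal_distribution)
  also have "\<dots> = (\<integral>x. ?g x \<partial>lborel)"
    unfolding char_def by (subst integral_density) (auto simp: std_normal_density_def)
  also have "\<dots> = c *\<^sub>R (\<integral>x. ?g (0 + c * x) \<partial>lborel)"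
    using lborel_integral_real_affine[of c ?g 0] c by simp
  also have "(\<integral>x. ?g (0 + c * x) \<partial>lborel)
    = (\<integral>x. of_real (1 / sqrt (2 * pi)) * (cis (- 2 * pi * (k * x)) * of_real (exp (- pi * x\<^sup>2 / s\<^sup>2))) \<partial>lborel)"
  proof (rule Bochner_Integration.integral_cong[OF refl])
    fix x :: real
    have "t * (c * x) = - 2 * pi * (k * x)" using tc by (metis mult.assoc)
    moreover have "- (c * x)\<^sup>2 / 2 = - pi * x\<^sup>2 / s\<^sup>2" by (simp add: power_mult_distrib c2)
    ultimately show "?g (0 + c * x) = of_real (1 / sqrt (2 * pi)) * (cis (- 2 * pi * (k * x)) * of_real (exp (- pi * x\<^sup>2 / s\<^sup>2)))"
      by (simp add: scaleR_conv_of_real cis_conv_exp)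
  qed
  also have "\<dots> = of_real (1 / sqrt (2 * pi)) * (\<integral>x. cis (- 2 * pi * (k * x)) * of_real (exp (- pi * x\<^sup>2 / s\<^sup>2)) \<partial>lborel)"
    by (rule integral_mult_right_zero)
  finally have "of_real (exp (- (t\<^sup>2) / 2)) = of_real (1 / s) * (\<integral>x. cis (- 2 * pi * (k * x)) * of_real (exp (- pi * x\<^sup>2 / s\<^sup>2)) \<partial>lborel)"
    by (simp add: c_def scaleR_conv_of_real)
  moreover have "- (t\<^sup>2) / 2 = - pi * s\<^sup>2 * k\<^sup>2"
    by (simp add: t_def power_mult_distrib)
  ultimately show ?thesis using s by (simp add: field_simps)
qed

lemma gaussian_scaled: "s > 0 \<Longrightarrow> schwartz (\<lambda>x::'a::euclidean_space. of_real (exp (- pi * (norm x)\<^sup>2 / s\<^sup>2)))"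
  using schwartz_gaussian[of "pi / s\<^sup>2", where 'a='a] by simp

text \<open>
  The integrand factors over the coordinates.
\<close>

lemma fourier_gaussian:
  fixes k :: "'a::euclidean_space"
  assumes s: "s > 0"
  shows "fourier (\<lambda>x. of_real (exp (- pi * (norm x)\<^sup>2 / s\<^sup>2))) k = of_real (s ^ DIM('a) * exp (- pi * s\<^sup>2 * (norm k)\<^sup>2))"
proof -
  have n: "(norm x)\<^sup>2 = (\<Sum>b\<in>Basis. (x \<bullet> b)\<^sup>2)" for x :: 'a
    by (subst power2_norm_eq_inner, subst euclidean_inner) (simp add: power2_eq_square)
  have e: "exp (\<Sum>b\<in>A. f b) = (\<Prod>b\<in>A. exp (f b :: complex))" if "finite A" for f and A :: "'a set"
    using that by (induction A rule: finite_induct) (auto simp: exp_add)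
  let ?h = "\<lambda>b x. cis (- 2 * pi * ((k \<bullet> b) * x)) * of_real (exp (- pi * x\<^sup>2 / s\<^sup>2))"
  have "fourier (\<lambda>x. of_real (exp (- pi * (norm x)\<^sup>2 / s\<^sup>2))) k = (\<integral>x. (\<Prod>b\<in>Basis. ?h b (x \<bullet> b)) \<partial>lborel)"
    unfolding fourier_alt
  proof (rule Bochner_Integration.integral_cong[OF refl])
    fix x :: 'a
    have "cis (- 2 * pi * (k \<bullet> x)) * of_real (exp (- pi * (norm x)\<^sup>2 / s\<^sup>2))
      = exp (\<i> * of_real (- 2 * pi * (k \<bullet> x)) + of_real (- pi * (norm x)\<^sup>2 / s\<^sup>2))"
      by (simp only: cis_conv_exp exp_add exp_of_real)
    also have "\<dots> = exp (\<Sum>b\<in>Basis. \<i> * of_real (- 2 * pi * ((k \<bullet> b) * (x \<bullet> b))) + of_real (- pi * (x \<bullet> b)\<^sup>2 / s\<^sup>2))"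
      unfolding n euclidean_inner[of k x]
      by (simp add: sum.distrib sum_distrib_left sum_divide_distrib sum_negf sum_subtractf)
    also have "\<dots> = (\<Prod>b\<in>Basis. ?h b (x \<bullet> b))"
      by (subst e[OF finite_Basis], simp only: cis_conv_exp exp_add exp_of_real)
    finally show "cis (- 2 * pi * (k \<bullet> x)) * of_real (exp (- pi * (norm x)\<^sup>2 / s\<^sup>2)) = (\<Prod>b\<in>Basis. ?h b (x \<bullet> b))" .
  qed
  also have "\<dots> = (\<Prod>b\<in>(Basis::'a set). \<integral>x. ?h b x \<partial>lborel)"
  proof (rule integral_lborel_prod)
    fix b :: 'a
    show "integrable lborel (?h b)"
      using integrable_cis_mult[OF gaussian_scaled[OF s, where 'a=real], of "k \<bullet> b"] by simp
  qed
  also have "\<dots> = (\<Prod>b\<in>(Basis::'a set). of_real s * exp (of_real (- pi * s\<^sup>2 * (k \<bullet> b)\<^sup>2)))"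
    unfolding fourier_gaussian_real[OF s] exp_of_real by simp
  also have "\<dots> = of_real (s ^ DIM('a)) * exp (\<Sum>b\<in>(Basis::'a set). of_real (- pi * s\<^sup>2 * (k \<bullet> b)\<^sup>2))"
    by (simp add: prod.distrib e)
  also have "\<dots> = of_real (s ^ DIM('a) * exp (- pi * s\<^sup>2 * (norm k)\<^sup>2))"
    unfolding n of_real_sum[symmetric] sum_distrib_left[symmetric] exp_of_real by simp
  finally show ?thesis .
qed

lemma fourier_duality:
  fixes f g :: "'a::euclidean_space \<Rightarrow> complex"
  assumes f: "schwartz f" and g: "schwartz g"
  shows "(\<integral>x. fourier f x * g x \<partial>lborel) = (\<integral>x. f x * fourier g x \<partial>lborel)"
proof -
  let ?F = "\<lambda>x y. cis (- 2 * pi * (x \<bullet> y)) * (f y * g x)"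
  have int: "integrable (lborel \<Otimes>\<^sub>M lborel) (\<lambda>(x, y). ?F x y)"
    unfolding lborel_prod
  proof (rule Bochner_Integration.integrable_bound[OF schwartz_integrable[OF schwartz_tensor[OF g f]]])
    show "(\<lambda>(x, y). ?F x y) \<in> borel_measurable lborel"
      unfolding cis_conv_exp case_prod_beta' using schwartz_measurable[OF f] schwartz_measurable[OF g]
      by (simp flip: lborel_prod)
  qed (auto simp: norm_mult)
  have "(\<integral>x. fourier f x * g x \<partial>lborel) = (\<integral>x. (\<integral>y. ?F x y \<partial>lborel) \<partial>lborel)"
    unfolding fourier_alt by (subst integral_mult_left_zero[symmetric]) (simp only: mult.assoc)
  also have "\<dots> = (\<integral>y. (\<integral>x. ?F x y \<partial>lborel) \<partial>lborel)"
    by (rule lborel_pair.Fubini_integral[OF int, symmetric])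
  also have "\<dots> = (\<integral>x. f x * fourier g x \<partial>lborel)"
    unfolding fourier_alt by (subst integral_mult_right_zero[symmetric]) (simp only: mult_ac inner_commute)
  finally show ?thesis .
qed

text \<open>
  Fourier inversion at the origin. Damping by a Gaussian that tends to 1 and moving the Fourier
  transform to the Gaussian turns the integral into an average of \<open>f\<close> against Gaussians that
  concentrate at 0.
\<close>

lemma integral_fourier:
  fixes f :: "'a::euclidean_space \<Rightarrow> complex"
  assumes f: "schwartz f"
  shows "(\<integral>x. fourier f x \<partial>lborel) = f 0"
proof (rule LIMSEQ_unique)
  define g where "g s x = complex_of_real (exp (- pi * (norm (x::'a))\<^sup>2 / s\<^sup>2))" for s x
  have gm: "g s \<in> borel_measurable borel" for s
    unfolding g_def by measurable
  have g1: "cmod (g s x) \<le> 1" for s x by (simp add: g_def)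
  obtain C where C: "\<And>x. cmod (f x) \<le> C" using schwartz_decay[OF f, of 0] by auto
  show "(\<lambda>m. \<integral>x. fourier f x * g (real (Suc m)) x \<partial>lborel) \<longlonglongrightarrow> (\<integral>x. fourier f x \<partial>lborel)"
  proof (rule integral_dominated_convergence[where w = "\<lambda>x. cmod (fourier f x)"])
    show "AE x in lborel. (\<lambda>m. fourier f x * g (real (Suc m)) x) \<longlonglongrightarrow> fourier f x"
    proof (rule AE_I2)
      fix x :: 'a
      have "(\<lambda>m. exp (- pi * (norm x)\<^sup>2 / (real (Suc m))\<^sup>2)) \<longlonglongrightarrow> 1"
        by real_asymp
      then have "(\<lambda>m. fourier f x * g (real (Suc m)) x) \<longlonglongrightarrow> fourier f x * of_real 1"
        unfolding g_def by (intro tendsto_mult tendsto_const tendsto_of_real)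
      then show "(\<lambda>m. fourier f x * g (real (Suc m)) x) \<longlonglongrightarrow> fourier f x" by simp
    qed
    show "AE x in lborel. norm (fourier f x * g (real (Suc m)) x) \<le> cmod (fourier f x)" for m
      using g1 by (auto simp: norm_mult mult_left_le)
  qed (use gm schwartz_measurable[OF schwartz_fourier[OF f]] schwartz_integrable[OF schwartz_fourier[OF f]] in auto)
  have eq: "(\<integral>x. fourier f x * g (real (Suc m)) x \<partial>lborel) = (\<integral>x. f (x /\<^sub>R real (Suc m)) * g 1 x \<partial>lborel)" for m
  proof -
    let ?s = "real (Suc m)"
    have gs: "schwartz (g ?s)" unfolding g_def[abs_def] by (rule gaussian_scaled) simp
    have gF: "fourier (g ?s) x = of_real (?s ^ DIM('a)) * of_real (exp (- pi * ?s\<^sup>2 * (norm x)\<^sup>2))" for x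
      unfolding g_def[abs_def] by (subst fourier_gaussian) simp_all
    have "(\<integral>x. fourier f x * g ?s x \<partial>lborel) = (\<integral>x. f x * fourier (g ?s) x \<partial>lborel)"
      by (rule fourier_duality[OF f gs])
    also have "\<dots> = of_real (\<bar>inverse ?s\<bar> ^ DIM('a)) * (\<integral>x. f (inverse ?s *\<^sub>R x) * fourier (g ?s) (inverse ?s *\<^sub>R x) \<partial>lborel)"
      by (rule integral_scaling)
        (use schwartz_measurable[OF f] schwartz_measurable[OF schwartz_fourier[OF gs]] in auto)
    also have "\<dots> = (\<integral>x. of_real (\<bar>inverse ?s\<bar> ^ DIM('a)) * (f (inverse ?s *\<^sub>R x) * fourier (g ?s) (inverse ?s *\<^sub>R x)) \<partial>lborel)"
      by (rule integral_mult_right_zero[symmetric])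
    also have "\<dots> = (\<integral>x. f (x /\<^sub>R ?s) * g 1 x \<partial>lborel)"
    proof (rule Bochner_Integration.integral_cong[OF refl])
      fix x :: 'a
      have 1: "of_real (\<bar>inverse ?s\<bar> ^ DIM('a)) * of_real (?s ^ DIM('a)) = (1 :: complex)"
        by (simp add: power_inverse flip: of_real_mult del: of_nat_Suc)
      have 2: "?s\<^sup>2 * (norm (inverse ?s *\<^sub>R x))\<^sup>2 = (norm x)\<^sup>2"
        by (simp add: power_mult_distrib power_inverse del: of_nat_Suc)
      have "fourier (g ?s) (inverse ?s *\<^sub>R x) = of_real (?s ^ DIM('a)) * g 1 x"
        unfolding gF g_def using 2 by (simp add: mult.assoc)
      then have "of_real (\<bar>inverse ?s\<bar> ^ DIM('a)) * (f (inverse ?s *\<^sub>R x) * fourier (g ?s) (inverse ?s *\<^sub>R x))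
        = (of_real (\<bar>inverse ?s\<bar> ^ DIM('a)) * of_real (?s ^ DIM('a))) * (f (x /\<^sub>R ?s) * g 1 x)"
        by (simp only: mult_ac)
      then show "of_real (\<bar>inverse ?s\<bar> ^ DIM('a)) * (f (inverse ?s *\<^sub>R x) * fourier (g ?s) (inverse ?s *\<^sub>R x)) = f (x /\<^sub>R ?s) * g 1 x"
        by (simp only: 1 mult_1)
    qed
    finally show ?thesis .
  qed
  have "(\<lambda>m. \<integral>x. f (x /\<^sub>R real (Suc m)) * g 1 x \<partial>lborel) \<longlonglongrightarrow> (\<integral>x. f 0 * g 1 x \<partial>lborel)"
  proof (rule integral_dominated_convergence[where w = "\<lambda>x. C * cmod (g 1 x)"])
    have g1s: "schwartz (g 1)" unfolding g_def[abs_def] by (rule gaussian_scaled) simp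
    then show "integrable lborel (\<lambda>x. C * cmod (g 1 x))"
      by (intro integrable_mult_right integrable_norm schwartz_integrable)
    show "AE x in lborel. (\<lambda>m. f (x /\<^sub>R real (Suc m)) * g 1 x) \<longlonglongrightarrow> f 0 * g 1 x"
    proof (rule AE_I2)
      fix x :: 'a
      have "(\<lambda>m. inverse (real (Suc m))) \<longlonglongrightarrow> 0" by real_asymp
      then have "(\<lambda>m. x /\<^sub>R real (Suc m)) \<longlonglongrightarrow> 0 *\<^sub>R x" by (intro tendsto_scaleR tendsto_const)
      moreover have "isCont f 0" using schwartz_continuous[OF f, of UNIV] by (simp add: continuous_on_eq_continuous_at)
      ultimately have "(\<lambda>m. f (x /\<^sub>R real (Suc m))) \<longlonglongrightarrow> f 0"
        by (intro isCont_tendsto_compose[of 0 f]) auto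
      then show "(\<lambda>m. f (x /\<^sub>R real (Suc m)) * g 1 x) \<longlonglongrightarrow> f 0 * g 1 x" by (intro tendsto_mult tendsto_const)
    qed
    show "AE x in lborel. norm (f (x /\<^sub>R real (Suc m)) * g 1 x) \<le> C * cmod (g 1 x)" for m
      by (auto simp: norm_mult intro!: mult_right_mono C)
    show "(\<lambda>x. f (x /\<^sub>R real (Suc m)) * g 1 x) \<in> borel_measurable lborel" for m
      using gm schwartz_measurable[OF f] by simp
  qed (use gm in auto)
  moreover have "(\<integral>x. g 1 x \<partial>lborel) = 1"
    using fourier_gaussian[of 1 "0::'a"] by (simp add: fourier_def g_def)
  ultimately show "(\<lambda>m. \<integral>x. fourier f x * g (real (Suc m)) x \<partial>lborel) \<longlonglongrightarrow> f 0"
    unfolding eq by simp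
qed

lemma fourier_translate:
  assumes f: "schwartz f"
  shows "fourier (\<lambda>y. f (y + x)) k = cis (2 * pi * (k \<bullet> x)) * fourier f k"
proof -
  have "fourier f k = (\<integral>y. cis (- 2 * pi * (k \<bullet> (y + x))) * f (y + x) \<partial>lborel)"
    unfolding fourier_alt
    by (rule integral_translation[symmetric]) (use integrable_cis_mult[OF f, of k] in auto)
  then have "cis (2 * pi * (k \<bullet> x)) * fourier f k
    = (\<integral>y. cis (2 * pi * (k \<bullet> x)) * (cis (- 2 * pi * (k \<bullet> (y + x))) * f (y + x)) \<partial>lborel)"
    by (simp only: integral_mult_right_zero)
  also have "\<dots> = fourier (\<lambda>y. f (y + x)) k"
    unfolding fourier_alt mult.assoc[symmetric] cis_mult
    by (simp add: inner_add_right distrib_left)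
  finally show ?thesis by simp
qed

lemma fourier_inversion:
  fixes f :: "'a::euclidean_space \<Rightarrow> complex"
  assumes f: "schwartz f"
  shows "fourier (\<lambda>k. fourier f (- k)) x = f x"
proof -
  have "f x = (\<integral>k. cis (2 * pi * (k \<bullet> x)) * fourier f k \<partial>lborel)"
    using integral_fourier[OF schwartz_translate[OF f, of x]] fourier_translate[OF f, of x] by simp
  also have "\<dots> = (\<integral>k. cis (2 * pi * ((- k) \<bullet> x)) * fourier f (- k) \<partial>lborel)"
    by (rule integral_reflect[symmetric])
      (use schwartz_measurable[OF schwartz_fourier[OF f]] in \<open>simp add: cis_conv_exp\<close>)
  also have "\<dots> = fourier (\<lambda>k. fourier f (- k)) x"
    unfolding fourier_alt[of "\<lambda>k. fourier f (- k)"] by (simp add: inner_commute)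
  finally show ?thesis by simp
qed

section \<open>The entire extension of the smoothed Wigner transform\<close>

lemma linear_vector_scale: "linear (\<lambda>\<zeta>. \<zeta> *s (v :: complex^'n))"
  by (auto simp: linear_iff vec_eq_iff algebra_simps)

lemma has_derivative_line:
  "((\<lambda>\<zeta>. a + \<zeta> *s (v :: complex^'n)) has_derivative (\<lambda>h. h *s v)) (at \<zeta>)"
proof -
  have "((\<lambda>\<zeta>. \<zeta> *s v) has_derivative (\<lambda>h. h *s v)) (at \<zeta>)"
    by (rule linear_imp_has_derivative[OF linear_vector_scale])
  from has_derivative_add[OF has_derivative_const this, of a] show ?thesis
    unfolding add_0 .
qed

text \<open>
  Every point of the complexified space lies on a complex line whose real points are real: the line
  through the real part in the direction of the imaginary part. On that line the function is a
  holomorphic function of one variable that vanishes on the reals, so the identity theorem in one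
  variable suffices.
\<close>

lemma entire_zero:
  assumes F: "entire F" and zero: "\<And>x k. F (of_real_vec x, of_real_vec k) = 0"
  shows "F (X, K) = 0"
proof -
  define x where "x = (\<chi> j. Re (X $ j))"
  define \<xi> where "\<xi> = (\<chi> j. Im (X $ j))"
  define k where "k = (\<chi> j. Re (K $ j))"
  define \<kappa> where "\<kappa> = (\<chi> j. Im (K $ j))"
  define l where "l \<zeta> = (of_real_vec x + \<zeta> *s of_real_vec \<xi>, of_real_vec k + \<zeta> *s of_real_vec \<kappa>)" for \<zeta>
  have "(\<lambda>\<zeta>. F (l \<zeta>)) holomorphic_on UNIV"
  proof (rule holomorphic_onI)
    fix \<zeta> :: complex
    obtain L where L: "(F has_derivative L) (at (l \<zeta>))" "\<And>c v w. L (c *s v, c *s w) = c * L (v, w)"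
      using F unfolding entire_def by blast
    have "(l has_derivative (\<lambda>h. (h *s of_real_vec \<xi>, h *s of_real_vec \<kappa>))) (at \<zeta>)"
      unfolding l_def[abs_def]
      by (rule has_derivative_Pair[OF has_derivative_line has_derivative_line])
    from has_derivative_compose[OF this L(1)]
    have "((\<lambda>\<zeta>. F (l \<zeta>)) has_field_derivative L (of_real_vec \<xi>, of_real_vec \<kappa>)) (at \<zeta>)"
      unfolding has_field_derivative_def by (rule has_derivative_eq_rhs) (simp add: fun_eq_iff L(2))
    then show "(\<lambda>\<zeta>. F (l \<zeta>)) field_differentiable (at \<zeta>)"
      unfolding field_differentiable_def by blast
  qed
  then have "F (l \<i>) = 0"
  proof (rule analytic_continuation[where U = "\<real>" and \<xi> = 0])
    show "0 islimpt (\<real> :: complex set)"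
      unfolding islimpt_approachable
    proof (intro allI impI)
      fix e :: real assume "e > 0"
      then show "\<exists>x'\<in>\<real>. x' \<noteq> 0 \<and> dist x' (0::complex) < e"
        by (intro bexI[of _ "of_real (e / 2)"]) auto
    qed
    fix \<zeta> :: complex assume "\<zeta> \<in> \<real>"
    then obtain r where r: "\<zeta> = of_real r" by (auto elim: Reals_cases)
    have "l \<zeta> = (of_real_vec (x + r *\<^sub>R \<xi>), of_real_vec (k + r *\<^sub>R \<kappa>))"
      by (simp add: l_def r of_real_vec_def vec_eq_iff)
    then show "F (l \<zeta>) = 0" by (simp add: zero)
  qed auto
  moreover have "l \<i> = (X, K)"
    by (simp add: l_def of_real_vec_def vec_eq_iff x_def \<xi>_def k_def \<kappa>_def complex_eq_iff)
  ultimately show ?thesis by simp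
qed

lemma entire_unique:
  assumes F: "entire F" and G: "entire G"
    and eq: "\<And>x k. F (of_real_vec x, of_real_vec k) = G (of_real_vec x, of_real_vec k)"
  shows "F = G"
proof -
  have "entire (\<lambda>p. F p - G p)"
    unfolding entire_def
  proof
    fix p
    obtain L where L: "(F has_derivative L) (at p)" "\<And>c v w. L (c *s v, c *s w) = c * L (v, w)"
      using F unfolding entire_def by blast
    obtain M where M: "(G has_derivative M) (at p)" "\<And>c v w. M (c *s v, c *s w) = c * M (v, w)"
      using G unfolding entire_def by blast
    show "\<exists>L. ((\<lambda>p. F p - G p) has_derivative L) (at p) \<and> (\<forall>c v w. L (c *s v, c *s w) = c * L (v, w))"
      by (rule exI[of _ "\<lambda>h. L h - M h"])
        (auto intro: has_derivative_diff L(1) M(1) simp: L(2) M(2) right_diff_distrib)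
  qed
  from entire_zero[OF this] eq show ?thesis by (auto simp: fun_eq_iff)
qed

lemma entire_extension_eq:
  assumes "entire F" "\<And>x k. F (of_real_vec x, of_real_vec k) = w (x, k)"
  shows "entire_extension w = F"
  unfolding entire_extension_def
  using assms by (intro the_equality) (auto intro!: entire_unique)

lemma schwartz_correlation:
  fixes f g :: "'a::euclidean_space \<Rightarrow> complex"
  assumes "schwartz f" "schwartz g"
  shows "schwartz (\<lambda>z. f (fst z + (1/2) *\<^sub>R snd z) * cnj (g (fst z - (1/2) *\<^sub>R snd z)))"
proof -
  let ?L = "\<lambda>z::'a\<times>'a. (fst z + (1/2) *\<^sub>R snd z, fst z - (1/2) *\<^sub>R snd z)"
  have lin: "linear ?L" by (auto simp: linear_iff algebra_simps)
  have "inj ?L"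
    unfolding linear_injective_0[OF lin]
  proof (intro allI impI)
    fix z assume z: "?L z = 0"
    then have "fst z + (1/2) *\<^sub>R snd z = 0" "fst z - (1/2) *\<^sub>R snd z = 0" by (auto simp: zero_prod_def)
    then have ab: "fst z = (1/2) *\<^sub>R snd z" "(1/2) *\<^sub>R snd z + (1/2) *\<^sub>R snd z = 0" by simp_all
    then have "snd z = 0" by (simp flip: scaleR_left_distrib)
    with ab have "fst z = 0" "snd z = 0" by simp_all
    then show "z = 0" by (simp add: prod_eq_iff)
  qed
  from schwartz_compose_affine[OF schwartz_tensor[OF assms(1) schwartz_cnj[OF assms(2)]] lin this, of 0]
  show ?thesis by simp
qed

text \<open>
  The exponent of the smoothed Wigner transform, continued to complex position and momentum
  \<open>p\<close>. It is a polynomial in \<open>p\<close>: the squared norm of the real case becomes the sum of the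
  complex squares of the coordinates.
\<close>

definition swt_exponent :: "real \<Rightarrow> real \<Rightarrow> (complex^'n::finite) \<times> (complex^'n) \<Rightarrow> 'n phase \<Rightarrow> complex" where
  "swt_exponent \<sigma>x \<sigma>k p z = (\<Sum>j\<in>UNIV.
     - 2 * of_real pi * \<i> * (snd p $ j * of_real (snd z $ j))
     - of_real (pi * \<sigma>k\<^sup>2 / 2) * (of_real (snd z $ j))\<^sup>2
     - of_real (2 * pi / \<sigma>x\<^sup>2) * (of_real (fst z $ j) - fst p $ j)\<^sup>2)"

definition swt_extended ::
  "real \<Rightarrow> real \<Rightarrow> (real^'n::finite \<Rightarrow> complex) \<Rightarrow> (real^'n \<Rightarrow> complex) \<Rightarrow> (complex^'n) \<times> (complex^'n) \<Rightarrow> complex" where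
  "swt_extended \<sigma>x \<sigma>k f g p = of_real ((sqrt 2 / \<sigma>x) ^ CARD('n)) *
     (\<integral>z. exp (swt_exponent \<sigma>x \<sigma>k p z) *
        (f (fst z + (1/2) *\<^sub>R snd z) * cnj (g (fst z - (1/2) *\<^sub>R snd z))) \<partial>lborel)"

lemma swt_extended_real:
  "swt_extended \<sigma>x \<sigma>k f g (of_real_vec x, of_real_vec k) = swt \<sigma>x \<sigma>k f g (x, k)"
proof -
  have n: "(norm v)\<^sup>2 = (\<Sum>j\<in>UNIV. (v $ j)\<^sup>2)" for v :: "real^'n"
    by (subst power2_norm_eq_inner) (simp add: inner_vec_def power2_eq_square)
  have eq: "swt_exponent \<sigma>x \<sigma>k (of_real_vec x, of_real_vec k) z = - 2 * of_real pi * \<i> * of_real (k \<bullet> snd z)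
      - of_real (pi * \<sigma>k\<^sup>2 * (norm (snd z))\<^sup>2 / 2) - of_real (2 * pi * (norm (fst z - x))\<^sup>2 / \<sigma>x\<^sup>2)" for z
    unfolding swt_exponent_def n
    by (simp add: inner_vec_def of_real_vec_def sum.distrib sum_subtractf sum_distrib_left sum_divide_distrib sum_negf)
  show ?thesis
    unfolding swt_extended_def swt_def eq case_prod_beta' mult.assoc prod.case fst_conv snd_conv by (rule refl)
qed

text \<open>
  An imaginary part of the momentum adds linear growth in \<open>y\<close>, which the Gaussian factor absorbs
  after completing the square, and an imaginary part of the position adds only a constant. So the
  exponential stays bounded, uniformly for \<open>p\<close> in a ball.
\<close>

lemma swt_exponent_bound:
  fixes p :: "(complex^'n::finite) \<times> (complex^'n)"
  assumes s: "\<sigma>x > 0" "\<sigma>k > 0" and p: "norm p \<le> R"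
  shows "Re (swt_exponent \<sigma>x \<sigma>k p z) \<le> real CARD('n) * (2 * pi * R\<^sup>2 / \<sigma>k\<^sup>2 + 2 * pi * R\<^sup>2 / \<sigma>x\<^sup>2)"
proof -
  have "Re (swt_exponent \<sigma>x \<sigma>k p z) \<le> (\<Sum>j\<in>(UNIV::'n set). 2 * pi * R\<^sup>2 / \<sigma>k\<^sup>2 + 2 * pi * R\<^sup>2 / \<sigma>x\<^sup>2)"
    unfolding swt_exponent_def Re_sum
  proof (rule sum_mono)
    fix j :: 'n
    have le: "\<bar>Im (fst p $ j)\<bar> \<le> R" "\<bar>Im (snd p $ j)\<bar> \<le> R"
      using abs_Im_le_cmod[of "fst p $ j"] abs_Im_le_cmod[of "snd p $ j"]
        Finite_Cartesian_Product.norm_nth_le[of "fst p" j] Finite_Cartesian_Product.norm_nth_le[of "snd p" j]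
        norm_fst_le[of "fst p" "snd p"] norm_snd_le[of "snd p" "fst p"] p by auto
    define \<kappa> where "\<kappa> = Im (snd p $ j)"
    define \<xi> where "\<xi> = Im (fst p $ j)"
    define y where "y = snd z $ j"
    define d where "d = fst z $ j - Re (fst p $ j)"
    have sq: "\<xi>\<^sup>2 \<le> R\<^sup>2" "\<kappa>\<^sup>2 \<le> R\<^sup>2" using le unfolding \<xi>_def \<kappa>_def by (auto simp: abs_le_square_iff[symmetric])
    \<comment> \<open>completing the square in \<open>y\<close>\<close>
    have "0 \<le> pi / (2 * \<sigma>k\<^sup>2) * (\<sigma>k\<^sup>2 * y - 2 * \<kappa>)\<^sup>2" by simp
    then have A: "2 * pi * (\<kappa> * y) - pi * \<sigma>k\<^sup>2 / 2 * y\<^sup>2 \<le> 2 * pi * \<kappa>\<^sup>2 / \<sigma>k\<^sup>2"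
      using s by (simp add: field_simps power2_eq_square)
    have B: "- (2 * pi / \<sigma>x\<^sup>2) * (d\<^sup>2 - \<xi>\<^sup>2) \<le> 2 * pi * \<xi>\<^sup>2 / \<sigma>x\<^sup>2"
      using s by (simp add: field_simps)
    let ?r = "Re (- 2 * of_real pi * \<i> * (snd p $ j * of_real (snd z $ j))
     - of_real (pi * \<sigma>k\<^sup>2 / 2) * (of_real (snd z $ j))\<^sup>2
     - of_real (2 * pi / \<sigma>x\<^sup>2) * (of_real (fst z $ j) - fst p $ j)\<^sup>2)"
    have "?r
      = 2 * pi * (\<kappa> * y) - pi * \<sigma>k\<^sup>2 / 2 * y\<^sup>2 + - (2 * pi / \<sigma>x\<^sup>2) * (d\<^sup>2 - \<xi>\<^sup>2)"
      unfolding \<kappa>_def \<xi>_def y_def d_def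
      by (simp add: power2_eq_square del: of_real_mult of_real_divide of_real_power)
    also have "\<dots> \<le> 2 * pi * \<kappa>\<^sup>2 / \<sigma>k\<^sup>2 + 2 * pi * \<xi>\<^sup>2 / \<sigma>x\<^sup>2" using A B by linarith
    also have "\<dots> \<le> 2 * pi * R\<^sup>2 / \<sigma>k\<^sup>2 + 2 * pi * R\<^sup>2 / \<sigma>x\<^sup>2"
      by (intro add_mono divide_right_mono mult_left_mono sq) auto
    finally show "?r \<le> 2 * pi * R\<^sup>2 / \<sigma>k\<^sup>2 + 2 * pi * R\<^sup>2 / \<sigma>x\<^sup>2" .
  qed
  then show ?thesis by simp
qed

lemma swt_exponent_continuous: "continuous_on UNIV (swt_exponent \<sigma>x \<sigma>k p)"
  unfolding swt_exponent_def by (intro continuous_intros)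

lemma swt_integrand_integrable:
  fixes W :: "'n::finite phase \<Rightarrow> complex"
  assumes s: "\<sigma>x > 0" "\<sigma>k > 0" and W: "schwartz W"
  shows "integrable lborel (\<lambda>z. exp (swt_exponent \<sigma>x \<sigma>k p z) * W z)"
proof -
  let ?\<kappa> = "real CARD('n) * (2 * pi * (norm p)\<^sup>2 / \<sigma>k\<^sup>2 + 2 * pi * (norm p)\<^sup>2 / \<sigma>x\<^sup>2)"
  show ?thesis
  proof (rule Bochner_Integration.integrable_bound[OF integrable_mult_right[OF schwartz_integrable[OF W], of "of_real (exp ?\<kappa>)"]])
    show "(\<lambda>z. exp (swt_exponent \<sigma>x \<sigma>k p z) * W z) \<in> borel_measurable lborel"
      unfolding measurable_lborel2
      by (intro borel_measurable_continuous_onI continuous_on_mult continuous_on_exp schwartz_continuous[OF W]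
          swt_exponent_continuous)
    show "AE z in lborel. norm (exp (swt_exponent \<sigma>x \<sigma>k p z) * W z) \<le> norm (of_real (exp ?\<kappa>) * W z)"
      unfolding norm_mult norm_exp_eq_Re norm_of_real
      using swt_exponent_bound[OF s order_refl, of p] by (intro AE_I2 mult_right_mono) auto
  qed
qed

text \<open>
  Differentiation under the integral: the derivative of the exponent grows only linearly in the
  integration variable, which the Schwartz factor absorbs, and it is complex linear in the increment.
\<close>

lemma entire_swt_extended:
  fixes f g :: "real^'n::finite \<Rightarrow> complex"
  assumes s: "\<sigma>x > 0" "\<sigma>k > 0" and f: "schwartz f" and g: "schwartz g"
  shows "entire (swt_extended \<sigma>x \<sigma>k f g)"
  unfolding entire_def
proof
  fix p0 :: "(complex^'n) \<times> (complex^'n)"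
  define W where "W = (\<lambda>z. f (fst z + (1/2) *\<^sub>R snd z) * cnj (g (fst z - (1/2) *\<^sub>R snd z)))"
  have W: "schwartz W" unfolding W_def by (rule schwartz_correlation[OF f g])
  define Q :: "(complex^'n) \<times> (complex^'n) \<Rightarrow> 'n phase \<Rightarrow> complex" where "Q = swt_exponent \<sigma>x \<sigma>k"
  define dQ where "dQ p z h = (\<Sum>j\<in>UNIV. - 2 * of_real pi * \<i> * (snd h $ j * of_real (snd z $ j))
     + of_real (4 * pi / \<sigma>x\<^sup>2) * ((of_real (fst z $ j) - fst p $ j) * fst h $ j))"
    for p h :: "(complex^'n) \<times> (complex^'n)" and z :: "'n phase"
  define R where "R = norm p0 + 1"
  define \<kappa> where "\<kappa> = real CARD('n) * (2 * pi * R\<^sup>2 / \<sigma>k\<^sup>2 + 2 * pi * R\<^sup>2 / \<sigma>x\<^sup>2)"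
  define E where "E = real CARD('n) * (2 * pi + 4 * pi / \<sigma>x\<^sup>2 * (1 + R))"
  obtain C where C: "C \<ge> 0" "\<And>z (y::'n phase). norm y \<le> norm z \<Longrightarrow> (1 + norm z) ^ 1 * cmod (W z) \<le> C * cauchy_weight y"
    using schwartz_bound[OF W, of 1] by blast
  have R: "norm p \<le> R" if "p \<in> ball p0 1" for p
    using that norm_triangle_sub[of p p0] unfolding R_def by (simp add: dist_norm norm_minus_commute)
  have R0: "R \<ge> 0" by (simp add: R_def)
  have dQ_bound: "cmod (dQ p z h) \<le> E * (1 + norm z) * norm h" if p: "p \<in> ball p0 1" for p z h
  proof -
    have "cmod (dQ p z h) \<le> (\<Sum>j\<in>(UNIV::'n set). (2 * pi + 4 * pi / \<sigma>x\<^sup>2 * (1 + R)) * (1 + norm z) * norm h)"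
      unfolding dQ_def
    proof (rule sum_norm_le)
      fix j :: 'n
      have h: "cmod (fst h $ j) \<le> norm h" "cmod (snd h $ j) \<le> norm h"
        using Finite_Cartesian_Product.norm_nth_le[of "fst h" j] Finite_Cartesian_Product.norm_nth_le[of "snd h" j]
          norm_fst_le[of "fst h" "snd h"] norm_snd_le[of "snd h" "fst h"] by auto
      have z: "\<bar>fst z $ j\<bar> \<le> norm z" "\<bar>snd z $ j\<bar> \<le> norm z"
        using Finite_Cartesian_Product.norm_nth_le[of "fst z" j] Finite_Cartesian_Product.norm_nth_le[of "snd z" j]
          norm_fst_le[of "fst z" "snd z"] norm_snd_le[of "snd z" "fst z"] by auto
      have "cmod (fst p $ j) \<le> R"
        using Finite_Cartesian_Product.norm_nth_le[of "fst p" j] norm_fst_le[of "fst p" "snd p"] R[OF p] by auto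
      then have "cmod (of_real (fst z $ j) - fst p $ j) \<le> norm z + R"
        using norm_triangle_ineq4[of "of_real (fst z $ j)" "fst p $ j"] z by simp
      also have "\<dots> \<le> (1 + R) * (1 + norm z)" using R0 by (simp add: algebra_simps)
      finally have d: "cmod (of_real (fst z $ j) - fst p $ j) \<le> (1 + R) * (1 + norm z)" .
      let ?r = "cmod (- 2 * of_real pi * \<i> * (snd h $ j * of_real (snd z $ j))
         + of_real (4 * pi / \<sigma>x\<^sup>2) * ((of_real (fst z $ j) - fst p $ j) * fst h $ j))"
      have "?r
        \<le> 2 * pi * (cmod (snd h $ j) * \<bar>snd z $ j\<bar>) + 4 * pi / \<sigma>x\<^sup>2 * (cmod (of_real (fst z $ j) - fst p $ j) * cmod (fst h $ j))"
        by (rule order_trans[OF norm_triangle_ineq]) (simp add: norm_mult norm_divide norm_power)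
      also have "\<dots> \<le> 2 * pi * (norm h * (1 + norm z)) + 4 * pi / \<sigma>x\<^sup>2 * (((1 + R) * (1 + norm z)) * norm h)"
        using R0 z by (intro add_mono mult_left_mono mult_mono h d) auto
      also have "\<dots> = (2 * pi + 4 * pi / \<sigma>x\<^sup>2 * (1 + R)) * (1 + norm z) * norm h"
        by (simp add: distrib_left distrib_right add_divide_distrib mult_ac)
      finally show "?r
         \<le> (2 * pi + 4 * pi / \<sigma>x\<^sup>2 * (1 + R)) * (1 + norm z) * norm h" .
    qed
    then show ?thesis by (simp add: E_def mult_ac)
  qed
  let ?L = "\<lambda>h. \<integral>z. exp (Q p0 z) * dQ p0 z h * W z \<partial>lborel"
  have D: "((\<lambda>p. \<integral>z. exp (Q p z) * W z \<partial>lborel) has_derivative ?L) (at p0)"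
  proof (rule has_derivative_integral[where r = 1 and g = "\<lambda>z. (exp \<kappa> * E * C) * cauchy_weight z"])
    show "integrable lborel (\<lambda>z. exp (Q p z) * W z)" for p
      unfolding Q_def by (rule swt_integrand_integrable[OF s W])
    show "((\<lambda>p. exp (Q p z) * W z) has_derivative (\<lambda>h. exp (Q p z) * dQ p z h * W z)) (at p)" for p z
    proof -
      have bl: "bounded_linear (\<lambda>p::(complex^'n) \<times> (complex^'n). fst p $ j)"
        "bounded_linear (\<lambda>p::(complex^'n) \<times> (complex^'n). snd p $ j)" for j
        by (auto intro: bounded_linear_compose[OF bounded_linear_vec_nth] bounded_linear_fst bounded_linear_snd)
      have "((\<lambda>p. Q p z) has_derivative dQ p z) (at p)"
        unfolding Q_def swt_exponent_def dQ_def
        by (rule derivative_eq_intros refl bl[THEN bounded_linear_imp_has_derivative])+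
          (simp add: fun_eq_iff algebra_simps)
      from has_derivative_mult_left[OF has_derivative_cexp[OF this], of "W z"] show ?thesis .
    qed
    show "cmod (exp (Q p z) * dQ p z h * W z) \<le> exp \<kappa> * E * C * cauchy_weight z * norm h" if p: "p \<in> ball p0 1" for p z h
    proof -
      have "cmod (exp (Q p z) * dQ p z h * W z) = exp (Re (Q p z)) * (cmod (dQ p z h) * cmod (W z))"
        by (simp add: norm_mult)
      also have "\<dots> \<le> exp \<kappa> * ((E * (1 + norm z) * norm h) * cmod (W z))"
        unfolding Q_def \<kappa>_def
        by (intro mult_mono mult_right_mono dQ_bound[OF p] exp_le_cancel_iff[THEN iffD2] swt_exponent_bound[OF s R[OF p]]) auto
      also have "\<dots> = (exp \<kappa> * E * norm h) * ((1 + norm z) ^ 1 * cmod (W z))" by simp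
      also have "\<dots> \<le> (exp \<kappa> * E * norm h) * (C * cauchy_weight z)"
        using R0 by (intro mult_left_mono C(2)) (auto simp: E_def)
      finally show ?thesis by (simp add: mult_ac)
    qed
    show "(\<lambda>z. exp (Q p0 z) * dQ p0 z h * W z) \<in> borel_measurable lborel" for h
      unfolding measurable_lborel2 Q_def dQ_def
      by (intro borel_measurable_continuous_onI continuous_on_mult continuous_on_exp schwartz_continuous[OF W] swt_exponent_continuous continuous_intros)
  qed (auto intro!: integrable_mult_right integrable_cauchy_weight)
  have dQc: "dQ p0 z (c *s v, c *s w) = c * dQ p0 z (v, w)" for z c v w
    by (simp add: dQ_def sum_distrib_left algebra_simps)
  have Lc: "?L (c *s v, c *s w) = c * ?L (v, w)" for c v w
    unfolding dQc by (subst integral_mult_right_zero[symmetric]) (simp only: mult_ac)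
  let ?c = "of_real ((sqrt 2 / \<sigma>x) ^ CARD('n)) :: complex"
  have "swt_extended \<sigma>x \<sigma>k f g = (\<lambda>p. ?c * (\<integral>z. exp (Q p z) * W z \<partial>lborel))"
    by (simp add: fun_eq_iff swt_extended_def Q_def W_def)
  then have "(swt_extended \<sigma>x \<sigma>k f g has_derivative (\<lambda>h. ?c * ?L h)) (at p0)"
    using has_derivative_mult_right[OF D, of ?c] by (simp only:)
  moreover have "\<forall>c v w. ?c * ?L (c *s v, c *s w) = c * (?c * ?L (v, w))"
    unfolding Lc by (simp only: mult_ac simp_thms)
  ultimately show "\<exists>L. (swt_extended \<sigma>x \<sigma>k f g has_derivative L) (at p0) \<and> (\<forall>c v w. L (c *s v, c *s w) = c * L (v, w))"
    by (intro exI[of _ "\<lambda>h. ?c * ?L h"] conjI)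
qed

lemma entire_extension_swt:
  fixes f g :: "real^'n::finite \<Rightarrow> complex"
  assumes "\<sigma>x > 0" "\<sigma>k > 0" "schwartz f" "schwartz g"
  shows "entire_extension (swt \<sigma>x \<sigma>k f g) = swt_extended \<sigma>x \<sigma>k f g"
  by (rule entire_extension_eq[OF entire_swt_extended[OF assms] swt_extended_real])

section \<open>Fubini for Fourier transforms\<close>

lemma integral_lborel_fst:
  fixes h :: "'a::euclidean_space \<times> 'b::euclidean_space \<Rightarrow> complex"
  assumes "integrable lborel h"
  shows "(\<integral>p. h p \<partial>lborel) = (\<integral>a. (\<integral>b. h (a, b) \<partial>lborel) \<partial>lborel)"
  using lborel_pair.integral_fst'[of h] assms by (simp add: lborel_prod)

lemma integral_lborel_snd:
  fixes h :: "'a::euclidean_space \<times> 'b::euclidean_space \<Rightarrow> complex"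
  assumes "integrable lborel h"
  shows "(\<integral>p. h p \<partial>lborel) = (\<integral>b. (\<integral>a. h (a, b) \<partial>lborel) \<partial>lborel)"
  using lborel_pair.integral_snd[of "\<lambda>a b. h (a, b)"] assms by (simp add: lborel_prod)

text \<open>
  The two orders of integration; comparing them is how Fubini is used for Schwartz functions below.
\<close>

lemma fourier_prod:
  fixes \<Phi> :: "'a::euclidean_space \<times> 'b::euclidean_space \<Rightarrow> complex"
  assumes \<Phi>: "schwartz \<Phi>"
  shows "fourier \<Phi> (\<eta>, \<kappa>) = fourier (\<lambda>a. fourier (\<lambda>b. \<Phi> (a, b)) \<kappa>) \<eta>" (is ?A)
    and "fourier \<Phi> (\<eta>, \<kappa>) = fourier (\<lambda>b. fourier (\<lambda>a. \<Phi> (a, b)) \<eta>) \<kappa>" (is ?B)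
proof -
  note int = integrable_cis_mult[OF \<Phi>, of "(\<eta>, \<kappa>)"]
  have split: "cis (- 2 * pi * ((\<eta>, \<kappa>) \<bullet> (a, b))) * \<Phi> (a, b)
      = cis (- 2 * pi * (\<eta> \<bullet> a)) * (cis (- 2 * pi * (\<kappa> \<bullet> b)) * \<Phi> (a, b))" for a b
    unfolding mult.assoc[symmetric] cis_mult by (simp add: distrib_left)
  have split': "cis (- 2 * pi * ((\<eta>, \<kappa>) \<bullet> (a, b))) * \<Phi> (a, b)
      = cis (- 2 * pi * (\<kappa> \<bullet> b)) * (cis (- 2 * pi * (\<eta> \<bullet> a)) * \<Phi> (a, b))" for a b
    unfolding mult.assoc[symmetric] cis_mult by (simp add: distrib_left add.commute)
  show ?A
    unfolding fourier_alt integral_lborel_fst[OF int] split by simp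
  show ?B
    unfolding fourier_alt integral_lborel_snd[OF int] split' by simp
qed

text \<open>
  The case of \<open>fourier_prod\<close> in which the first frequency is 0.
\<close>

lemma integral_fourier_commute:
  fixes \<Phi> :: "'s::euclidean_space \<times> 'b::euclidean_space \<Rightarrow> complex"
  assumes "schwartz \<Phi>"
  shows "(\<integral>s. fourier (\<lambda>b. \<Phi> (s, b)) \<kappa> \<partial>lborel) = fourier (\<lambda>b. \<integral>s. \<Phi> (s, b) \<partial>lborel) \<kappa>"
  using fourier_prod[OF assms, of 0 \<kappa>] by (simp add: fourier_at_0)

lemma integral_gaussian_shift:
  fixes v :: "'a::euclidean_space"
  assumes "\<sigma> > 0"
  shows "(\<integral>x. complex_of_real (exp (- 2 * pi / \<sigma>\<^sup>2 * (norm (v - x))\<^sup>2)) \<partial>lborel) = of_real ((\<sigma> / sqrt 2) ^ DIM('a))"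
proof -
  let ?\<gamma> = "\<lambda>x::'a. complex_of_real (exp (- pi * (norm x)\<^sup>2 / (\<sigma> / sqrt 2)\<^sup>2))"
  have s: "\<sigma> / sqrt 2 > 0" using assms by simp
  have "(\<integral>x. complex_of_real (exp (- 2 * pi / \<sigma>\<^sup>2 * (norm (v - x))\<^sup>2)) \<partial>lborel) = (\<integral>x. ?\<gamma> (x + - v) \<partial>lborel)"
    by (simp add: power_divide norm_minus_commute[of v] mult_ac)
  also have "\<dots> = (\<integral>x. ?\<gamma> x \<partial>lborel)"
    by (rule integral_translation[OF schwartz_measurable[OF gaussian_scaled[OF s]]])
  also have "\<dots> = of_real ((\<sigma> / sqrt 2) ^ DIM('a))"
    using fourier_gaussian[OF s, of "0::'a"] by (simp add: fourier_at_0)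
  finally show ?thesis .
qed

section \<open>The smoothed operator as a Weyl pairing\<close>

text \<open>
  The complex shifts are chosen such that the Gaussian prefactor cancels the quadratic term in \<open>S\<close>
  and completes the square \<open>(y - T)\<^sup>2\<close>. What remains is the exponent at the real point,
  translated by \<open>T\<close>, and a pure phase in \<open>S\<close>.
\<close>

lemma swt_exponent_coordinate:
  fixes x k S T u y sx sk P :: complex
  assumes "sx \<noteq> 0"
  shows "2 * P * \<i> * (S * x + T * k) - P / 2 * (sx\<^sup>2 * S\<^sup>2 + sk\<^sup>2 * T\<^sup>2)
      + (- 2 * P * \<i> * ((k - (S - \<i> * (sk\<^sup>2 * T)) / 2) * y) - P * sk\<^sup>2 / 2 * y\<^sup>2
        - 2 * P / sx\<^sup>2 * (u - (x + (T + \<i> * (sx\<^sup>2 * S)) / 2))\<^sup>2)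
    = 2 * P * \<i> * (S * (u + (y - T) / 2)) - 2 * P * \<i> * (k * (y - T))
      - P * sk\<^sup>2 / 2 * (y - T)\<^sup>2 - 2 * P / sx\<^sup>2 * (u - T / 2 - x)\<^sup>2"
proof -
  define d where "d = u - T / 2 - x"
  have eq: "u - (x + (T + \<i> * (sx\<^sup>2 * S)) / 2) = d - \<i> * sx\<^sup>2 * S / 2"
    by (simp add: d_def field_simps)
  have square: "2 * P / sx\<^sup>2 * (u - (x + (T + \<i> * (sx\<^sup>2 * S)) / 2))\<^sup>2
    = 2 * P / sx\<^sup>2 * d\<^sup>2 - 2 * P * \<i> * S * d - P * sx\<^sup>2 * S\<^sup>2 / 2"
    unfolding eq using assms by (simp add: field_simps power2_eq_square)
  have u: "u = d + T / 2 + x" by (simp add: d_def)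
  show ?thesis unfolding square unfolding u by (simp add: field_simps power2_eq_square)
qed

lemma swt_exponent_shift:
  fixes x k S T u y :: "real^'n::finite"
  assumes "\<sigma>x > 0"
  shows "2 * of_real pi * \<i> * of_real (S \<bullet> x + T \<bullet> k)
       - of_real (pi / 2 * (\<sigma>x\<^sup>2 * (norm S)\<^sup>2 + \<sigma>k\<^sup>2 * (norm T)\<^sup>2))
     + swt_exponent \<sigma>x \<sigma>k
         (\<chi> j. of_real (x $ j) + (of_real (T $ j) + \<i> * of_real (\<sigma>x\<^sup>2 * S $ j)) / 2,
          \<chi> j. of_real (k $ j) - (of_real (S $ j) - \<i> * of_real (\<sigma>k\<^sup>2 * T $ j)) / 2) (u, y)
    = \<i> * of_real (2 * pi * (S \<bullet> (u + (1/2) *\<^sub>R (y - T)))) - \<i> * of_real (2 * pi * (k \<bullet> (y - T)))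
      - of_real (pi * \<sigma>k\<^sup>2 / 2 * (norm (y - T))\<^sup>2) - of_real (2 * pi / \<sigma>x\<^sup>2 * (norm (u - (1/2) *\<^sub>R T - x))\<^sup>2)"
    (is "?L = ?R")
proof -
  have n: "(norm v)\<^sup>2 = (\<Sum>j\<in>UNIV. (v $ j)\<^sup>2)" for v :: "real^'n"
    by (subst power2_norm_eq_inner) (simp add: inner_vec_def power2_eq_square)
  let ?c = "complex_of_real"
  have "?L = (\<Sum>j\<in>UNIV. 2 * ?c pi * \<i> * (?c (S $ j) * ?c (x $ j) + ?c (T $ j) * ?c (k $ j))
      - ?c pi / 2 * ((?c \<sigma>x)\<^sup>2 * (?c (S $ j))\<^sup>2 + (?c \<sigma>k)\<^sup>2 * (?c (T $ j))\<^sup>2)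
      + (- 2 * ?c pi * \<i> * ((?c (k $ j) - (?c (S $ j) - \<i> * ((?c \<sigma>k)\<^sup>2 * ?c (T $ j))) / 2) * ?c (y $ j))
        - ?c pi * (?c \<sigma>k)\<^sup>2 / 2 * (?c (y $ j))\<^sup>2
        - 2 * ?c pi / (?c \<sigma>x)\<^sup>2 * (?c (u $ j) - (?c (x $ j) + (?c (T $ j) + \<i> * ((?c \<sigma>x)\<^sup>2 * ?c (S $ j))) / 2))\<^sup>2))"
    unfolding swt_exponent_def n inner_vec_def
    by (simp add: sum.distrib sum_subtractf sum_distrib_left sum_divide_distrib distrib_left add_divide_distrib)
  also have "\<dots> = (\<Sum>j\<in>UNIV. 2 * ?c pi * \<i> * (?c (S $ j) * (?c (u $ j) + (?c (y $ j) - ?c (T $ j)) / 2))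
      - 2 * ?c pi * \<i> * (?c (k $ j) * (?c (y $ j) - ?c (T $ j)))
      - ?c pi * (?c \<sigma>k)\<^sup>2 / 2 * (?c (y $ j) - ?c (T $ j))\<^sup>2
      - 2 * ?c pi / (?c \<sigma>x)\<^sup>2 * (?c (u $ j) - ?c (T $ j) / 2 - ?c (x $ j))\<^sup>2)"
    by (intro sum.cong refl swt_exponent_coordinate) (use assms in simp)
  also have "\<dots> = ?R"
    unfolding n inner_vec_def
    by (simp add: sum.distrib sum_subtractf sum_distrib_left sum_divide_distrib distrib_left right_diff_distrib
        diff_divide_distrib mult_ac)
  finally show ?thesis .
qed

text \<open>
  The smoothed operator applied to the transform of \<open>f, g\<close> at \<open>(x, k)\<close> pairs the symbol with
  a function of \<open>(X, K)\<close>. Up to normalisation that function is the Fourier transform of this kernel in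
  \<open>(T, z)\<close>, where \<open>T\<close> is dual to \<open>K\<close> and \<open>z\<close> is dual to \<open>k\<close>.
\<close>

definition wigner_kernel ::
  "real \<Rightarrow> real \<Rightarrow> (real^'n::finite \<Rightarrow> complex) \<Rightarrow> (real^'n \<Rightarrow> complex) \<Rightarrow> 'n phase \<times> 'n phase \<Rightarrow> complex" where
  "wigner_kernel \<sigma>x \<sigma>k f g = (\<lambda>((x, X), (T, z)).
     (f (X + (1/2) *\<^sub>R T) * cnj (g (X - (1/2) *\<^sub>R T - z))) *
     (of_real (exp (- (pi * \<sigma>k\<^sup>2 / 2) * (norm z)\<^sup>2)) *
      of_real (exp (- (2 * pi / \<sigma>x\<^sup>2) * (norm (X - (1/2) *\<^sub>R T - (1/2) *\<^sub>R z - x))\<^sup>2))))"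

text \<open>
  A tensor product of two Schwartz functions and two Gaussians in linear coordinates. The four
  arguments are linearly independent, so the kernel decays in all variables, including \<open>x\<close>.
\<close>

lemma schwartz_wigner_kernel:
  fixes f g :: "real^'n::finite \<Rightarrow> complex"
  assumes s: "\<sigma>x > 0" "\<sigma>k > 0" and f: "schwartz f" and g: "schwartz g"
  shows "schwartz (wigner_kernel \<sigma>x \<sigma>k f g)"
proof -
  let ?L = "\<lambda>v::'n phase \<times> 'n phase.
    ((snd (fst v) + (1/2) *\<^sub>R fst (snd v), snd (fst v) - (1/2) *\<^sub>R fst (snd v) - snd (snd v)),
     (snd (snd v), snd (fst v) - (1/2) *\<^sub>R fst (snd v) - (1/2) *\<^sub>R snd (snd v) - fst (fst v)))"
  have lin: "linear ?L" by (auto simp: linear_iff algebra_simps)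
  have inj: "inj ?L"
    unfolding linear_injective_0[OF lin]
  proof (intro allI impI)
    fix v assume v: "?L v = 0"
    then have 1: "snd (snd v) = 0" by (simp add: zero_prod_def)
    with v have 2: "snd (fst v) = (1/2) *\<^sub>R fst (snd v)" "snd (fst v) + (1/2) *\<^sub>R fst (snd v) = 0"
      by (auto simp: zero_prod_def)
    then have "fst (snd v) = 0" by (simp flip: scaleR_left_distrib)
    with 1 2 v show "v = 0" by (simp add: zero_prod_def prod_eq_iff)
  qed
  have "schwartz (\<lambda>p. (\<lambda>p. f (fst p) * cnj (g (snd p))) (fst p) *
     (\<lambda>p. of_real (exp (- (pi * \<sigma>k\<^sup>2 / 2) * (norm (fst p :: real^'n))\<^sup>2)) *
       of_real (exp (- (2 * pi / \<sigma>x\<^sup>2) * (norm (snd p :: real^'n))\<^sup>2))) (snd p))"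
    by (intro schwartz_tensor schwartz_cnj f g schwartz_gaussian) (use s in auto)
  from schwartz_compose_affine[OF this lin inj, of 0] show ?thesis
    by (simp add: wigner_kernel_def case_prod_beta')
qed

text \<open>
  The substitution \<open>u = q - z/2\<close>, \<open>y = z + T\<close>: a translation in each variable separately, after
  splitting the double integral.
\<close>

lemma integral_shear:
  fixes H :: "(real^'n::finite) \<Rightarrow> (real^'n) \<Rightarrow> complex"
  assumes int: "integrable lborel (\<lambda>p. H (fst p) (snd p))"
    and int': "integrable lborel (\<lambda>p. H (fst p - (1/2) *\<^sub>R snd p) (snd p + T))"
  shows "(\<integral>p. H (fst p) (snd p) \<partial>lborel) = (\<integral>p. H (fst p - (1/2) *\<^sub>R snd p) (snd p + T) \<partial>lborel)"
proof -
  have m: "(\<lambda>p. H (fst p) (snd p)) \<in> borel_measurable (borel \<Otimes>\<^sub>M borel)"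
    using borel_measurable_integrable[OF int] by (simp add: borel_prod)
  have m': "(\<lambda>(y, u). H u y) \<in> borel_measurable (lborel \<Otimes>\<^sub>M lborel)"
    using measurable_compose[OF measurable_pair_swap' m, of ] by (simp add: case_prod_beta' cong: measurable_cong_sets)
  have mu: "(\<lambda>u. H u y) \<in> borel_measurable borel" for y
    using measurable_compose[OF measurable_Pair1'[of y lborel lborel] m'] by simp
  have my: "(\<lambda>y. \<integral>u. H u y \<partial>lborel) \<in> borel_measurable borel"
    using lborel.borel_measurable_lebesgue_integral[OF m'] by simp
  have "(\<integral>p. H (fst p) (snd p) \<partial>lborel) = (\<integral>y. (\<integral>u. H u y \<partial>lborel) \<partial>lborel)"
    using integral_lborel_snd[OF int] by simp
  also have "\<dots> = (\<integral>z. (\<integral>u. H u (z + T) \<partial>lborel) \<partial>lborel)"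
    by (rule integral_translation[OF my, symmetric])
  also have "\<dots> = (\<integral>z. (\<integral>q. H (q + - ((1/2) *\<^sub>R z)) (z + T) \<partial>lborel) \<partial>lborel)"
    by (subst integral_translation[OF mu]) (rule refl)
  also have "\<dots> = (\<integral>p. H (fst p - (1/2) *\<^sub>R snd p) (snd p + T) \<partial>lborel)"
    using integral_lborel_snd[OF int'] by simp
  finally show ?thesis .
qed

abbreviation phase_kernel where
  "phase_kernel \<sigma>x \<sigma>k f g v \<equiv> fourier (\<lambda>b. wigner_kernel \<sigma>x \<sigma>k f g (fst v, b)) (snd v)"

text \<open>
  Once the exponent is simplified by \<open>swt_exponent_shift\<close>, the substitution of \<open>integral_shear\<close> makes the
  phase linear in the new variables, with frequencies \<open>- S\<close> and \<open>k\<close>.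
\<close>

lemma smoothed_op_integrand:
  fixes f g :: "real^'n::finite \<Rightarrow> complex"
  assumes s: "\<sigma>x > 0" "\<sigma>k > 0" and f: "schwartz f" and g: "schwartz g"
  shows "exp (2 * of_real pi * \<i> * of_real (S \<bullet> x + T \<bullet> k)
          - of_real (pi / 2 * (\<sigma>x\<^sup>2 * (norm S)\<^sup>2 + \<sigma>k\<^sup>2 * (norm T)\<^sup>2)))
     * swt_extended \<sigma>x \<sigma>k f g
         (\<chi> j. of_real (x $ j) + (of_real (T $ j) + \<i> * of_real (\<sigma>x\<^sup>2 * S $ j)) / 2,
          \<chi> j. of_real (k $ j) - (of_real (S $ j) - \<i> * of_real (\<sigma>k\<^sup>2 * T $ j)) / 2)
    = of_real ((sqrt 2 / \<sigma>x) ^ CARD('n)) * fourier (\<lambda>p. wigner_kernel \<sigma>x \<sigma>k f g ((x, fst p), (T, snd p))) (- S, k)"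
proof -
  let ?A = "2 * of_real pi * \<i> * of_real (S \<bullet> x + T \<bullet> k)
          - of_real (pi / 2 * (\<sigma>x\<^sup>2 * (norm S)\<^sup>2 + \<sigma>k\<^sup>2 * (norm T)\<^sup>2))"
  let ?p = "(\<chi> j. of_real (x $ j) + (of_real (T $ j) + \<i> * of_real (\<sigma>x\<^sup>2 * S $ j)) / 2,
          \<chi> j. of_real (k $ j) - (of_real (S $ j) - \<i> * of_real (\<sigma>k\<^sup>2 * T $ j)) / 2) :: (complex^'n) \<times> (complex^'n)"
  let ?W = "\<lambda>z. f (fst z + (1/2) *\<^sub>R snd z) * cnj (g (fst z - (1/2) *\<^sub>R snd z))"
  let ?B = "\<lambda>p. wigner_kernel \<sigma>x \<sigma>k f g ((x, fst p), (T, snd p))"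
  let ?c = "of_real ((sqrt 2 / \<sigma>x) ^ CARD('n)) :: complex"
  define H where "H u y = exp (?A + swt_exponent \<sigma>x \<sigma>k ?p (u, y)) * ?W (u, y)" for u y
  have H: "exp ?A * (exp (swt_exponent \<sigma>x \<sigma>k ?p z) * ?W z) = H (fst z) (snd z)" for z
    by (simp add: H_def exp_add mult.assoc)
  have HB: "H (q - (1/2) *\<^sub>R z) (z + T) = cis (- 2 * pi * ((- S, k) \<bullet> (q, z))) * ?B (q, z)" for q z
  proof -
    have 1: "q - (1/2) *\<^sub>R z + (1/2) *\<^sub>R z = q" "z + T - T = z" by simp_all
    have 2: "q - (1/2) *\<^sub>R z + (1/2) *\<^sub>R (z + T) = q + (1/2) *\<^sub>R T"
      by (simp add: scaleR_right_distrib)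
    have 3: "q - (1/2) *\<^sub>R z - (1/2) *\<^sub>R (z + T) = q - (1/2) *\<^sub>R T - z"
    proof -
      have "q - (1/2) *\<^sub>R z - (1/2) *\<^sub>R (z + T) = q - (1/2) *\<^sub>R T - ((1/2) *\<^sub>R z + (1/2) *\<^sub>R z)"
        by (simp add: scaleR_right_distrib algebra_simps)
      also have "(1/2) *\<^sub>R z + (1/2) *\<^sub>R z = z" by (simp flip: scaleR_left_distrib)
      finally show ?thesis .
    qed
    have 4: "q - (1/2) *\<^sub>R z - (1/2) *\<^sub>R T - x = q - (1/2) *\<^sub>R T - (1/2) *\<^sub>R z - x" by simp
    let ?e = "exp (\<i> * of_real (2 * pi * (S \<bullet> q)) - \<i> * of_real (2 * pi * (k \<bullet> z))
      - of_real (pi * \<sigma>k\<^sup>2 / 2 * (norm z)\<^sup>2) - of_real (2 * pi / \<sigma>x\<^sup>2 * (norm (q - (1/2) *\<^sub>R T - (1/2) *\<^sub>R z - x))\<^sup>2))"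
    let ?b = "cis (- 2 * pi * ((- S, k) \<bullet> (q, z))) * (of_real (exp (- (pi * \<sigma>k\<^sup>2 / 2) * (norm z)\<^sup>2)) *
      of_real (exp (- (2 * pi / \<sigma>x\<^sup>2) * (norm (q - (1/2) *\<^sub>R T - (1/2) *\<^sub>R z - x))\<^sup>2)))"
    have "?e
      = exp (\<i> * of_real (- 2 * pi * ((- S, k) \<bullet> (q, z))) + (of_real (- (pi * \<sigma>k\<^sup>2 / 2) * (norm z)\<^sup>2)
        + of_real (- (2 * pi / \<sigma>x\<^sup>2) * (norm (q - (1/2) *\<^sub>R T - (1/2) *\<^sub>R z - x))\<^sup>2)))"
      by (rule arg_cong[of _ _ exp]) (simp add: algebra_simps)
    also have "\<dots> = ?b"
      by (simp only: exp_add cis_conv_exp exp_of_real)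
    finally have E: "?e = ?b" .
    show ?thesis
      unfolding H_def swt_exponent_shift[OF s(1)] fst_conv snd_conv 1 2 3 4 E wigner_kernel_def prod.case
      by (simp only: mult_ac)
  qed
  have B: "schwartz ?B"
    by (rule schwartz_reparametrise[OF schwartz_wigner_kernel[OF s f g], of "\<lambda>p. ((x, fst p), (T, snd p))"])
      (auto simp: linear_iff inj_def)
  have int: "integrable lborel (\<lambda>z. H (fst z) (snd z))"
    unfolding H[symmetric]
    by (intro integrable_mult_right swt_integrand_integrable[OF s] schwartz_correlation f g)
  have HB': "H (fst p - (1/2) *\<^sub>R snd p) (snd p + T) = cis (- 2 * pi * ((- S, k) \<bullet> p)) * ?B p" for p
    using HB[of "fst p" "snd p"] by simp
  have int': "integrable lborel (\<lambda>p. H (fst p - (1/2) *\<^sub>R snd p) (snd p + T))"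
    unfolding HB' by (rule integrable_cis_mult[OF B])
  have "exp ?A * swt_extended \<sigma>x \<sigma>k f g ?p = ?c * (\<integral>z. exp ?A * (exp (swt_exponent \<sigma>x \<sigma>k ?p z) * ?W z) \<partial>lborel)"
    unfolding swt_extended_def integral_mult_right_zero by (simp only: mult_ac)
  also have "\<dots> = ?c * (\<integral>z. H (fst z) (snd z) \<partial>lborel)" unfolding H ..
  also have "\<dots> = ?c * fourier ?B (- S, k)"
    unfolding integral_shear[OF int int'] HB' fourier_alt ..
  finally show ?thesis .
qed

text \<open>
  The Fourier transform in \<open>S\<close> that is part of the definition of the smoothed operator undoes the
  Fourier transform in \<open>q\<close> of \<open>smoothed_op_integrand\<close>, by Fourier inversion; the one in \<open>T\<close>
  remains.
\<close>

lemma smoothed_op_swt: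
  fixes f g :: "real^'n::finite \<Rightarrow> complex"
  assumes s: "\<sigma>x > 0" "\<sigma>k > 0" and f: "schwartz f" and g: "schwartz g"
  shows "smoothed_op \<sigma>x \<sigma>k a (swt \<sigma>x \<sigma>k f g) (x, k) =
    a (\<lambda>p. of_real ((sqrt 2 / \<sigma>x) ^ CARD('n)) * phase_kernel \<sigma>x \<sigma>k f g ((x, fst p), (snd p, k)))"
proof -
  let ?c = "of_real ((sqrt 2 / \<sigma>x) ^ CARD('n)) :: complex"
  let ?B = "wigner_kernel \<sigma>x \<sigma>k f g"
  note B = schwartz_wigner_kernel[OF s f g]
  \<comment> \<open>\<open>G\<close> is the test function in the definition of the smoothed operator, rewritten by
    \<open>smoothed_op_integrand\<close>; \<open>P\<close> is what its Fourier transform in \<open>q\<close> is taken of\<close>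
  define G where "G = (\<lambda>(S, T). ?c * fourier (\<lambda>p. ?B ((x, fst p), (T, snd p))) (- S, k))"
  define P where "P = (\<lambda>p. fourier (\<lambda>z. ?B ((x, snd p), (fst p, z))) k)"
  have P: "schwartz P"
  proof -
    have "schwartz (\<lambda>w. ?B ((x, snd (fst w)), (fst (fst w), snd w)))"
      by (rule schwartz_reparametrise[OF B, of "\<lambda>w. ((x, snd (fst w)), (fst (fst w), snd w))"])
        (auto simp: linear_iff inj_def)
    from schwartz_slice_snd[OF schwartz_partial_fourier[OF this], of k] show ?thesis by (simp add: P_def)
  qed
  have B': "schwartz (\<lambda>p. ?B ((x, fst p), (T, snd p)))" for T
    by (rule schwartz_reparametrise[OF B, of "\<lambda>p. ((x, fst p), (T, snd p))"])
      (auto simp: linear_iff inj_def)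
  have G: "G (S, T) = ?c * fourier (\<lambda>q. P (T, q)) (- S)" for S T
    unfolding G_def prod.case fourier_prod(1)[OF B'] by (simp add: P_def)
  have Gs: "schwartz G"
  proof -
    have "schwartz (\<lambda>p. fourier (\<lambda>q. P (fst p, q)) (snd p))" by (rule schwartz_partial_fourier[OF P])
    then have "schwartz (\<lambda>p. ?c * fourier (\<lambda>q. P (snd p, q)) (- fst p))"
      by (intro schwartz_scale)
        (drule schwartz_reparametrise[of _ "\<lambda>p. (snd p, - fst p)"]; auto simp: linear_iff inj_def prod_eq_iff)
    moreover have "G = (\<lambda>p. ?c * fourier (\<lambda>q. P (snd p, q)) (- fst p))"
      using G by (auto simp: fun_eq_iff)
    ultimately show ?thesis by simp
  qed
  have "fourier G (X, K) = ?c * phase_kernel \<sigma>x \<sigma>k f g ((x, X), (K, k))" for X K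
  proof -
    have "fourier G (X, K) = fourier (\<lambda>T. fourier (\<lambda>S. G (S, T)) X) K"
      by (rule fourier_prod(2)[OF Gs])
    also have "\<dots> = fourier (\<lambda>T. ?c * P (T, X)) K"
      unfolding G fourier_scale fourier_inversion[OF schwartz_slice_fst[OF P]] ..
    also have "\<dots> = ?c * fourier (\<lambda>T. fourier (\<lambda>z. ?B ((x, X), (T, z))) k) K"
      unfolding fourier_scale P_def fst_conv snd_conv ..
    also have "\<dots> = ?c * phase_kernel \<sigma>x \<sigma>k f g ((x, X), (K, k))"
      unfolding fst_conv snd_conv fourier_prod(1)[OF schwartz_slice_fst[OF B]] ..
    finally show ?thesis .
  qed
  then have "fourier G = (\<lambda>p. ?c * phase_kernel \<sigma>x \<sigma>k f g ((x, fst p), (snd p, k)))"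
    by (simp add: fun_eq_iff)
  moreover have "smoothed_op \<sigma>x \<sigma>k a (swt \<sigma>x \<sigma>k f g) (x, k) = a (fourier G)"
    unfolding smoothed_op_def fourier_dist_def prod.case entire_extension_swt[OF s f g] smoothed_op_integrand[OF s f g] G_def ..
  ultimately show ?thesis by simp
qed

text \<open>
  The reflection \<open>z \<mapsto> - z\<close> turns the test function of the Weyl pairing into a Wigner transform,
  the form in which the marginals of the kernel appear.
\<close>

lemma weyl_op_alt:
  fixes f \<phi> :: "real^'n::finite \<Rightarrow> complex"
  assumes f: "schwartz f" and \<phi>: "schwartz \<phi>"
  shows "weyl_op a f \<phi> = a (\<lambda>p. fourier (\<lambda>T. f (fst p + (1/2) *\<^sub>R T) * \<phi> (fst p - (1/2) *\<^sub>R T)) (snd p))"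
proof -
  have "(\<integral>z. exp (2 * of_real pi * \<i> * of_real (k \<bullet> z)) * \<phi> (q + (1/2) *\<^sub>R z) * f (q - (1/2) *\<^sub>R z) \<partial>lborel)
    = fourier (\<lambda>T. f (q + (1/2) *\<^sub>R T) * \<phi> (q - (1/2) *\<^sub>R T)) k" for q k
  proof -
    let ?h = "\<lambda>z. exp (2 * of_real pi * \<i> * of_real (k \<bullet> z)) * \<phi> (q + (1/2) *\<^sub>R z) * f (q - (1/2) *\<^sub>R z)"
    have "?h \<in> borel_measurable borel"
      using schwartz_measurable[OF f] schwartz_measurable[OF \<phi>] by simp
    from integral_reflect[OF this] show ?thesis
      unfolding fourier_def by (simp add: mult_ac)
  qed
  then show ?thesis unfolding weyl_op_def by (simp add: case_prod_beta')
qed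

section \<open>Integrals over momentum, position and phase space\<close>

lemma schwartz_phase_kernel:
  fixes f g :: "real^'n::finite \<Rightarrow> complex"
  assumes s: "\<sigma>x > 0" "\<sigma>k > 0" and f: "schwartz f" and g: "schwartz g"
  shows "schwartz (phase_kernel \<sigma>x \<sigma>k f g)"
  by (rule schwartz_partial_fourier[OF schwartz_wigner_kernel[OF assms]])

lemma schwartz_wigner:
  fixes f \<phi> :: "real^'n::finite \<Rightarrow> complex"
  assumes f: "schwartz f" and \<phi>: "schwartz \<phi>"
  shows "schwartz (\<lambda>p. fourier (\<lambda>T. f (fst p + (1/2) *\<^sub>R T) * \<phi> (fst p - (1/2) *\<^sub>R T)) (snd p))"
  using schwartz_partial_fourier[OF schwartz_correlation[OF f schwartz_cnj[OF \<phi>]]] by simp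

lemma weyl_op_scale:
  assumes "tempered_distribution a" "schwartz f" "schwartz \<phi>"
  shows "weyl_op a f (\<lambda>x. c * \<phi> x) = c * weyl_op a f \<phi>"
proof -
  have "weyl_op a f (\<lambda>x. c * \<phi> x) = a (\<lambda>p. c * fourier (\<lambda>T. f (fst p + (1/2) *\<^sub>R T) * \<phi> (fst p - (1/2) *\<^sub>R T)) (snd p))"
    unfolding weyl_op_alt[OF assms(2) schwartz_scale[OF assms(3)]] fourier_scale[symmetric]
    by (simp only: mult.left_commute)
  also have "\<dots> = c * weyl_op a f \<phi>"
    unfolding weyl_op_alt[OF assms(2,3)] by (rule tempered_scale[OF assms(1) schwartz_wigner[OF assms(2,3)]])
  finally show ?thesis .
qed

lemma schwartz_gaussian_window:
  fixes g :: "'a::euclidean_space \<Rightarrow> complex"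
  assumes s: "\<sigma> > 0" and g: "schwartz g"
  shows "schwartz (\<lambda>y. of_real (exp (- 2 * pi * (norm (x - y))\<^sup>2 / \<sigma>\<^sup>2)) * cnj (g y))"
proof -
  have "schwartz (\<lambda>y::'a. complex_of_real (exp (- (2 * pi / \<sigma>\<^sup>2) * (norm y)\<^sup>2)))"
    by (rule schwartz_gaussian) (use s in simp)
  from schwartz_mult[OF schwartz_reflect[OF this, of x] schwartz_cnj[OF g]] show ?thesis by simp
qed

text \<open>
  As \<open>k\<close> is dual to \<open>z\<close>, integrating over it sets \<open>z = 0\<close>.
\<close>

lemma integral_phase_kernel_momentum:
  fixes f g :: "real^'n::finite \<Rightarrow> complex"
  assumes s: "\<sigma>x > 0" "\<sigma>k > 0" and f: "schwartz f" and g: "schwartz g"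
  shows "(\<integral>k. phase_kernel \<sigma>x \<sigma>k f g ((x, X), (K, k)) \<partial>lborel)
    = fourier (\<lambda>T. wigner_kernel \<sigma>x \<sigma>k f g ((x, X), (T, 0))) K"
proof -
  let ?B = "wigner_kernel \<sigma>x \<sigma>k f g"
  note B = schwartz_wigner_kernel[OF s f g]
  have "schwartz (\<lambda>w. ?B ((x, X), (snd w, fst w)))"
    by (rule schwartz_reparametrise[OF B, of "\<lambda>w. ((x, X), (snd w, fst w))"]) (auto simp: linear_iff inj_def)
  from schwartz_slice_snd[OF schwartz_partial_fourier[OF this], of K]
  have "schwartz (\<lambda>z. fourier (\<lambda>T. ?B ((x, X), (T, z))) K)" by simp
  from integral_fourier[OF this] show ?thesis
    unfolding fst_conv snd_conv fourier_prod(2)[OF schwartz_slice_fst[OF B]] .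
qed

text \<open>
  At \<open>z = 0\<close> one Gaussian factor of the kernel is 1 and the other is a window in
  \<open>X - T/2\<close>, the argument of \<open>g\<close>, so it becomes part of the test function.
\<close>

lemma position_marginal:
  fixes f g :: "real^'n::finite \<Rightarrow> complex"
  assumes s: "\<sigma>x > 0" "\<sigma>k > 0" and f: "schwartz f" and g: "schwartz g" and a: "tempered_distribution a"
  shows "has_bochner_integral lborel (\<lambda>k. smoothed_op \<sigma>x \<sigma>k a (swt \<sigma>x \<sigma>k f g) (x, k))
    (of_real (sqrt 2 ^ CARD('n) / \<sigma>x ^ CARD('n)) *
      weyl_op a f (\<lambda>x'. of_real (exp (- 2 * pi * (norm (x - x'))\<^sup>2 / \<sigma>x\<^sup>2)) * cnj (g x')))"
proof -
  let ?c = "of_real ((sqrt 2 / \<sigma>x) ^ CARD('n)) :: complex"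
  let ?\<phi> = "\<lambda>x'. of_real (exp (- 2 * pi * (norm (x - x'))\<^sup>2 / \<sigma>x\<^sup>2)) * cnj (g x')"
  have \<phi>: "schwartz ?\<phi>"
    by (rule schwartz_gaussian_window[OF s(1) g])
  have "schwartz (\<lambda>w. phase_kernel \<sigma>x \<sigma>k f g ((x, fst (snd w)), (snd (snd w), fst w)))"
    by (rule schwartz_reparametrise[OF schwartz_phase_kernel[OF s f g], of "\<lambda>w. ((x, fst (snd w)), (snd (snd w), fst w))"])
      (auto simp: linear_iff inj_def prod_eq_iff)
  from tempered_parameter_integral[OF a schwartz_scale[OF this, of ?c]]
  have "has_bochner_integral lborel (\<lambda>k. smoothed_op \<sigma>x \<sigma>k a (swt \<sigma>x \<sigma>k f g) (x, k))
    (a (\<lambda>p. \<integral>k. ?c * phase_kernel \<sigma>x \<sigma>k f g ((x, fst p), (snd p, k)) \<partial>lborel))"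
    unfolding smoothed_op_swt[OF s f g] by simp
  also have "(\<lambda>p. \<integral>k. ?c * phase_kernel \<sigma>x \<sigma>k f g ((x, fst p), (snd p, k)) \<partial>lborel)
    = (\<lambda>p. ?c * fourier (\<lambda>T. f (fst p + (1/2) *\<^sub>R T) * ?\<phi> (fst p - (1/2) *\<^sub>R T)) (snd p))"
    unfolding integral_mult_right_zero integral_phase_kernel_momentum[OF s f g]
    by (simp add: wigner_kernel_def norm_minus_commute mult_ac)
  also have "a \<dots> = ?c * weyl_op a f ?\<phi>"
    unfolding weyl_op_alt[OF f \<phi>] by (rule tempered_scale[OF a schwartz_wigner[OF f \<phi>]])
  finally show ?thesis by (simp add: power_divide)
qed

text \<open>
  After the momentum integral, the remaining Gaussian window in \<open>x\<close> has mass
  \<open>(\<sigma>x / sqrt 2) ^ n\<close>, which cancels the normalisation.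
\<close>

lemma phase_space_total:
  fixes f g :: "real^'n::finite \<Rightarrow> complex"
  assumes s: "\<sigma>x > 0" "\<sigma>k > 0" and f: "schwartz f" and g: "schwartz g" and a: "tempered_distribution a"
  shows "has_bochner_integral lborel (smoothed_op \<sigma>x \<sigma>k a (swt \<sigma>x \<sigma>k f g)) (weyl_op a f (\<lambda>y. cnj (g y)))"
proof -
  let ?c = "of_real ((sqrt 2 / \<sigma>x) ^ CARD('n)) :: complex"
  let ?B = "wigner_kernel \<sigma>x \<sigma>k f g"
  let ?F = "phase_kernel \<sigma>x \<sigma>k f g"
  note B = schwartz_wigner_kernel[OF s f g]
  note F = schwartz_phase_kernel[OF s f g]
  have "schwartz (\<lambda>w. ?F ((fst (fst w), fst (snd w)), (snd (snd w), snd (fst w))))"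
    by (rule schwartz_reparametrise[OF F, of "\<lambda>w. ((fst (fst w), fst (snd w)), (snd (snd w), snd (fst w)))"])
      (auto simp: linear_iff inj_def prod_eq_iff)
  from tempered_parameter_integral[OF a schwartz_scale[OF this, of ?c]]
  have "has_bochner_integral lborel (\<lambda>q. smoothed_op \<sigma>x \<sigma>k a (swt \<sigma>x \<sigma>k f g) (fst q, snd q))
    (a (\<lambda>p. \<integral>q. ?c * ?F ((fst q, fst p), (snd p, snd q)) \<partial>lborel))"
    unfolding smoothed_op_swt[OF s f g] by simp
  also have "(\<lambda>p. \<integral>q. ?c * ?F ((fst q, fst p), (snd p, snd q)) \<partial>lborel)
    = (\<lambda>p. fourier (\<lambda>T. f (fst p + (1/2) *\<^sub>R T) * cnj (g (fst p - (1/2) *\<^sub>R T))) (snd p))"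
  proof
    fix p :: "'n phase"
    obtain X K where p: "p = (X, K)" by fastforce
    have "schwartz (\<lambda>q. ?F ((fst q, X), (K, snd q)))"
      by (rule schwartz_reparametrise[OF F, of "\<lambda>q. ((fst q, X), (K, snd q))"]) (auto simp: linear_iff inj_def prod_eq_iff)
    from integral_lborel_fst[OF schwartz_integrable[OF this]]
    have "(\<integral>q. ?F ((fst q, X), (K, snd q)) \<partial>lborel) = (\<integral>x. fourier (\<lambda>T. ?B ((x, X), (T, 0))) K \<partial>lborel)"
      unfolding fst_conv[of _ "_ :: real^'n"] snd_conv[of "_ :: real^'n"] 
      by (simp add: integral_phase_kernel_momentum[OF s f g, simplified])
    also have "\<dots> = fourier (\<lambda>T. \<integral>x. ?B ((x, X), (T, 0)) \<partial>lborel) K"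
    proof -
      have "schwartz (\<lambda>w. ?B ((fst w, X), (snd w, 0)))"
        by (rule schwartz_reparametrise[OF B, of "\<lambda>w. ((fst w, X), (snd w, 0))"]) (auto simp: linear_iff inj_def prod_eq_iff)
      from integral_fourier_commute[OF this, of K] show ?thesis by simp
    qed
    also have "(\<lambda>T. \<integral>x. ?B ((x, X), (T, 0)) \<partial>lborel)
      = (\<lambda>T. of_real ((\<sigma>x / sqrt 2) ^ CARD('n)) * (f (X + (1/2) *\<^sub>R T) * cnj (g (X - (1/2) *\<^sub>R T))))"
      using integral_gaussian_shift[OF s(1), where 'a = "real^'n"]
      by (simp add: wigner_kernel_def fun_eq_iff)
    finally have "?c * (\<integral>q. ?F ((fst q, X), (K, snd q)) \<partial>lborel)
      = (?c * of_real ((\<sigma>x / sqrt 2) ^ CARD('n))) * fourier (\<lambda>T. f (X + (1/2) *\<^sub>R T) * cnj (g (X - (1/2) *\<^sub>R T))) K"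
      unfolding fourier_scale by (simp only: mult.assoc)
    moreover have "?c * of_real ((\<sigma>x / sqrt 2) ^ CARD('n)) = 1"
      unfolding of_real_mult[symmetric] power_mult_distrib[symmetric] using s(1) by simp
    ultimately show "(\<integral>q. ?c * ?F ((fst q, fst p), (snd p, snd q)) \<partial>lborel)
      = fourier (\<lambda>T. f (fst p + (1/2) *\<^sub>R T) * cnj (g (fst p - (1/2) *\<^sub>R T))) (snd p)"
      unfolding integral_mult_right_zero p fst_conv snd_conv by (simp only: mult_1)
  qed
  finally show ?thesis
    unfolding weyl_op_alt[OF f schwartz_cnj[OF g]] by simp
qed

text \<open>
  A Gaussian window in frequency corresponds to a Gaussian weight on displacements in position. With
  the complex conjugate of \<open>fourier g\<close> written as the transform of a reflected function, this is
  the duality \<open>fourier_duality\<close> and the transform of a translated Gaussian.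
\<close>

lemma gaussian_momentum_window:
  fixes g :: "real^'n::finite \<Rightarrow> complex"
  assumes s: "\<sigma>k > 0" and g: "schwartz g"
  shows "fourier (\<lambda>z. cnj (g (p - z)) * of_real (exp (- (pi * \<sigma>k\<^sup>2 / 2) * (norm z)\<^sup>2))) k
    = of_real ((sqrt 2 / \<sigma>k) ^ CARD('n)) *
      fourier (\<lambda>k'. of_real (exp (- 2 * pi * (norm (k - k'))\<^sup>2 / \<sigma>k\<^sup>2)) * cnj (fourier g k')) p"
    (is "_ = _ * fourier ?w p")
proof -
  let ?s = "\<sigma>k / sqrt 2"
  have s': "?s > 0" using s by simp
  let ?\<gamma> = "\<lambda>y::real^'n. complex_of_real (exp (- pi * (norm y)\<^sup>2 / ?s\<^sup>2))"
  have \<gamma>: "schwartz ?\<gamma>" by (rule gaussian_scaled[OF s'])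
  have cg: "cnj (fourier g k') = fourier (\<lambda>r. cnj (g (0 - r))) k'" for k'
  proof -
    have "cnj (fourier g k') = (\<integral>x. cis (2 * pi * (k' \<bullet> x)) * cnj (g x) \<partial>lborel)"
      unfolding fourier_alt by (subst Bochner_Integration.integral_cnj[symmetric]) (simp add: cis_cnj del: Bochner_Integration.integral_cnj)
    also have "\<dots> = (\<integral>x. cis (2 * pi * (k' \<bullet> (- x))) * cnj (g (- x)) \<partial>lborel)"
      by (rule integral_reflect[symmetric])
        (use schwartz_measurable[OF schwartz_cnj[OF g]] in \<open>simp add: cis_conv_exp\<close>)
    finally show ?thesis by (simp add: fourier_alt)
  qed
  have tr: "cis (- 2 * pi * (p \<bullet> k')) * cnj (fourier g k') = fourier (\<lambda>r. cnj (g (p - r))) k'" for k'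
  proof -
    have "fourier (\<lambda>r. cnj (g (0 - (r + - p)))) k' = cis (2 * pi * (k' \<bullet> (- p))) * fourier (\<lambda>r. cnj (g (0 - r))) k'"
      by (rule fourier_translate[OF schwartz_reflect[OF schwartz_cnj[OF g]]])
    then show ?thesis unfolding cg by (simp add: inner_commute)
  qed
  have "fourier ?w p
    = (\<integral>k'. fourier (\<lambda>r. cnj (g (p - r))) k' * ?\<gamma> (k' + - k) \<partial>lborel)"
    unfolding fourier_alt[of ?w] tr[symmetric]
    by (simp add: power_divide norm_minus_commute[of k] mult_ac)
  also have "\<dots> = (\<integral>r. cnj (g (p - r)) * fourier (\<lambda>k'. ?\<gamma> (k' + - k)) r \<partial>lborel)"
    by (rule fourier_duality[OF schwartz_reflect[OF schwartz_cnj[OF g]] schwartz_translate[OF \<gamma>]])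
  also have "\<dots> = (\<integral>r. of_real (?s ^ CARD('n)) * (cis (- 2 * pi * (k \<bullet> r)) * (cnj (g (p - r)) * of_real (exp (- (pi * \<sigma>k\<^sup>2 / 2) * (norm r)\<^sup>2)))) \<partial>lborel)"
    unfolding fourier_translate[OF \<gamma>] fourier_gaussian[OF s']
    by (simp add: power_divide inner_commute mult_ac)
  also have "\<dots> = of_real (?s ^ CARD('n)) * fourier (\<lambda>z. cnj (g (p - z)) * of_real (exp (- (pi * \<sigma>k\<^sup>2 / 2) * (norm z)\<^sup>2))) k"
    unfolding fourier_alt by (rule integral_mult_right_zero)
  finally have "of_real ((sqrt 2 / \<sigma>k) ^ CARD('n)) *
      fourier ?w p
    = of_real ((sqrt 2 / \<sigma>k) ^ CARD('n) * ?s ^ CARD('n)) * fourier (\<lambda>z. cnj (g (p - z)) * of_real (exp (- (pi * \<sigma>k\<^sup>2 / 2) * (norm z)\<^sup>2))) k"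
    by (simp only: of_real_mult mult.assoc)
  moreover have "(sqrt 2 / \<sigma>k) ^ CARD('n) * ?s ^ CARD('n) = 1"
    using s by (simp flip: power_mult_distrib)
  ultimately show ?thesis by simp
qed

text \<open>
  Integrating over \<open>x\<close> removes the Gaussian that contains \<open>x\<close>. What remains of the \<open>z\<close>-integral
  is, by \<open>gaussian_momentum_window\<close>, a multiple of the Fourier transform of the windowed test function,
  evaluated at the argument of \<open>g\<close>.
\<close>

lemma momentum_marginal:
  fixes f g :: "real^'n::finite \<Rightarrow> complex"
  assumes s: "\<sigma>x > 0" "\<sigma>k > 0" and f: "schwartz f" and g: "schwartz g" and a: "tempered_distribution a"
  shows "has_bochner_integral lborel (\<lambda>x. smoothed_op \<sigma>x \<sigma>k a (swt \<sigma>x \<sigma>k f g) (x, k))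
    (of_real (sqrt 2 ^ CARD('n) / \<sigma>k ^ CARD('n)) *
      fourier_dist (weyl_op a f) (\<lambda>k'. of_real (exp (- 2 * pi * (norm (k - k'))\<^sup>2 / \<sigma>k\<^sup>2)) * cnj (fourier g k')))"
proof -
  let ?c = "of_real ((sqrt 2 / \<sigma>x) ^ CARD('n)) :: complex"
  let ?ck = "of_real ((sqrt 2 / \<sigma>k) ^ CARD('n)) :: complex"
  let ?B = "wigner_kernel \<sigma>x \<sigma>k f g"
  let ?F = "phase_kernel \<sigma>x \<sigma>k f g"
  let ?\<psi> = "\<lambda>k'. of_real (exp (- 2 * pi * (norm (k - k'))\<^sup>2 / \<sigma>k\<^sup>2)) * cnj (fourier g k')"
  note B = schwartz_wigner_kernel[OF s f g]
  note F = schwartz_phase_kernel[OF s f g]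
  have \<psi>: "schwartz ?\<psi>"
    by (rule schwartz_gaussian_window[OF s(2) schwartz_fourier[OF g]])
  have "schwartz (\<lambda>w. ?F ((fst w, fst (snd w)), (snd (snd w), k)))"
    by (rule schwartz_reparametrise[OF F, of "\<lambda>w. ((fst w, fst (snd w)), (snd (snd w), k))"])
      (auto simp: linear_iff inj_def prod_eq_iff)
  from tempered_parameter_integral[OF a schwartz_scale[OF this, of ?c]]
  have "has_bochner_integral lborel (\<lambda>x. smoothed_op \<sigma>x \<sigma>k a (swt \<sigma>x \<sigma>k f g) (x, k))
    (a (\<lambda>p. \<integral>x. ?c * ?F ((x, fst p), (snd p, k)) \<partial>lborel))"
    unfolding smoothed_op_swt[OF s f g] by simp
  also have "(\<lambda>p. \<integral>x. ?c * ?F ((x, fst p), (snd p, k)) \<partial>lborel)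
    = (\<lambda>p. fourier (\<lambda>T. f (fst p + (1/2) *\<^sub>R T) * (?ck * fourier ?\<psi> (fst p - (1/2) *\<^sub>R T))) (snd p))"
  proof
    fix p :: "'n phase"
    obtain X K where p: "p = (X, K)" by fastforce
    let ?h = "\<lambda>b. f (X + (1/2) *\<^sub>R fst b) * (cnj (g (X - (1/2) *\<^sub>R fst b - snd b)) * of_real (exp (- (pi * \<sigma>k\<^sup>2 / 2) * (norm (snd b))\<^sup>2)))"
    have h: "schwartz ?h"
    proof -
      have "schwartz (\<lambda>p. f (fst p) * ((\<lambda>q. cnj (g (fst q)) * of_real (exp (- (pi * \<sigma>k\<^sup>2 / 2) * (norm (snd q :: real^'n))\<^sup>2))) (snd p)))"
        by (intro schwartz_tensor schwartz_cnj f g schwartz_gaussian) (use s in auto)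
      then have "schwartz (\<lambda>b::'n phase. (\<lambda>p. f (fst p) * ((\<lambda>q. cnj (g (fst q)) * of_real (exp (- (pi * \<sigma>k\<^sup>2 / 2) * (norm (snd q :: real^'n))\<^sup>2))) (snd p)))
          (X + (1/2) *\<^sub>R fst b, (X - (1/2) *\<^sub>R fst b - snd b, snd b)))"
        by (rule schwartz_reparametrise) (auto simp: linear_iff inj_def prod_eq_iff algebra_simps)
      then show ?thesis by simp
    qed
    have "(\<integral>x. ?F ((x, X), (K, k)) \<partial>lborel) = fourier (\<lambda>b. \<integral>x. ?B ((x, X), b) \<partial>lborel) (K, k)"
    proof -
      have "schwartz (\<lambda>w. ?B ((fst w, X), snd w))"
        by (rule schwartz_reparametrise[OF B, of "\<lambda>w. ((fst w, X), snd w)"]) (auto simp: linear_iff inj_def prod_eq_iff)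
      from integral_fourier_commute[OF this, of "(K, k)"] show ?thesis by simp
    qed
    also have "(\<lambda>b. \<integral>x. ?B ((x, X), b) \<partial>lborel) = (\<lambda>b. of_real ((\<sigma>x / sqrt 2) ^ CARD('n)) * ?h b)"
      using integral_gaussian_shift[OF s(1), where 'a = "real^'n"]
      by (simp add: wigner_kernel_def fun_eq_iff case_prod_beta' mult_ac)
    finally have "?c * (\<integral>x. ?F ((x, X), (K, k)) \<partial>lborel) = (?c * of_real ((\<sigma>x / sqrt 2) ^ CARD('n))) * fourier ?h (K, k)"
      unfolding fourier_scale by (simp only: mult.assoc)
    moreover have "?c * of_real ((\<sigma>x / sqrt 2) ^ CARD('n)) = 1"
      unfolding of_real_mult[symmetric] power_mult_distrib[symmetric] using s(1) by simp
    moreover have "fourier ?h (K, k) = fourier (\<lambda>T. f (X + (1/2) *\<^sub>R T) * (?ck * fourier ?\<psi> (X - (1/2) *\<^sub>R T))) K"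
      unfolding fourier_prod(1)[OF h] fst_conv snd_conv fourier_scale gaussian_momentum_window[OF s(2) g] ..
    ultimately show "(\<integral>x. ?c * ?F ((x, fst p), (snd p, k)) \<partial>lborel)
      = fourier (\<lambda>T. f (fst p + (1/2) *\<^sub>R T) * (?ck * fourier ?\<psi> (fst p - (1/2) *\<^sub>R T))) (snd p)"
      unfolding integral_mult_right_zero p fst_conv snd_conv by (simp only: mult_1)
  qed
  also have "a \<dots> = weyl_op a f (\<lambda>y. ?ck * fourier ?\<psi> y)"
    by (rule weyl_op_alt[OF f schwartz_scale[OF schwartz_fourier[OF \<psi>]], symmetric])
  also have "\<dots> = ?ck * fourier_dist (weyl_op a f) ?\<psi>"
    unfolding fourier_dist_def by (rule weyl_op_scale[OF a f schwartz_fourier[OF \<psi>]])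
  finally show ?thesis by (simp add: power_divide)
qed

theorem corollary4p8:
  fixes \<sigma>x \<sigma>k :: real
    and M :: "('n::finite phase functional)^'d^'d::finite"
    and u :: "real^'n \<Rightarrow> real \<Rightarrow> complex^'d"
    and t :: real
  assumes "\<sigma>x > 0" and "\<sigma>k > 0"
    and "\<And>i j. tempered_distribution (M $ i $ j)"
    and "\<And>s i. schwartz (\<lambda>x. u x s $ i)"
  shows "has_bochner_integral lborel
           (smoothed_observable \<sigma>x \<sigma>k M (\<lambda>y. u y t))
           (observable M (\<lambda>y. u y t)) \<and>
         (\<forall>x. has_bochner_integral lborel
           (\<lambda>k. smoothed_observable \<sigma>x \<sigma>k M (\<lambda>y. u y t) (x, k))
           (of_real (sqrt 2 ^ CARD('n) / \<sigma>x ^ CARD('n)) *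
              vec_pairing (weyl_matrix_op M (\<lambda>y. u y t))
                (\<lambda>x'. of_real (exp (- 2 * pi * (norm (x - x'))\<^sup>2 / \<sigma>x\<^sup>2)) *s cnj_vec (u x' t)))) \<and>
         (\<forall>k. has_bochner_integral lborel
           (\<lambda>x. smoothed_observable \<sigma>x \<sigma>k M (\<lambda>y. u y t) (x, k))
           (of_real (sqrt 2 ^ CARD('n) / \<sigma>k ^ CARD('n)) *
              vec_pairing (vec_fourier_dist (weyl_matrix_op M (\<lambda>y. u y t)))
                (\<lambda>k'. of_real (exp (- 2 * pi * (norm (k - k'))\<^sup>2 / \<sigma>k\<^sup>2)) *s
                       cnj_vec (vec_fourier (\<lambda>y. u y t) k'))))"
proof -
  note s = assms(1,2)
  have a: "tempered_distribution (M $ i $ j)" for i j by (rule assms(3))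
  have v: "schwartz (\<lambda>y. u y t $ i)" for i by (rule assms(4))
  have obs: "smoothed_observable \<sigma>x \<sigma>k M (\<lambda>y. u y t) p = (\<Sum>i\<in>UNIV. \<Sum>j\<in>UNIV.
      smoothed_op \<sigma>x \<sigma>k (M $ i $ j) (swt \<sigma>x \<sigma>k (\<lambda>y. u y t $ j) (\<lambda>y. u y t $ i)) p)" for p
    by (simp add: smoothed_observable_def trace_def op_matrix_mult_def smoothed_op_matrix_def swt_matrix_def)
  have 1: "has_bochner_integral lborel (smoothed_observable \<sigma>x \<sigma>k M (\<lambda>y. u y t)) (observable M (\<lambda>y. u y t))"
    unfolding obs[abs_def] observable_def vec_pairing_def weyl_matrix_op_def cnj_vec_def vec_lambda_beta
    by (intro has_bochner_integral_sum phase_space_total[OF s v v a])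
  have 2: "has_bochner_integral lborel (\<lambda>k. smoothed_observable \<sigma>x \<sigma>k M (\<lambda>y. u y t) (x, k))
           (of_real (sqrt 2 ^ CARD('n) / \<sigma>x ^ CARD('n)) *
              vec_pairing (weyl_matrix_op M (\<lambda>y. u y t))
                (\<lambda>x'. of_real (exp (- 2 * pi * (norm (x - x'))\<^sup>2 / \<sigma>x\<^sup>2)) *s cnj_vec (u x' t)))" for x
    unfolding obs vec_pairing_def weyl_matrix_op_def cnj_vec_def vec_lambda_beta vector_smult_component sum_distrib_left
    by (intro has_bochner_integral_sum position_marginal[OF s v v a])
  have 3: "has_bochner_integral lborel (\<lambda>x. smoothed_observable \<sigma>x \<sigma>k M (\<lambda>y. u y t) (x, k))
           (of_real (sqrt 2 ^ CARD('n) / \<sigma>k ^ CARD('n)) *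
              vec_pairing (vec_fourier_dist (weyl_matrix_op M (\<lambda>y. u y t)))
                (\<lambda>k'. of_real (exp (- 2 * pi * (norm (k - k'))\<^sup>2 / \<sigma>k\<^sup>2)) *s
                       cnj_vec (vec_fourier (\<lambda>y. u y t) k')))" for k
    unfolding obs vec_pairing_def weyl_matrix_op_def cnj_vec_def vec_fourier_def vec_fourier_dist_def
      fourier_dist_def vec_lambda_beta vector_smult_component sum_distrib_left
    by (intro has_bochner_integral_sum momentum_marginal[OF s v v a, unfolded fourier_dist_def])
  show ?thesis using 1 2 3 by blast
qed

end
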